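(* Let $g\in H(\mathbb{D})$ and let $v\in\widehat{\mathcal{D}}$ satisfy the two conditions $$\sup_{0<r<1}\left(\int_r^1\frac{\widehat{v}(s)}{(1-s)^2}\,ds\right)^{1/2}\left(\int_0^r\frac{1}{\widehat{v}(s)}\,ds\right)^{1/2}<\infty$$ and $$\sup_{0<r<1}\left(\int_0^r\frac{\widehat{v}(s)}{(1-s)^4}\,ds\right)^{1/2}\left(\int_r^1\frac{(1-s)^2}{\widehat{v}(s)}\,ds\right)^{1/2}<\infty.$$ Then $\mathcal{H}_g$ is compact on $\mathcal{D}_v$ if and only if $g\in b(2,\infty)$.
   Context: $\mathbb{D}$ is the open unit disc and $H(\mathbb{D})$ the space of analytic functions on $\mathbb{D}$; $dA=\frac{dx\,dy}{\pi}$. A weight is a function $v:\mathbb{D}\to(0,\infty)$ integrable over $\mathbb{D}$ with respect to $dA$; it is radial if $v(z)=v(|z|)$ for all $z$. For a radial weight $v$ put $\widehat{v}(r)=\int_r^1 v(s)\,ds$. The class $\widehat{\mathcal{D}}$ consists of the radial weights $v$ with $\sup_{0<r<1}\frac{\widehat v(r)}{\widehat v\left(\frac{1+r}{2}\right)}<\infty$. The weighted Dirichlet space $\mathcal{D}_v$ consists of $f\in H(\mathbb{D})$ with $\|f\|_{\mathcal{D}_v}^2=|f(0)|^2+\int_{\mathbb{D}}|f'(z)|^2v(z)\,dA(z)<\infty$; it is a Hilbert space. For $g\in H(\mathbb{D})$, the generalized Hilbert operator is $\mathcal{H}_g(f)(z)=\int_0^1 f(t)g'(tz)\,dt$. (The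 condition $\int_0^1\frac{(1-s)^2}{\widehat v(s)}\,ds<\infty$, which follows from the second hypothesis, ensures that the integral defines an analytic function on $\mathbb{D}$ for each $f\in\mathcal{D}_v$.) With $M_2(r,f)=\left(\frac{1}{2\pi}\int_{-\pi}^{\pi}|f(re^{i\theta})|^2\,d\theta\right)^{1/2}$, the space $b(2,\infty)$ consists of $g\in H(\mathbb{D})$ with $\lim_{r\to1^-}M_2(r,g')(1-r)^{1/2}=0$. *)

theory Defs
  imports "HOL-Complex_Analysis.Complex_Analysis"
begin

text \<open>Functions on the unit disc are total functions on \<^typ>\<open>complex\<close>; their values outside
  \<^term>\<open>ball (0::complex) 1\<close> are irrelevant to every notion below.\<close>

definition weight :: "(complex \<Rightarrow> real) \<Rightarrow> bool" where
  "weight v \<longleftrightarrow> (\<forall>z\<in>ball 0 1. 0 < v z) \<and> set_integrable lebesgue (ball 0 1) v"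

definition radial_weight :: "(complex \<Rightarrow> real) \<Rightarrow> bool" where
  "radial_weight v \<longleftrightarrow> weight v \<and> (\<forall>z\<in>ball 0 1. v z = v (of_real (cmod z)))"

text \<open>For a radial weight the following integral is finite and positive for each \<open>0 < r < 1\<close>.
  At \<open>r = 0\<close> it may diverge (for example if \<open>v z = 1 / cmod z\<close>), but that value
  is never relevant.\<close>

definition vhat :: "(complex \<Rightarrow> real) \<Rightarrow> real \<Rightarrow> real" where
  "vhat v r = (LINT s:{r<..<1}|lebesgue. v (of_real s))"

definition D_hat :: "(complex \<Rightarrow> real) set" where
  "D_hat = {v. radial_weight v \<and> bdd_above ((\<lambda>r. vhat v r / vhat v ((1 + r) / 2)) ` {0<..<1})}"

text \<open>The square root on the extended half-line; it allows a supremum of products of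
  possibly infinite integrals to be written without integrability side conditions.\<close>

definition ennsqrt :: "ennreal \<Rightarrow> ennreal" where
  "ennsqrt x = (if x = \<infinity> then \<infinity> else ennreal (sqrt (enn2real x)))"

definition dirichlet_space :: "(complex \<Rightarrow> real) \<Rightarrow> (complex \<Rightarrow> complex) set" where
  "dirichlet_space v = {f. f holomorphic_on ball 0 1 \<and>
     set_integrable lebesgue (ball 0 1) (\<lambda>z. (cmod (deriv f z))\<^sup>2 * v z)}"

text \<open>The factor \<open>1 / pi\<close> comes from the normalised area measure \<open>dA = dx dy / pi\<close>.\<close>

definition dirichlet_norm :: "(complex \<Rightarrow> real) \<Rightarrow> (complex \<Rightarrow> complex) \<Rightarrow> real" where
  "dirichlet_norm v f = sqrt ((cmod (f 0))\<^sup>2 +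
     (1 / pi) * (LINT z:ball 0 1|lebesgue. (cmod (deriv f z))\<^sup>2 * v z))"

text \<open>The integral is meaningful only if it converges absolutely (otherwise it is \<open>0\<close>);
  finiteness of the integral of \<open>(1 - s)\<^sup>2 / vhat v s\<close> over \<open>(0, 1)\<close> ensures this for
  \<open>f\<close> in the Dirichlet space of a weight \<open>v\<close> in \<open>D_hat\<close> and \<open>z\<close> in the disc.\<close>

definition hilbert_op :: "(complex \<Rightarrow> complex) \<Rightarrow> (complex \<Rightarrow> complex) \<Rightarrow> complex \<Rightarrow> complex" where
  "hilbert_op g f z = (LINT t:{0<..<1::real}|lebesgue. f (of_real t) * deriv g (of_real t * z))"

text \<open>Sequential form of compactness for linear operators. The norm does not see values outside
  the disc, so limits need no quotient by agreement on the disc.\<close>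

definition compact_on_dirichlet ::
    "(complex \<Rightarrow> real) \<Rightarrow> ((complex \<Rightarrow> complex) \<Rightarrow> (complex \<Rightarrow> complex)) \<Rightarrow> bool" where
  "compact_on_dirichlet v T \<longleftrightarrow>
     (\<forall>f\<in>dirichlet_space v. T f \<in> dirichlet_space v) \<and>
     (\<forall>F :: nat \<Rightarrow> complex \<Rightarrow> complex.
        (\<forall>n. F n \<in> dirichlet_space v) \<and> (\<exists>C. \<forall>n. dirichlet_norm v (F n) \<le> C) \<longrightarrow>
        (\<exists>\<sigma> :: nat \<Rightarrow> nat. \<exists>h\<in>dirichlet_space v. strict_mono \<sigma> \<and>
           (\<lambda>n. dirichlet_norm v (\<lambda>z. T (F (\<sigma> n)) z - h z)) \<longlonglongrightarrow> 0))"

definition M2 :: "real \<Rightarrow> (complex \<Rightarrow> complex) \<Rightarrow> real" where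
  "M2 r f = sqrt (1 / (2 * pi) *
     (LINT \<theta>:{-pi..pi}|lebesgue. (cmod (f (of_real r * exp (\<i> * of_real \<theta>))))\<^sup>2))"

definition b_2_infinity :: "(complex \<Rightarrow> complex) set" where
  "b_2_infinity = {g. g holomorphic_on ball 0 1 \<and>
     ((\<lambda>r. M2 r (deriv g) * (1 - r) powr (1 / 2)) \<longlongrightarrow> 0) (at_left 1)}"

end

theory Submission
  imports Defs
begin

text \<open>Write \<open>f = (\<Sum>n. a\<^sub>n z\<^sup>n)\<close> and \<open>g' = (\<Sum>k. \<beta>\<^sub>k z\<^sup>k)\<close>. Then \<open>H\<^sub>g f = (\<Sum>k. \<beta>\<^sub>k L\<^sub>k z\<^sup>k)\<close> with
  \<open>L\<^sub>k = \<integral> t\<^sup>k f(t) dt\<close>, and the Dirichlet norm is a weighted \<open>l\<^sup>2\<close> norm of the coefficients whose weights are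
  \<open>k\<^sup>2\<close> times the moments \<open>\<mu>\<close> of \<open>v\<close>. Hilbert's inequality controls \<open>f'\<close> on the radius \<open>[0, 1)\<close> in
  \<open>L\<^sup>2\<close> with weight \<open>vhat v\<close>; the two hypotheses on \<open>v\<close> are Muckenhoupt conditions, so two weighted Hardy
  inequalities control first \<open>f\<close> and then \<open>G(x) = \<integral> |f|\<close> over \<open>(x, 1)\<close>. Since \<open>L\<^sub>k\<close> is an average of \<open>G\<close>
  over \<open>x < 1 - 1/k\<close>, where doubling gives \<open>\<mu>\<^sub>k \<lesssim> vhat v x\<close>, the tails of \<open>H\<^sub>g f\<close> are small uniformly on bounded
  sets when \<open>g\<close> is in \<open>b(2, \<infinity>)\<close>, and compactness follows from coefficientwise convergence. Conversely, testing on
  normalised blocks \<open>z\<^sup>N + \<dots> + z\<^bsup>2N-1\<^esup>\<close> bounds the average of \<open>|\<beta>\<^sub>k|\<^sup>2\<close> over \<open>N/2 \<le> k \<le> N\<close> by the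
  tail of the image of the block, and tails tend to zero uniformly on relatively compact sets.\<close>

section \<open>Planar Lebesgue measure and radial weights\<close>

text \<open>The exponents are forced by one computation. Estimating the square of \<open>L_k\<close>
  costs a kernel \<open>k x^(k-1)\<close>, so with the factor \<open>k^2\<close> of the Dirichlet
  norm the symbol enters through the sum of \<open>k^3 |\<beta>_k|^2 x^(k-1)\<close>. For a symbol
  in b(2, infinity) this sum, started at a large index, is at most a small multiple of
  \<open>(1 - x)^(-4)\<close>. The second Hardy inequality has exactly
  \<open>vhat v x / (1 - x)^4\<close> on its left, and the weight
  \<open>vhat v x / (1 - x)^2\<close> on its right is the one on the left of the first. Hilbert's
  inequality is applied on each interval \<open>[0, s]\<close>; integration against the profile of
  \<open>v\<close> then produces \<open>vhat v\<close> on one side and the moments on the other. The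
  estimates are made for series with coefficients \<open>|a_n|\<close>, so that they concern
  nonnegative integrals and Tonelli's theorem applies without convergence questions. A separate
  obstacle is measure-theoretic: \<open>v\<close> is only known to be Lebesgue measurable in the
  plane, and its profile must be shown to be measurable on the line.\<close>

lemma lborel_complex_eq_distr:
  "distr (lborel :: (real \<times> real) measure) borel (\<lambda>(x, y). Complex x y) = lborel"
proof (rule lborel_eqI[symmetric])
  have meas: "(\<lambda>(x, y). Complex x y) \<in> borel_measurable (borel :: (real \<times> real) measure)"
    unfolding Complex_eq case_prod_beta by (intro borel_measurable_continuous_onI continuous_intros)
  fix l u :: complex assume le: "\<And>b. b \<in> Basis \<Longrightarrow> l \<bullet> b \<le> u \<bullet> b"
  have le': "Re l \<le> Re u" "Im l \<le> Im u"
    using le[of 1] le[of \<i>] by (auto simp: Basis_complex_def)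
  have vim: "(\<lambda>(x, y). Complex x y) -` box l u = box (Re l) (Re u) \<times> box (Im l) (Im u)"
    by (auto simp: box_def Basis_complex_def)
  have "emeasure (distr lborel borel (\<lambda>(x, y). Complex x y)) (box l u) =
      emeasure (lborel \<Otimes>\<^sub>M lborel) (box (Re l) (Re u) \<times> box (Im l) (Im u))"
    using meas by (subst emeasure_distr) (auto simp: vim lborel_prod)
  also have "\<dots> = emeasure lborel (box (Re l) (Re u)) * emeasure lborel (box (Im l) (Im u))"
    by (intro lborel.emeasure_pair_measure_Times) auto
  also have "\<dots> = ennreal (\<Prod>b\<in>Basis. (u - l) \<bullet> b)"
    using le' by (simp add: Basis_complex_def ennreal_mult)
  finally show "emeasure (distr lborel borel (\<lambda>(x, y). Complex x y)) (box l u) =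
    ennreal (\<Prod>b\<in>Basis. (u - l) \<bullet> b)" .
qed simp

lemma nn_integral_complex_fst:
  fixes h :: "complex \<Rightarrow> ennreal"
  assumes [measurable]: "h \<in> borel_measurable borel"
  shows "(\<integral>\<^sup>+z. h z \<partial>lborel) = (\<integral>\<^sup>+y. \<integral>\<^sup>+x. h (Complex x y) \<partial>lborel \<partial>lborel)"
    and "(\<integral>\<^sup>+z. h z \<partial>lborel) = (\<integral>\<^sup>+x. \<integral>\<^sup>+y. h (Complex x y) \<partial>lborel \<partial>lborel)"
proof -
  have meas [measurable]: "(\<lambda>(x, y). Complex x y) \<in> borel_measurable (borel \<Otimes>\<^sub>M borel)"
    unfolding borel_prod Complex_eq case_prod_beta
    by (intro borel_measurable_continuous_onI continuous_intros)
  have *: "(\<integral>\<^sup>+z. h z \<partial>lborel) = (\<integral>\<^sup>+p. h (Complex (fst p) (snd p)) \<partial>(lborel \<Otimes>\<^sub>M lborel))"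
    using meas by (subst lborel_complex_eq_distr[symmetric], subst nn_integral_distr)
      (auto simp: lborel_prod borel_prod case_prod_beta)
  have m: "(\<lambda>p. h (Complex (fst p) (snd p))) \<in> borel_measurable (lborel \<Otimes>\<^sub>M lborel)"
    using measurable_compose[OF meas assms] by (simp add: case_prod_beta)
  show "(\<integral>\<^sup>+z. h z \<partial>lborel) = (\<integral>\<^sup>+x. \<integral>\<^sup>+y. h (Complex x y) \<partial>lborel \<partial>lborel)"
    unfolding * using lborel.nn_integral_fst[OF m] by simp
  show "(\<integral>\<^sup>+z. h z \<partial>lborel) = (\<integral>\<^sup>+y. \<integral>\<^sup>+x. h (Complex x y) \<partial>lborel \<partial>lborel)"
    unfolding * using lborel_pair.nn_integral_snd[of "\<lambda>p. h (Complex (fst p) (snd p))"] m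
    by (simp add: case_prod_beta)
qed

text \<open>For a fixed imaginary part the shear is a translation of the real part, so Tonelli's
  theorem reduces the claim to translation invariance on the line. Shears serve as building blocks
  for rotations.\<close>

lemma nn_integral_shear_Re:
  fixes h :: "complex \<Rightarrow> ennreal" and a :: real
  assumes [measurable]: "h \<in> borel_measurable borel"
  shows "(\<integral>\<^sup>+z. h (z + of_real (a * Im z)) \<partial>lborel) = (\<integral>\<^sup>+z. h z \<partial>lborel)"
proof -
  have [measurable]: "(\<lambda>x. Complex x y) \<in> borel_measurable borel" for y
    unfolding Complex_eq by (intro borel_measurable_continuous_onI continuous_intros)
  have "(\<integral>\<^sup>+z. h (z + of_real (a * Im z)) \<partial>lborel)
      = (\<integral>\<^sup>+y. \<integral>\<^sup>+x. h (Complex (a * y + 1 * x) y) \<partial>lborel \<partial>lborel)"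
    by (subst nn_integral_complex_fst(1), measurable)
      (auto intro!: nn_integral_cong arg_cong[where f = h] simp: complex_eq_iff)
  also have "\<dots> = (\<integral>\<^sup>+y. \<integral>\<^sup>+x. h (Complex x y) \<partial>lborel \<partial>lborel)"
    using nn_integral_real_affine[of "\<lambda>x. h (Complex x y)" 1 "a * y" for y] by simp
  also have "\<dots> = (\<integral>\<^sup>+z. h z \<partial>lborel)"
    by (subst nn_integral_complex_fst(1)) auto
  finally show ?thesis .
qed

lemma nn_integral_shear_Im:
  fixes h :: "complex \<Rightarrow> ennreal" and a :: real
  assumes [measurable]: "h \<in> borel_measurable borel"
  shows "(\<integral>\<^sup>+z. h (z + \<i> * of_real (a * Re z)) \<partial>lborel) = (\<integral>\<^sup>+z. h z \<partial>lborel)"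
proof -
  have [measurable]: "(\<lambda>y. Complex x y) \<in> borel_measurable borel" for x
    unfolding Complex_eq by (intro borel_measurable_continuous_onI continuous_intros)
  have "(\<integral>\<^sup>+z. h (z + \<i> * of_real (a * Re z)) \<partial>lborel)
      = (\<integral>\<^sup>+x. \<integral>\<^sup>+y. h (Complex x (a * x + 1 * y)) \<partial>lborel \<partial>lborel)"
    by (subst nn_integral_complex_fst(2), measurable)
      (auto intro!: nn_integral_cong arg_cong[where f = h] simp: complex_eq_iff)
  also have "\<dots> = (\<integral>\<^sup>+x. \<integral>\<^sup>+y. h (Complex x y) \<partial>lborel \<partial>lborel)"
    using nn_integral_real_affine[of "\<lambda>y. h (Complex x y)" 1 "a * x" for x] by simp
  also have "\<dots> = (\<integral>\<^sup>+z. h z \<partial>lborel)"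
    by (subst nn_integral_complex_fst(2)) auto
  finally show ?thesis .
qed

text \<open>A rotation by less than a half turn is a product of three shears; a general rotation is the
  square of one of these.\<close>

lemma nn_integral_rotate:
  fixes h :: "complex \<Rightarrow> ennreal"
  assumes [measurable]: "h \<in> borel_measurable borel" and c: "cmod c = 1"
  shows "(\<integral>\<^sup>+z. h (c * z) \<partial>lborel) = (\<integral>\<^sup>+z. h z \<partial>lborel)"
proof -
  have half: "(\<integral>\<^sup>+z. k (d * z) \<partial>lborel) = (\<integral>\<^sup>+z. k z \<partial>lborel)"
    if [measurable]: "k \<in> borel_measurable borel" and d: "cmod d = 1" "Re d \<ge> 0"
    for k :: "complex \<Rightarrow> ennreal" and d
  proof -
    define s where "s = Im d"
    \<comment> \<open>For \<open>d = cis \<phi>\<close> this is minus the tangent of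
      \<open>\<phi> / 2\<close>, and \<open>s\<close> is the sine of \<open>\<phi>\<close>. Shearing
      by \<open>t\<close>, then by \<open>s\<close> in the other direction, then by \<open>t\<close>
      again is multiplication by \<open>d\<close>.\<close>
    define t where "t = - Im d / (1 + Re d)"
    have sq: "(Re d)\<^sup>2 + (Im d)\<^sup>2 = 1"
      using d(1) by (simp add: cmod_def)
    have t: "t * (1 + Re d) = - s"
      using d by (simp add: t_def s_def)
    have Re: "1 + t * s = Re d"
      using d sq by (simp add: t_def s_def field_simps power2_eq_square)
    have Im: "2 * t + t * s * t = - s"
      using t by (simp only: flip: Re) (simp add: algebra_simps)
    have "(\<integral>\<^sup>+z. k z \<partial>lborel) = (\<integral>\<^sup>+z. k (z + of_real (t * Im z)) \<partial>lborel)"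
      by (simp only: nn_integral_shear_Re[OF that(1)])
    also have "\<dots> = (\<integral>\<^sup>+z. k ((z + \<i> * of_real (s * Re z))
        + of_real (t * Im (z + \<i> * of_real (s * Re z)))) \<partial>lborel)"
      by (rule nn_integral_shear_Im[symmetric]) measurable
    also have "\<dots> = (\<integral>\<^sup>+z. k (((z + of_real (t * Im z)) + \<i> * of_real (s * Re (z + of_real (t * Im z))))
        + of_real (t * Im ((z + of_real (t * Im z)) + \<i> * of_real (s * Re (z + of_real (t * Im z)))))) \<partial>lborel)"
      by (rule nn_integral_shear_Re[symmetric]) measurable
    also have "\<dots> = (\<integral>\<^sup>+z. k (d * z) \<partial>lborel)"
    proof (intro nn_integral_cong arg_cong[where f = k] complex_eqI)
      fix z :: complex
      have "Re z + t * Im z + t * (Im z + s * (Re z + t * Im z))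
        = (1 + t * s) * Re z + (2 * t + t * s * t) * Im z"
        by (simp add: algebra_simps)
      then show "Re (((z + of_real (t * Im z)) + \<i> * of_real (s * Re (z + of_real (t * Im z))))
        + of_real (t * Im ((z + of_real (t * Im z)) + \<i> * of_real (s * Re (z + of_real (t * Im z)))))) = Re (d * z)"
        unfolding Re Im by (simp add: s_def)
      have "Im z + s * (Re z + t * Im z) = (1 + t * s) * Im z + s * Re z"
        by (simp add: algebra_simps)
      then show "Im (((z + of_real (t * Im z)) + \<i> * of_real (s * Re (z + of_real (t * Im z))))
        + of_real (t * Im ((z + of_real (t * Im z)) + \<i> * of_real (s * Re (z + of_real (t * Im z)))))) = Im (d * z)"
        unfolding Re by (simp add: s_def)
    qed
    finally show ?thesis ..
  qed
  \<comment> \<open>The principal square root has nonnegative real part, as required in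
    \<open>half\<close>, where \<open>1 + Re d\<close> is a denominator.\<close>
  define d where "d = csqrt c"
  have d: "cmod d = 1" "Re d \<ge> 0" "c = d * d"
    using c Re_csqrt[of c] power2_csqrt[of c] by (auto simp: d_def norm_csqrt power2_eq_square)
  have "(\<integral>\<^sup>+z. h (c * z) \<partial>lborel) = (\<integral>\<^sup>+z. h (d * (d * z)) \<partial>lborel)"
    by (simp add: d mult.assoc)
  also have "\<dots> = (\<integral>\<^sup>+z. h (d * z) \<partial>lborel)"
    by (rule half[of "\<lambda>z. h (d * z)"]) (use d in auto)
  also have "\<dots> = (\<integral>\<^sup>+z. h z \<partial>lborel)"
    by (rule half) (use d in auto)
  finally show ?thesis .
qed

text \<open>Polar coordinates for radial integrands. Half-lines form a generator of the Borel sets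
  stable under intersection, and on \<open>{..a}\<close> both measures give the area of a
  disc.\<close>

lemma distr_lborel_cmod:
  "distr (lborel :: complex measure) borel cmod =
     density lborel (\<lambda>r. ennreal (2 * pi * r) * indicator {0<..} r)"
proof (rule measure_eqI_generator_eq[where E = "range (\<lambda>a::real. {..a})" and \<Omega> = UNIV
      and A = "\<lambda>n. {..real n}"])
  show "Int_stable (range (\<lambda>a::real. {..a}))"
    by (auto simp: Int_stable_def)
  have sb: "sets borel = sigma_sets UNIV (range (\<lambda>a::real. {..a}))"
    by (subst borel_eq_atMost) (simp add: sets_measure_of_conv)
  show "sets (distr (lborel :: complex measure) borel cmod) = sigma_sets UNIV (range (\<lambda>a::real. {..a}))"
    "sets (density lborel (\<lambda>r. ennreal (2 * pi * r) * indicator {0<..} r)) = sigma_sets UNIV (range (\<lambda>a::real. {..a}))"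
    by (simp_all add: sb)
  have eq: "emeasure (distr (lborel :: complex measure) borel cmod) {..a} = (if a < 0 then 0 else ennreal (pi * a\<^sup>2))" for a
  proof -
    have "cmod -` {..a} = (if a < 0 then {} else cball 0 a)"
      by (auto simp: cball_def) (meson dual_order.trans not_le norm_ge_zero)
    then show ?thesis
      by (subst emeasure_distr) (auto simp: emeasure_cball unit_ball_vol_2 mult.commute)
  qed
  have eq2: "emeasure (density lborel (\<lambda>r. ennreal (2 * pi * r) * indicator {0<..} r)) {..a} = (if a < 0 then 0 else ennreal (pi * a\<^sup>2))" for a
  proof -
    have "emeasure (density lborel (\<lambda>r. ennreal (2 * pi * r) * indicator {0<..} r)) {..a}
       = (\<integral>\<^sup>+r. ennreal (2 * pi * r) * indicator {0..a} r \<partial>lborel)"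
      by (subst emeasure_density) (auto intro!: nn_integral_cong split: split_indicator)
    also have "\<dots> = (if a < 0 then 0 else ennreal (pi * a\<^sup>2))"
    proof (cases "a < 0")
      case False
      have "(\<integral>\<^sup>+r. ennreal (2 * pi * r) * indicator {0..a} r \<partial>lborel) = ennreal (pi * a\<^sup>2 - pi * 0\<^sup>2)"
        using False by (intro nn_integral_FTC_Icc) (auto intro!: derivative_eq_intros)
      then show ?thesis using False by simp
    qed simp
    finally show ?thesis .
  qed
  fix X assume "X \<in> range (\<lambda>a::real. {..a})"
  then show "emeasure (distr (lborel :: complex measure) borel cmod) X =
     emeasure (density lborel (\<lambda>r. ennreal (2 * pi * r) * indicator {0<..} r)) X"
    by (auto simp: eq eq2)
next
  fix i :: nat
  have "cmod -` {..real i} = cball 0 (real i)" by auto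
  then show "emeasure (distr (lborel :: complex measure) borel cmod) {..real i} \<noteq> \<infinity>"
    by (subst emeasure_distr) (auto simp: emeasure_cball)
next
  show "(\<Union>i. {..real i}) = UNIV"
    using real_arch_simple by auto
qed auto

lemma nn_integral_cmod:
  assumes [measurable]: "h \<in> borel_measurable borel"
  shows "(\<integral>\<^sup>+z. h (cmod z) \<partial>lborel) = (\<integral>\<^sup>+r. ennreal (2 * pi * r) * indicator {0<..} r * h r \<partial>lborel)"
proof -
  have "(\<integral>\<^sup>+z. h (cmod z) \<partial>lborel) = (\<integral>\<^sup>+r. h r \<partial>distr (lborel :: complex measure) borel cmod)"
    by (subst nn_integral_distr) auto
  also have "\<dots> = (\<integral>\<^sup>+r. ennreal (2 * pi * r) * indicator {0<..} r * h r \<partial>lborel)"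
    unfolding distr_lborel_cmod by (subst nn_integral_density) auto
  finally show ?thesis .
qed

section \<open>Null sets and measurability: from the plane to the radius and back\<close>

lemma AE_cmod:
  assumes "AE r in lborel. P r"
  shows "AE z in (lborel :: complex measure). P (cmod z)"
proof -
  obtain N where N: "N \<in> null_sets lborel" "{r. \<not> P r} \<subseteq> N"
    using assms by (auto simp: eventually_ae_filter)
  have [measurable]: "N \<in> sets borel" using N by auto
  have "emeasure (lborel :: complex measure) (cmod -` N) = (\<integral>\<^sup>+z. indicator N (cmod z) \<partial>lborel)"
    by (subst nn_integral_indicator[symmetric])
      (auto intro!: nn_integral_cong measurable_sets_borel[of cmod borel] split: split_indicator)
  also have "\<dots> = (\<integral>\<^sup>+r. ennreal (2 * pi * r) * indicator {0<..} r * indicator N r \<partial>lborel)"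
    by (rule nn_integral_cmod) auto
  also have "\<dots> = 0"
    by (subst nn_integral_0_iff_AE) (use AE_not_in[OF N(1)] in \<open>auto elim!: eventually_mono\<close>)
  finally have "cmod -` N \<in> null_sets (lborel :: complex measure)"
    by (auto simp: null_sets_def intro!: measurable_sets_borel[of cmod borel])
  then show ?thesis
    by (rule AE_I') (use N in auto)
qed

text \<open>The density \<open>2 * pi * r\<close> of the radial measure vanishes nowhere on the
  positive half-line, so a set that is null for it is Lebesgue null there. Nothing can be said about
  \<open>r \<le> 0\<close>, which explains the premise in the conclusion.\<close>

lemma AE_cmod_imp:
  assumes "AE z in (lborel :: complex measure). \<not> cmod z \<in> D" and [measurable]: "D \<in> sets borel"
  shows "AE r in lborel. 0 < r \<longrightarrow> r \<notin> D"
proof -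
  have "(\<integral>\<^sup>+r. ennreal (2 * pi * r) * indicator {0<..} r * indicator D r \<partial>lborel)
      = (\<integral>\<^sup>+z. indicator D (cmod z) \<partial>lborel)"
    by (rule nn_integral_cmod[symmetric]) auto
  also have "\<dots> = 0"
    by (subst nn_integral_0_iff_AE) (use assms(1) in \<open>auto elim!: eventually_mono\<close>)
  finally have "AE r in lborel. ennreal (2 * pi * r) * indicator {0<..} r * indicator D r = 0"
    by (subst (asm) nn_integral_0_iff_AE) auto
  then show ?thesis
  proof eventually_elim
    case (elim r)
    then show ?case
      using mult_pos_pos[OF pi_gt_zero, of r] by (auto split: split_indicator_asm)
  qed
qed

text \<open>Up to a null set a Lebesgue measurable set is a countable union of compact sets. Their
  images under \<open>cmod\<close> are compact, so \<open>A\<close>, the union of the images, is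
  Borel, although images of general measurable sets need not be.\<close>

lemma radial_inner_borel:
  assumes "cmod -` E \<in> sets lebesgue"
  obtains A where "A \<in> sets borel" "A \<subseteq> E" "AE z in (lborel :: complex measure). cmod z \<notin> E - A"
proof -
  obtain C N where CN: "fsigma C" "N \<in> null_sets lebesgue" "C \<union> N = cmod -` E"
    using lebesgue_set_almost_fsigma[OF assms] by metis
  obtain F :: "nat \<Rightarrow> complex set" where F: "range F \<subseteq> Collect compact" "C = \<Union>(range F)"
    using CN(1) fsigma_Union_compact by metis
  define A where "A = (\<Union>n. cmod ` F n)"
  have "A \<in> sets borel"
    unfolding A_def using F(1)
    by (intro sets.countable_UN image_subsetI borel_compact compact_continuous_image continuous_intros) auto
  moreover have "A \<subseteq> E"
    using CN(3) F(2) by (auto simp: A_def)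
  moreover have "AE z in lborel. cmod z \<notin> E - A"
  proof -
    have "AE z in lebesgue. z \<notin> N"
      using CN(2) by (rule AE_not_in)
    then have "AE z in lborel. z \<notin> N"
      by (simp add: AE_completion_iff)
    then show ?thesis
    proof eventually_elim
      case (elim z)
      have "z \<in> C" if "cmod z \<in> E" using that elim CN(3) by blast
      then show ?case using F(2) by (auto simp: A_def)
    qed
  qed
  ultimately show ?thesis using that by blast
qed

text \<open>Inner approximation of both \<open>E\<close> and its complement encloses
  \<open>E\<close> between the Borel sets \<open>A\<close> and \<open>- B\<close>. Their difference
  is radially null in the plane, hence null on the positive half-line. The half-line
  \<open>r \<le> 0\<close> is invisible to \<open>cmod\<close> apart from the origin, so
  \<open>E\<close> is required to avoid it.\<close>

lemma radial_set_measurable: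
  assumes E: "cmod -` E \<in> sets lebesgue" "E \<subseteq> {0<..}"
  shows "E \<in> sets lebesgue"
proof -
  obtain A where A: "A \<in> sets borel" "A \<subseteq> E" "AE z in (lborel :: complex measure). cmod z \<notin> E - A"
    using radial_inner_borel[OF E(1)] .
  have E': "cmod -` (- E) \<in> sets lebesgue"
    using sets.compl_sets[OF E(1)] by (simp add: Compl_eq_Diff_UNIV vimage_Diff)
  obtain B where B: "B \<in> sets borel" "B \<subseteq> - E"
    "AE z in (lborel :: complex measure). cmod z \<notin> - E - B"
    using radial_inner_borel[OF E'] .
  have "AE z in (lborel :: complex measure). cmod z \<notin> - B - A"
    using A(3) B(3) by eventually_elim auto
  then have "AE r in lborel. 0 < r \<longrightarrow> r \<notin> - B - A"
    by (rule AE_cmod_imp) (use A B in auto)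
  then have "AE r in lborel. (r \<in> A) = (r \<in> E)"
  proof eventually_elim
    case (elim r)
    then show ?case using A(2) B(2) E(2) by auto
  qed
  then have "AE r in lebesgue. (r \<in> A) = (r \<in> E)"
    by (rule AE_completion)
  moreover have "A \<in> sets lebesgue" using A by simp
  ultimately show ?thesis
    by (rule completion.in_sets_AE) simp
qed

lemma radial_weight_borel:
  assumes v: "radial_weight v"
  obtains w :: "real \<Rightarrow> real" where "w \<in> borel_measurable borel" "\<And>r. 0 \<le> w r"
    "(\<lambda>r. indicator {0<..<1} r * v (of_real r)) \<in> borel_measurable lebesgue"
    "AE r in lborel. 0 < r \<and> r < 1 \<longrightarrow> v (of_real r) = w r"
    "AE z in lborel. cmod z < 1 \<longrightarrow> v z = w (cmod z)"
proof -
  have pos: "0 < v z" if "cmod z < 1" for z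
    using v that unfolding radial_weight_def weight_def mem_ball_0[symmetric] by blast
  have rad: "v z = v (of_real (cmod z))" if "cmod z < 1" for z
    using v that unfolding radial_weight_def mem_ball_0[symmetric] by blast
  have "(\<lambda>z. indicator (ball 0 1) z *\<^sub>R v z) \<in> borel_measurable lebesgue"
    using v unfolding radial_weight_def weight_def set_integrable_def by blast
  then have vm: "(\<lambda>z. indicator (ball 0 1) z * v z) \<in> borel_measurable lebesgue" by simp
  define f where "f r = indicator {0<..<1} r * v (of_real r)" for r :: real
  have f_meas: "f \<in> borel_measurable lebesgue"
  proof (rule borel_measurable_iff_greater[THEN iffD2], rule allI)
    fix c :: real
    show "{x \<in> space lebesgue. c < f x} \<in> sets lebesgue"
    proof (cases "c < 0")
      case True
      then have "{x \<in> space lebesgue. c < f x} = UNIV"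
        using pos by (auto simp: f_def split: split_indicator intro!: less_trans[of c 0])
      then show ?thesis by simp
    next
      case False
      have "{x \<in> space lebesgue. c < f x} \<in> sets lebesgue"
      proof (rule radial_set_measurable)
        \<comment> \<open>The profile \<open>f\<close> is cut off at \<open>r = 0\<close>, whereas
          \<open>v\<close> may be large at the origin; hence the removal of this point.\<close>
        have "cmod -` {x \<in> space lebesgue. c < f x}
          = {z \<in> space lebesgue. c < indicator (ball 0 1) z * v z} - {0}"
        proof (rule set_eqI)
          fix z :: complex
          show "z \<in> cmod -` {x \<in> space lebesgue. c < f x} \<longleftrightarrow>
            z \<in> {z \<in> space lebesgue. c < indicator (ball 0 1) z * v z} - {0}"
            using rad[of z] False by (cases "cmod z < 1"; cases "z = 0") (simp_all add: f_def)
        qed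
        also have "\<dots> \<in> sets lebesgue"
          using vm[unfolded borel_measurable_iff_greater] by (intro sets.Diff) auto
        finally show "cmod -` {x \<in> space lebesgue. c < f x} \<in> sets lebesgue" .
        show "{x \<in> space lebesgue. c < f x} \<subseteq> {0<..}"
          using False by (auto simp: f_def split: split_indicator_asm)
      qed
      then show ?thesis .
    qed
  qed
  then obtain f' where f': "f' \<in> borel_measurable lborel" "AE r in lborel. f r = f' r"
    using completion_ex_borel_measurable_real by blast
  \<comment> \<open>The absolute value makes the representative nonnegative everywhere; since
    \<open>v\<close> is positive, equality almost everywhere survives.\<close>
  define w where "w r = \<bar>f' r\<bar>" for r
  have AE: "AE r in lborel. 0 < r \<and> r < 1 \<longrightarrow> v (of_real r) = w r"
    using f'(2)
  proof eventually_elim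
    case (elim r)
    then show ?case using pos[of "of_real r"] by (auto simp: f_def w_def)
  qed
  show thesis
  proof (rule that[OF _ _ f_meas[unfolded f_def] AE])
    show "w \<in> borel_measurable borel" using f'(1) unfolding w_def by simp
    show "0 \<le> w r" for r by (simp add: w_def)
    have "AE z in (lborel :: complex measure). z \<noteq> 0"
      using AE_lborel_singleton[of 0] by simp
    then show "AE z in lborel. cmod z < 1 \<longrightarrow> v z = w (cmod z)"
      using AE_cmod[OF AE]
    proof eventually_elim
      case (elim z)
      then show ?case using rad[of z] by auto
    qed
  qed
qed

section \<open>Power series on the disc\<close>

lemma has_integral_cis_mult:
  fixes k :: int
  shows "((\<lambda>\<theta>. cis (of_int k * \<theta>)) has_integral (if k = 0 then of_real (2 * pi) else 0)) {-pi..pi}"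
proof (cases "k = 0")
  case True
  then show ?thesis
    using has_integral_const_real[of "1 :: complex" "-pi" pi] by (simp add: scaleR_conv_of_real)
next
  case False
  have "((\<lambda>\<theta>. cis (of_int k * \<theta>)) has_integral
     (- \<i> / of_int k * cis (of_int k * pi) - (- \<i> / of_int k * cis (of_int k * (-pi))))) {-pi..pi}"
  proof (rule fundamental_theorem_of_calculus)
    fix x assume "x \<in> {-pi..pi}"
    show "((\<lambda>\<theta>. - \<i> / of_int k * cis (of_int k * \<theta>)) has_vector_derivative cis (of_int k * x))
        (at x within {-pi..pi})"
    proof -
      have "((\<lambda>u. - \<i> / of_int k * exp (\<i> * (of_int k * u))) has_field_derivative
          exp (\<i> * (of_int k * of_real x))) (at (of_real x))"
        using False by (auto intro!: derivative_eq_intros)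
      from has_vector_derivative_real_field[OF this] show ?thesis
        by (simp add: cis_conv_exp)
    qed
  qed simp
  moreover have "cis (of_int k * pi) = cis (of_int k * (-pi))"
    by (simp add: complex_eq_iff mult.commute[of _ pi])
  ultimately show ?thesis using False by simp
qed

lemma parseval_sum:
  fixes c :: "nat \<Rightarrow> complex"
  shows "((\<lambda>\<theta>. (cmod (\<Sum>n<N. c n * cis (real n * \<theta>)))\<^sup>2) has_integral (2 * pi * (\<Sum>n<N. (cmod (c n))\<^sup>2))) {-pi..pi}"
proof -
  have "((\<lambda>\<theta>. \<Sum>m<N. \<Sum>n<N. c m * cnj (c n) * cis (of_int (int m - int n) * \<theta>)) has_integral
      (\<Sum>m<N. \<Sum>n<N. c m * cnj (c n) * (if int m - int n = 0 then of_real (2 * pi) else 0))) {-pi..pi}"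
    by (intro has_integral_sum has_integral_mult_right has_integral_cis_mult) auto
  moreover have "(\<Sum>m<N. \<Sum>n<N. c m * cnj (c n) * cis (of_int (int m - int n) * \<theta>))
      = of_real ((cmod (\<Sum>n<N. c n * cis (real n * \<theta>)))\<^sup>2)" for \<theta>
    by (simp only: complex_norm_square cnj_sum sum_product)
      (intro sum.cong, auto simp: cis_cnj cis_mult algebra_simps)
  moreover have "(\<Sum>m<N. \<Sum>n<N. c m * cnj (c n) * (if int m - int n = 0 then of_real (2 * pi) else 0))
      = of_real (2 * pi * (\<Sum>n<N. (cmod (c n))\<^sup>2))"
    by (simp only: of_real_mult of_real_sum complex_norm_square)
      (simp add: if_distrib sum_distrib_left mult.commute cong: if_cong)
  ultimately have "((\<lambda>\<theta>. complex_of_real ((cmod (\<Sum>n<N. c n * cis (real n * \<theta>)))\<^sup>2)) has_integral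
      of_real (2 * pi * (\<Sum>n<N. (cmod (c n))\<^sup>2))) {-pi..pi}"
    by simp
  from has_integral_linear[OF this bounded_linear_Re] show ?thesis
    by (simp add: o_def)
qed

lemma parseval:
  fixes c :: "nat \<Rightarrow> complex"
  assumes "summable (\<lambda>n. cmod (c n))"
  shows "summable (\<lambda>n. (cmod (c n))\<^sup>2)" (is ?summ)
    and "((\<lambda>\<theta>. (cmod (\<Sum>n. c n * cis (real n * \<theta>)))\<^sup>2) has_integral (2 * pi * (\<Sum>n. (cmod (c n))\<^sup>2))) {-pi..pi}"
proof -
  define B where "B = (\<Sum>n. cmod (c n))"
  have le: "cmod (c n) \<le> B" for n
    unfolding B_def using sum_le_suminf[OF assms, of "{n}"] by simp
  show summ: ?summ
  proof (rule summable_comparison_test[OF _ summable_mult[OF assms, of B]], intro exI allI impI)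
    fix n show "norm ((cmod (c n))\<^sup>2) \<le> B * cmod (c n)"
      using mult_right_mono[OF le, of "cmod (c n)" n] by (simp add: power2_eq_square)
  qed
  have sm: "summable (\<lambda>n. c n * cis (real n * \<theta>))" for \<theta>
    by (rule summable_norm_cancel) (use assms in \<open>simp add: norm_mult\<close>)
  let ?f = "\<lambda>N \<theta>. (cmod (\<Sum>n<N. c n * cis (real n * \<theta>)))\<^sup>2"
  let ?g = "\<lambda>\<theta>. (cmod (\<Sum>n. c n * cis (real n * \<theta>)))\<^sup>2"
  have int: "?f N integrable_on {-pi..pi}" for N
    using parseval_sum by blast
  have bd: "norm (?f N \<theta>) \<le> B\<^sup>2" for N \<theta>
  proof -
    have "cmod (\<Sum>n<N. c n * cis (real n * \<theta>)) \<le> (\<Sum>n<N. cmod (c n))"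
      by (rule sum_norm_le) (simp add: norm_mult)
    also have "\<dots> \<le> B" unfolding B_def by (rule sum_le_suminf[OF assms]) auto
    finally show ?thesis by (simp add: power_mono)
  qed
  have lim: "(\<lambda>N. ?f N \<theta>) \<longlonglongrightarrow> ?g \<theta>" for \<theta>
    by (intro tendsto_intros summable_LIMSEQ sm)
  note dc = dominated_convergence[where f = ?f and g = ?g and h = "\<lambda>_. B\<^sup>2" and S = "{-pi..pi}",
    OF int integrable_const_ivl bd lim]
  have "(\<lambda>N. integral {-pi..pi} (?f N)) \<longlonglongrightarrow> 2 * pi * (\<Sum>n. (cmod (c n))\<^sup>2)"
    by (subst integral_unique[OF parseval_sum]) (intro tendsto_intros summable_LIMSEQ summ)
  then have "integral {-pi..pi} ?g = 2 * pi * (\<Sum>n. (cmod (c n))\<^sup>2)"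
    using dc(2) LIMSEQ_unique by blast
  then show "(?g has_integral (2 * pi * (\<Sum>n. (cmod (c n))\<^sup>2))) {-pi..pi}"
    using dc(1) by (simp add: has_integral_iff)
qed

text \<open>In polar coordinates \<open>dA\<close> becomes \<open>2 r dr\<close>, so this is the
  \<open>dA\<close>-integral of \<open>cmod z ^ (2 * n) * w (cmod z)\<close>, the squared norm of
  the monomial of degree \<open>n\<close>.\<close>

definition moment :: "(real \<Rightarrow> real) \<Rightarrow> nat \<Rightarrow> ennreal" where
  "moment w n = (\<integral>\<^sup>+r. indicator {0<..<1} r * ennreal (2 * r ^ (2 * n + 1) * w r) \<partial>lborel)"

text \<open>Parametrised by a point \<open>z\<close> of the circle instead of its radius, so that
  the identity can be integrated over \<open>z\<close> after a rotation average.\<close>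

lemma power_series_parseval:
  assumes F: "\<And>u. cmod u < 1 \<Longrightarrow> (\<lambda>n. \<alpha> n * u ^ n) sums F u" and z: "cmod z < 1"
  shows "summable (\<lambda>n. (cmod (\<alpha> n))\<^sup>2 * cmod z ^ (2 * n))"
    and "((\<lambda>\<theta>. (cmod (F (cis \<theta> * z)))\<^sup>2) has_integral
      2 * pi * (\<Sum>n. (cmod (\<alpha> n))\<^sup>2 * cmod z ^ (2 * n))) {-pi..pi}"
proof -
  obtain \<rho> where \<rho>: "cmod z < \<rho>" "\<rho> < 1" using z dense by blast
  then have "0 < \<rho>" using norm_ge_zero[of z] by linarith
  have "summable (\<lambda>n. \<alpha> n * of_real \<rho> ^ n)"
    using F[of "of_real \<rho>"] \<rho> \<open>0 < \<rho>\<close> by (auto simp: sums_iff)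
  then have "summable (\<lambda>n. norm (\<alpha> n * z ^ n))"
    by (rule powser_insidea) (use \<rho> \<open>0 < \<rho>\<close> in auto)
  note p = parseval[OF this]
  have *: "(cmod (\<alpha> n * z ^ n))\<^sup>2 = (cmod (\<alpha> n))\<^sup>2 * cmod z ^ (2 * n)" for n
    by (simp add: norm_mult norm_power power_mult_distrib power_mult[symmetric] mult.commute)
  have F': "(\<Sum>n. \<alpha> n * z ^ n * cis (real n * \<theta>)) = F (cis \<theta> * z)" for \<theta>
  proof -
    have "(\<lambda>n. \<alpha> n * (cis \<theta> * z) ^ n) sums F (cis \<theta> * z)"
      by (rule F) (use z in \<open>simp add: norm_mult\<close>)
    moreover have "\<alpha> n * (cis \<theta> * z) ^ n = \<alpha> n * z ^ n * cis (real n * \<theta>)" for n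
      by (simp add: power_mult_distrib Complex.DeMoivre)
    ultimately show ?thesis by (simp add: sums_iff)
  qed
  show "summable (\<lambda>n. (cmod (\<alpha> n))\<^sup>2 * cmod z ^ (2 * n))"
    using p(1) by (simp only: *)
  show "((\<lambda>\<theta>. (cmod (F (cis \<theta> * z)))\<^sup>2) has_integral
      2 * pi * (\<Sum>n. (cmod (\<alpha> n))\<^sup>2 * cmod z ^ (2 * n))) {-pi..pi}"
    using p(2) by (simp only: * F')
qed

text \<open>The polar coordinates at hand apply to radial integrands only. The integrand is
  therefore averaged over all rotations, which leaves its integral unchanged; by Parseval's identity
  the average is radial and expands into monomials in \<open>cmod z\<close>.\<close>

lemma nn_integral_disc_power_series:
  fixes F :: "complex \<Rightarrow> complex" and w :: "real \<Rightarrow> real"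
  assumes hol: "F holomorphic_on ball 0 1"
    and F: "\<And>u. cmod u < 1 \<Longrightarrow> (\<lambda>n. \<alpha> n * u ^ n) sums F u"
    and w [measurable]: "w \<in> borel_measurable borel" and w0: "\<And>r. 0 \<le> w r"
  shows "(\<integral>\<^sup>+z. indicator (ball 0 1) z * ennreal ((cmod (F z))\<^sup>2 * w (cmod z)) \<partial>lborel)
    = ennreal pi * (\<Sum>n. ennreal ((cmod (\<alpha> n))\<^sup>2) * moment w n)"
proof -
  \<comment> \<open>The values of \<open>F\<close> outside the disc are arbitrary; cutting them off
    yields a Borel function on the whole plane.\<close>
  define Fb where "Fb z = indicator (ball 0 1) z *\<^sub>R F z" for z
  have [measurable]: "Fb \<in> borel_measurable borel"
    unfolding Fb_def using holomorphic_on_imp_continuous_on[OF hol]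
    by (intro borel_measurable_continuous_on_indicator) auto
  have [measurable]: "cis \<in> borel_measurable borel"
    by (intro borel_measurable_continuous_onI continuous_intros)
  have [measurable]: "ball (0 :: complex) 1 \<in> sets borel" by simp
  define H where "H z = indicator (ball 0 1) z * ennreal ((cmod (Fb z))\<^sup>2 * w (cmod z))" for z :: complex
  have [measurable]: "H \<in> borel_measurable borel" unfolding H_def by measurable
  have H: "H z = indicator (ball 0 1) z * ennreal ((cmod (F z))\<^sup>2 * w (cmod z))" for z
    by (simp add: H_def Fb_def split: split_indicator)
  have "ennreal (2 * pi) * (\<integral>\<^sup>+z. H z \<partial>lborel)
      = (\<integral>\<^sup>+\<theta>. (\<integral>\<^sup>+z. H z \<partial>lborel) * indicator {-pi..pi} \<theta> \<partial>lborel)"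
    by (subst nn_integral_cmult) (auto simp: mult.commute)
  also have "\<dots> = (\<integral>\<^sup>+\<theta>. (\<integral>\<^sup>+z. H (cis \<theta> * z) * indicator {-pi..pi} \<theta> \<partial>lborel) \<partial>lborel)"
    by (subst nn_integral_multc) (auto simp: nn_integral_rotate)
  also have "\<dots> = (\<integral>\<^sup>+z. (\<integral>\<^sup>+\<theta>. H (cis \<theta> * z) * indicator {-pi..pi} \<theta> \<partial>lborel) \<partial>lborel)"
    by (subst lborel_pair.Fubini') auto
  also have "\<dots> = (\<integral>\<^sup>+z. (\<Sum>n. ennreal (2 * pi * (cmod (\<alpha> n))\<^sup>2) *
       (indicator {..<1} (cmod z) * ennreal (cmod z ^ (2 * n) * w (cmod z)))) \<partial>lborel)"
  proof (rule nn_integral_cong)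
    fix z :: complex
    show "(\<integral>\<^sup>+\<theta>. H (cis \<theta> * z) * indicator {-pi..pi} \<theta> \<partial>lborel) =
       (\<Sum>n. ennreal (2 * pi * (cmod (\<alpha> n))\<^sup>2) * (indicator {..<1} (cmod z) * ennreal (cmod z ^ (2 * n) * w (cmod z))))"
    proof (cases "cmod z < 1")
      case True
      note p = power_series_parseval[OF F True]
      have "(\<integral>\<^sup>+\<theta>. H (cis \<theta> * z) * indicator {-pi..pi} \<theta> \<partial>lborel) =
        (\<integral>\<^sup>+\<theta>. ennreal ((cmod (F (cis \<theta> * z)))\<^sup>2 * w (cmod z)) * indicator {-pi..pi} \<theta> \<partial>lborel)"
        using True by (simp add: H norm_mult)
      also have "\<dots> = ennreal (2 * pi * (\<Sum>n. (cmod (\<alpha> n))\<^sup>2 * cmod z ^ (2 * n)) * w (cmod z))"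
        using w0 by (intro nn_integral_has_integral_lebesgue' has_integral_mult_left p(2)) auto
      also have "2 * pi * (\<Sum>n. (cmod (\<alpha> n))\<^sup>2 * cmod z ^ (2 * n)) * w (cmod z)
          = (\<Sum>n. 2 * pi * (cmod (\<alpha> n))\<^sup>2 * (cmod z ^ (2 * n) * w (cmod z)))"
        using suminf_mult[OF p(1), of "2 * pi * w (cmod z)"] by (simp add: mult_ac)
      also have "ennreal \<dots> = (\<Sum>n. ennreal (2 * pi * (cmod (\<alpha> n))\<^sup>2 * (cmod z ^ (2 * n) * w (cmod z))))"
        using w0 summable_mult[OF p(1), of "2 * pi * w (cmod z)"]
        by (intro suminf_ennreal2[symmetric]) (auto simp: mult_ac)
      also have "\<dots> = (\<Sum>n. ennreal (2 * pi * (cmod (\<alpha> n))\<^sup>2) * (indicator {..<1} (cmod z) * ennreal (cmod z ^ (2 * n) * w (cmod z))))"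
        using True w0 by (simp add: ennreal_mult)
      finally show ?thesis .
    qed (simp add: H norm_mult)
  qed
  also have "\<dots> = (\<Sum>n. \<integral>\<^sup>+z. ennreal (2 * pi * (cmod (\<alpha> n))\<^sup>2) *
       (indicator {..<1} (cmod z) * ennreal (cmod z ^ (2 * n) * w (cmod z))) \<partial>lborel)"
    by (rule nn_integral_suminf) measurable
  also have "\<dots> = (\<Sum>n. ennreal (2 * pi * (cmod (\<alpha> n))\<^sup>2) * (ennreal pi * moment w n))"
  proof (rule suminf_cong)
    fix n
    have "(\<integral>\<^sup>+z. indicator {..<1} (cmod z) * ennreal (cmod z ^ (2 * n) * w (cmod z)) \<partial>(lborel :: complex measure))
      = (\<integral>\<^sup>+r. ennreal (2 * pi * r) * indicator {0<..} r * (indicator {..<1} r * ennreal (r ^ (2 * n) * w r)) \<partial>lborel)"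
      by (rule nn_integral_cmod) measurable
    also have "\<dots> = (\<integral>\<^sup>+r. ennreal pi * (indicator {0<..<1} r * ennreal (2 * r ^ (2 * n + 1) * w r)) \<partial>lborel)"
      using w0 by (intro nn_integral_cong) (auto simp: mult_ac ennreal_mult[symmetric] split: split_indicator)
    also have "\<dots> = ennreal pi * moment w n"
      unfolding moment_def by (rule nn_integral_cmult) measurable
    finally show "(\<integral>\<^sup>+z. ennreal (2 * pi * (cmod (\<alpha> n))\<^sup>2) *
       (indicator {..<1} (cmod z) * ennreal (cmod z ^ (2 * n) * w (cmod z))) \<partial>lborel)
       = ennreal (2 * pi * (cmod (\<alpha> n))\<^sup>2) * (ennreal pi * moment w n)"
      by (subst nn_integral_cmult) auto
  qed
  also have "\<dots> = ennreal (2 * pi) * (ennreal pi * (\<Sum>n. ennreal ((cmod (\<alpha> n))\<^sup>2) * moment w n))"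
    unfolding ennreal_suminf_cmult[symmetric]
    by (intro suminf_cong) (simp only: ennreal_mult'' pi_ge_zero zero_le_power2 mult_ac zero_le_numeral mult_nonneg_nonneg)
  finally have "(\<integral>\<^sup>+z. H z \<partial>lborel) = ennreal pi * (\<Sum>n. ennreal ((cmod (\<alpha> n))\<^sup>2) * moment w n)"
    by (subst (asm) ennreal_mult_cancel_left) auto
  then show ?thesis by (simp only: H)
qed

section \<open>Hilbert's inequality\<close>

text \<open>The row sum for Schur's test with weights \<open>1 / sqrt (n + 1)\<close>. For
  \<open>n \<le> m\<close> the factor \<open>m + n + 1\<close> is bounded below by
  \<open>m + 1\<close>, for larger \<open>n\<close> by \<open>n + 1\<close>; each of the two
  resulting sums telescopes and contributes at most 2.\<close>

lemma hilbert_row_sum: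
  "(\<Sum>n<N. sqrt (real m + 1) / (sqrt (real n + 1) * (real m + real n + 1))) \<le> 4"
proof -
  define s where "s = sqrt (real m + 1)"
  have s: "s > 0" "s * s = real m + 1" by (auto simp: s_def)
  \<comment> \<open>Both expressions equal 2 at \<open>N = m + 1\<close>, where the induction passes
    from one regime to the other.\<close>
  have "(\<Sum>n<N. s / (sqrt (real n + 1) * (real m + real n + 1)))
    \<le> (if N \<le> m + 1 then 2 * sqrt (real N) / s else 4 - 2 * s / sqrt (real N))"
  proof (induction N)
    case (Suc N)
    define a where "a = sqrt (real N)"
    define b where "b = sqrt (real N + 1)"
    have ab: "0 \<le> a" "a \<le> b" "0 < b" "a * a = real N" "b * b = real N + 1"
      by (auto simp: a_def b_def)
    have diff: "(b - a) * (b + a) = 1" using ab by (simp add: algebra_simps)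
    have b2: "1 \<le> (b - a) * (2 * b)"
      using mult_left_mono[of "b + a" "2 * b" "b - a"] ab diff by simp
    have b': "sqrt (real (Suc N)) = b" by (simp add: b_def add.commute)
    show ?case
    proof (cases "N \<le> m")
      case True
      have "s / (b * (real m + real N + 1)) \<le> s / (b * (s * s))"
        using s ab by (intro divide_left_mono mult_left_mono mult_pos_pos) auto
      also have "\<dots> = 1 / (b * s)" using s(1) by simp
      also have "\<dots> \<le> 2 * (b - a) / s"
        using b2 s ab by (simp add: field_simps)
      finally have "s / (b * (real m + real N + 1)) \<le> 2 * (b - a) / s" .
      moreover have "(\<Sum>n<N. s / (sqrt (real n + 1) * (real m + real n + 1))) \<le> 2 * a / s"
        using Suc True by (simp add: a_def)
      moreover have "2 * a / s + 2 * (b - a) / s = 2 * b / s"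
        by (simp add: diff_divide_distrib right_diff_distrib)
      ultimately have "(\<Sum>n<Suc N. s / (sqrt (real n + 1) * (real m + real n + 1))) \<le> 2 * b / s"
        by (simp add: b_def)
      then show ?thesis using True by (simp only: b') simp
    next
      case False
      then have N: "N \<ge> 1" "a > 0" by (auto simp: a_def)
      have "s / (b * (real m + real N + 1)) \<le> s / (b * (b * b))"
        using s ab by (intro divide_left_mono mult_left_mono mult_pos_pos) auto
      also have "\<dots> \<le> 2 * s / a - 2 * s / b"
      proof -
        have "1 / (b * b * b) \<le> 2 / a - 2 / b"
        proof -
          have "a * 1 \<le> b * ((b - a) * (2 * b))"
            by (intro mult_mono b2) (use ab in auto)
          then have "a / (a * b * (b * b)) \<le> b * ((b - a) * (2 * b)) / (a * b * (b * b))"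
            using N(2) ab(3) by (intro divide_right_mono) auto
          moreover have "a / (a * b * (b * b)) = 1 / (b * b * b)"
            "b * ((b - a) * (2 * b)) / (a * b * (b * b)) = 2 / a - 2 / b"
            using N(2) ab(3) by (simp_all add: diff_divide_distrib left_diff_distrib right_diff_distrib)
          ultimately show ?thesis by simp
        qed
        from mult_left_mono[OF this, of s] show ?thesis using s by (simp add: algebra_simps)
      qed
      finally have *: "s / (b * (real m + real N + 1)) \<le> 2 * s / a - 2 * s / b" .
      have "(\<Sum>n<N. s / (sqrt (real n + 1) * (real m + real n + 1))) \<le> 4 - 2 * s / a"
      proof (cases "N = m + 1")
        case True
        then have "a = s" by (simp add: a_def s_def add.commute)
        moreover have "(\<Sum>n<N. s / (sqrt (real n + 1) * (real m + real n + 1))) \<le> 2 * a / s"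
          using Suc True unfolding a_def by (simp only: split: if_split_asm)
        ultimately show ?thesis using s by simp
      next
        case False
        then show ?thesis using Suc \<open>\<not> N \<le> m\<close> by (simp add: a_def)
      qed
      then have "(\<Sum>n<Suc N. s / (sqrt (real n + 1) * (real m + real n + 1))) \<le> 4 - 2 * s / b"
        using * by (simp add: b_def)
      then show ?thesis using False by (simp only: b') simp
    qed
  qed simp
  also have "\<dots> \<le> 4"
  proof -
    have "sqrt (real N) \<le> s" if "N \<le> m + 1"
      unfolding s_def using that by (simp add: of_nat_le_iff[symmetric] del: of_nat_le_iff)
    then show ?thesis using s by (auto simp: field_simps)
  qed
  finally show ?thesis by (simp add: s_def)
qed

text \<open>Schur's test: the product \<open>x m * x n\<close> is split by the inequality between
  arithmetic and geometric means with the ratio \<open>s m / s n\<close>, and the row sums are at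
  most 4. The sharp constant is pi, but any finite constant serves here.\<close>

lemma hilbert_inequality:
  fixes x :: "nat \<Rightarrow> real"
  shows "(\<Sum>m<N. \<Sum>n<N. x m * x n / (real m + real n + 1)) \<le> 4 * (\<Sum>n<N. (x n)\<^sup>2)"
proof -
  define s where "s n = sqrt (real n + 1)" for n
  define R where "R m n = s m / (s n * (real m + real n + 1))" for m n
  have s: "s n > 0" for n by (simp add: s_def)
  have le: "x m * x n / (real m + real n + 1) \<le> (x m)\<^sup>2 * R m n / 2 + (x n)\<^sup>2 * R n m / 2" for m n
  proof -
    have "2 * x m * x n * s m * s n \<le> (x m * s m)\<^sup>2 + (x n * s n)\<^sup>2"
      using sum_squares_bound[of "x m * s m" "x n * s n"] by (simp add: mult_ac)
    then have "2 * x m * x n \<le> (x m)\<^sup>2 * (s m / s n) + (x n)\<^sup>2 * (s n / s m)"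
      using s[of m] s[of n] by (simp add: field_simps power2_eq_square)
    then have "2 * x m * x n / (real m + real n + 1) \<le>
       ((x m)\<^sup>2 * (s m / s n) + (x n)\<^sup>2 * (s n / s m)) / (real m + real n + 1)"
      by (rule divide_right_mono) simp
    moreover have "((x m)\<^sup>2 * (s m / s n) + (x n)\<^sup>2 * (s n / s m)) / (real m + real n + 1)
       = 2 * ((x m)\<^sup>2 * R m n / 2 + (x n)\<^sup>2 * R n m / 2)"
      by (simp add: R_def add_divide_distrib add_ac)
    ultimately show ?thesis by simp
  qed
  have "(\<Sum>m<N. \<Sum>n<N. x m * x n / (real m + real n + 1))
      \<le> (\<Sum>m<N. \<Sum>n<N. (x m)\<^sup>2 * R m n / 2 + (x n)\<^sup>2 * R n m / 2)"
    by (intro sum_mono le)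
  also have "\<dots> = (\<Sum>m<N. \<Sum>n<N. (x m)\<^sup>2 * R m n / 2) + (\<Sum>m<N. \<Sum>n<N. (x n)\<^sup>2 * R n m / 2)"
    by (simp add: sum.distrib)
  also have "(\<Sum>m<N. \<Sum>n<N. (x n)\<^sup>2 * R n m / 2) = (\<Sum>m<N. \<Sum>n<N. (x m)\<^sup>2 * R m n / 2)"
    by (rule sum.swap)
  also have "(\<Sum>m<N. \<Sum>n<N. (x m)\<^sup>2 * R m n / 2) + (\<Sum>m<N. \<Sum>n<N. (x m)\<^sup>2 * R m n / 2)
      = (\<Sum>m<N. (x m)\<^sup>2 * (\<Sum>n<N. R m n))"
    by (simp add: sum_divide_distrib[symmetric] sum_distrib_left)
  also have "\<dots> \<le> (\<Sum>m<N. (x m)\<^sup>2 * 4)"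
    unfolding R_def s_def by (intro sum_mono mult_left_mono hilbert_row_sum) simp
  finally show ?thesis by (simp add: sum_distrib_left mult.commute)
qed

text \<open>Expanding the square and integrating yields the Hilbert matrix applied to the numbers
  \<open>x n * \<rho> ^ n\<close>, with one extra factor \<open>\<rho>\<close>. That factor later
  supplies the odd power in \<open>moment\<close>.\<close>

lemma nn_integral_power_sum_square_le:
  fixes x :: "nat \<Rightarrow> real"
  assumes \<rho>: "0 \<le> \<rho>"
  shows "(\<integral>\<^sup>+t. ennreal ((\<Sum>n<N. x n * t ^ n)\<^sup>2) * indicator {0..\<rho>} t \<partial>lborel)
    \<le> ennreal (4 * \<rho> * (\<Sum>n<N. (x n)\<^sup>2 * \<rho> ^ (2 * n)))"
proof -
  have "((\<lambda>t. \<Sum>m<N. \<Sum>n<N. x m * x n * t ^ (m + n)) has_integral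
      (\<Sum>m<N. \<Sum>n<N. x m * x n * (\<rho> ^ (m + n + 1) / real (m + n + 1)))) {0..\<rho>}"
  proof (intro has_integral_sum has_integral_mult_right)
    fix m n
    have "((\<lambda>t. t ^ (m + n)) has_integral (\<rho> ^ (m + n + 1) / real (m + n + 1) - 0 ^ (m + n + 1) / real (m + n + 1))) {0..\<rho>}"
    proof (rule fundamental_theorem_of_calculus[OF \<rho>])
      fix t :: real
      show "((\<lambda>t. t ^ (m + n + 1) / real (m + n + 1)) has_vector_derivative t ^ (m + n)) (at t within {0..\<rho>})"
        unfolding has_real_derivative_iff_has_vector_derivative[symmetric]
        by (rule DERIV_cong[OF DERIV_cdivide[OF DERIV_power[OF DERIV_ident]]]) simp
    qed
    then show "((\<lambda>t. t ^ (m + n)) has_integral (\<rho> ^ (m + n + 1) / real (m + n + 1))) {0..\<rho>}" by simp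
  qed auto
  moreover have "(\<Sum>m<N. \<Sum>n<N. x m * x n * t ^ (m + n)) = (\<Sum>n<N. x n * t ^ n)\<^sup>2" for t
    by (simp add: power2_eq_square sum_product power_add mult_ac)
  ultimately have "(\<integral>\<^sup>+t. ennreal ((\<Sum>n<N. x n * t ^ n)\<^sup>2) * indicator {0..\<rho>} t \<partial>lborel)
      = ennreal (\<Sum>m<N. \<Sum>n<N. x m * x n * (\<rho> ^ (m + n + 1) / real (m + n + 1)))"
    by (intro nn_integral_has_integral_lebesgue') auto
  also have "(\<Sum>m<N. \<Sum>n<N. x m * x n * (\<rho> ^ (m + n + 1) / real (m + n + 1)))
      = \<rho> * (\<Sum>m<N. \<Sum>n<N. (x m * \<rho> ^ m) * (x n * \<rho> ^ n) / (real m + real n + 1))"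
    by (simp add: sum_distrib_left power_add mult_ac add_ac)
  also have "ennreal \<dots> \<le> ennreal (\<rho> * (4 * (\<Sum>n<N. (x n * \<rho> ^ n)\<^sup>2)))"
    by (intro ennreal_leI mult_left_mono hilbert_inequality \<rho>)
  finally show ?thesis
    by (simp add: power_mult_distrib power_mult[symmetric] mult_ac)
qed

text \<open>The extended-valued form of \<open>vhat\<close> for the profile \<open>w\<close>,
  available before finiteness is established.\<close>

definition tail :: "(real \<Rightarrow> real) \<Rightarrow> real \<Rightarrow> ennreal" where
  "tail w r = (\<integral>\<^sup>+s. indicator {r<..<1} s * ennreal (w s) \<partial>lborel)"

text \<open>Writing \<open>tail w t\<close> as an integral over \<open>s > t\<close> and exchanging
  the order leaves, for each \<open>s\<close>, the integral of the squared series over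
  \<open>(0, s)\<close>, to which the previous bound applies with \<open>\<rho> = s\<close>. The
  constant comes from \<open>4 * s * s ^ (2 * n) = 2 * (2 * s ^ (2 * n + 1))\<close>.\<close>

lemma nn_integral_power_series_tail_le:
  fixes x :: "nat \<Rightarrow> real"
  assumes x: "\<And>n. 0 \<le> x n" and w [measurable]: "w \<in> borel_measurable borel" and w0: "\<And>r. 0 \<le> w r"
  shows "(\<integral>\<^sup>+t. indicator {0<..<1} t * (\<Sum>n. ennreal (x n * t ^ n))\<^sup>2 * tail w t \<partial>lborel)
    \<le> 2 * (\<Sum>n. ennreal ((x n)\<^sup>2) * moment w n)"
proof -
  define \<phi> where "\<phi> t = indicator {0<..<1} t * (\<Sum>n. ennreal (x n * t ^ n))" for t :: real
  have \<phi>0: "\<phi> t = 0" if "t \<le> 0" for t using that by (simp add: \<phi>_def)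
  have [measurable]: "\<phi> \<in> borel_measurable borel" unfolding \<phi>_def by measurable
  have inner: "(\<integral>\<^sup>+t. indicator {0<..<\<rho>} t * (\<phi> t)\<^sup>2 \<partial>lborel) \<le> ennreal (4 * \<rho>) * (\<Sum>n. ennreal ((x n)\<^sup>2 * \<rho> ^ (2 * n)))"
    if \<rho>: "0 < \<rho>" "\<rho> < 1" for \<rho>
  proof -
    \<comment> \<open>Nonnegative coefficients make the squared partial sums increasing, so the
      finite inequality passes to the series by monotone convergence.\<close>
    have "(\<integral>\<^sup>+t. indicator {0<..<\<rho>} t * (\<phi> t)\<^sup>2 \<partial>lborel)
       = (\<integral>\<^sup>+t. (SUP N. ennreal ((\<Sum>n<N. x n * t ^ n)\<^sup>2) * indicator {0<..<\<rho>} t) \<partial>lborel)"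
    proof (rule nn_integral_cong)
      fix t :: real
      show "indicator {0<..<\<rho>} t * (\<phi> t)\<^sup>2 = (SUP N. ennreal ((\<Sum>n<N. x n * t ^ n)\<^sup>2) * indicator {0<..<\<rho>} t)"
      proof (cases "t \<in> {0<..<\<rho>}")
        case True
        then have t: "0 < t" "t < 1" using \<rho> by auto
        have pow: "ennreal ((\<Sum>n<N. x n * t ^ n)\<^sup>2) = (\<Sum>n<N. ennreal (x n * t ^ n))\<^sup>2" for N
          by (subst sum_ennreal) (use x t in \<open>auto simp: ennreal_power sum_nonneg\<close>)
        have inc: "incseq (\<lambda>N. (\<Sum>n<N. ennreal (x n * t ^ n))\<^sup>2)"
          by (intro incseq_SucI power_mono) auto
        have "(\<lambda>N. (\<Sum>n<N. ennreal (x n * t ^ n))\<^sup>2) \<longlonglongrightarrow> (\<Sum>n. ennreal (x n * t ^ n))\<^sup>2"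
          unfolding power2_eq_square by (intro tendsto_mult_ennreal summable_LIMSEQ) (auto intro: disjI2)
        then have "(SUP N. (\<Sum>n<N. ennreal (x n * t ^ n))\<^sup>2) = (\<Sum>n. ennreal (x n * t ^ n))\<^sup>2"
          using LIMSEQ_unique LIMSEQ_SUP[OF inc] by blast
        then show ?thesis using True t by (simp add: \<phi>_def pow)
      qed simp
    qed
    also have "\<dots> = (SUP N. \<integral>\<^sup>+t. ennreal ((\<Sum>n<N. x n * t ^ n)\<^sup>2) * indicator {0<..<\<rho>} t \<partial>lborel)"
      using x by (intro nn_integral_monotone_convergence_SUP)
        (auto intro!: incseq_SucI le_funI ennreal_leI power_mono sum_nonneg split: split_indicator)
    also have "\<dots> \<le> ennreal (4 * \<rho>) * (\<Sum>n. ennreal ((x n)\<^sup>2 * \<rho> ^ (2 * n)))"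
    proof (rule SUP_least)
      fix N
      have "(\<integral>\<^sup>+t. ennreal ((\<Sum>n<N. x n * t ^ n)\<^sup>2) * indicator {0<..<\<rho>} t \<partial>lborel)
         \<le> (\<integral>\<^sup>+t. ennreal ((\<Sum>n<N. x n * t ^ n)\<^sup>2) * indicator {0..\<rho>} t \<partial>lborel)"
        by (intro nn_integral_mono) (auto split: split_indicator)
      also have "\<dots> \<le> ennreal (4 * \<rho> * (\<Sum>n<N. (x n)\<^sup>2 * \<rho> ^ (2 * n)))"
        by (rule nn_integral_power_sum_square_le) (use \<rho> in auto)
      also have "\<dots> = ennreal (4 * \<rho>) * (\<Sum>n<N. ennreal ((x n)\<^sup>2 * \<rho> ^ (2 * n)))"
        using \<rho> by (subst sum_ennreal) (auto simp: ennreal_mult[symmetric] sum_nonneg)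
      also have "\<dots> \<le> ennreal (4 * \<rho>) * (\<Sum>n. ennreal ((x n)\<^sup>2 * \<rho> ^ (2 * n)))"
        by (intro mult_left_mono sum_le_suminf) auto
      finally show "(\<integral>\<^sup>+t. ennreal ((\<Sum>n<N. x n * t ^ n)\<^sup>2) * indicator {0<..<\<rho>} t \<partial>lborel)
         \<le> ennreal (4 * \<rho>) * (\<Sum>n. ennreal ((x n)\<^sup>2 * \<rho> ^ (2 * n)))" .
    qed
    finally show ?thesis .
  qed
  have "(\<integral>\<^sup>+t. indicator {0<..<1} t * (\<Sum>n. ennreal (x n * t ^ n))\<^sup>2 * tail w t \<partial>lborel)
     = (\<integral>\<^sup>+t. (\<integral>\<^sup>+s. indicator {0<..<1} s * (if t < s then ennreal (w s) * (\<phi> t)\<^sup>2 else 0) \<partial>lborel) \<partial>lborel)"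
  proof (rule nn_integral_cong)
    fix t :: real
    have sq: "indicator {0<..<1} t * (\<Sum>n. ennreal (x n * t ^ n))\<^sup>2 = (\<phi> t)\<^sup>2"
      by (simp add: \<phi>_def split: split_indicator)
    have "(\<phi> t)\<^sup>2 * tail w t
       = (\<integral>\<^sup>+s. (\<phi> t)\<^sup>2 * (indicator {t<..<1} s * ennreal (w s)) \<partial>lborel)"
      unfolding tail_def by (rule nn_integral_cmult[symmetric]) measurable
    also have "\<dots> = (\<integral>\<^sup>+s. indicator {0<..<1} s * (if t < s then ennreal (w s) * (\<phi> t)\<^sup>2 else 0) \<partial>lborel)"
      using \<phi>0[of t] by (intro nn_integral_cong) (auto simp: mult_ac split: split_indicator)
    finally show "indicator {0<..<1} t * (\<Sum>n. ennreal (x n * t ^ n))\<^sup>2 * tail w t = \<dots>"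
      unfolding sq .
  qed
  also have "\<dots> = (\<integral>\<^sup>+s. (\<integral>\<^sup>+t. indicator {0<..<1} s * (if t < s then ennreal (w s) * (\<phi> t)\<^sup>2 else 0) \<partial>lborel) \<partial>lborel)"
    by (subst lborel_pair.Fubini') auto
  also have "\<dots> = (\<integral>\<^sup>+s. indicator {0<..<1} s * ennreal (w s) * (\<integral>\<^sup>+t. indicator {0<..<s} t * (\<phi> t)\<^sup>2 \<partial>lborel) \<partial>lborel)"
    by (intro nn_integral_cong, subst nn_integral_cmult[symmetric], measurable)
      (auto intro!: nn_integral_cong simp: \<phi>_def power2_eq_square mult_ac split: split_indicator)
  also have "\<dots> \<le> (\<integral>\<^sup>+s. indicator {0<..<1} s * ennreal (w s) * (ennreal (4 * s) * (\<Sum>n. ennreal ((x n)\<^sup>2 * s ^ (2 * n)))) \<partial>lborel)"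
  proof (rule nn_integral_mono)
    fix s :: real
    show "indicator {0<..<1} s * ennreal (w s) * (\<integral>\<^sup>+t. indicator {0<..<s} t * (\<phi> t)\<^sup>2 \<partial>lborel)
      \<le> indicator {0<..<1} s * ennreal (w s) * (ennreal (4 * s) * (\<Sum>n. ennreal ((x n)\<^sup>2 * s ^ (2 * n))))"
    proof (cases "s \<in> {0<..<1}")
      case True
      then show ?thesis by (intro mult_left_mono inner) auto
    qed simp
  qed
  also have "\<dots> = (\<integral>\<^sup>+s. (\<Sum>n. (2 * ennreal ((x n)\<^sup>2)) * (indicator {0<..<1} s * ennreal (2 * s ^ (2 * n + 1) * w s))) \<partial>lborel)"
  proof (intro nn_integral_cong)
    fix s :: real
    have "ennreal (w s) * (ennreal (4 * s) * (\<Sum>n. ennreal ((x n)\<^sup>2 * s ^ (2 * n))))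
      = (\<Sum>n. (2 * ennreal ((x n)\<^sup>2)) * ennreal (2 * s ^ (2 * n + 1) * w s))" if "0 < s"
      unfolding ennreal_suminf_cmult[symmetric] using that w0[of s]
    proof (intro suminf_cong)
      fix n
      have "2 * ennreal ((x n)\<^sup>2) = ennreal (2 * (x n)\<^sup>2)"
        by (rule numeral_mult_ennreal) simp
      then show "ennreal (w s) * (ennreal (4 * s) * ennreal ((x n)\<^sup>2 * s ^ (2 * n)))
        = 2 * ennreal ((x n)\<^sup>2) * ennreal (2 * s ^ (2 * n + 1) * w s)"
        using that w0[of s] by (simp add: ennreal_mult''[symmetric] mult_ac)
    qed
    then show "indicator {0<..<1} s * ennreal (w s) * (ennreal (4 * s) * (\<Sum>n. ennreal ((x n)\<^sup>2 * s ^ (2 * n))))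
      = (\<Sum>n. (2 * ennreal ((x n)\<^sup>2)) * (indicator {0<..<1} s * ennreal (2 * s ^ (2 * n + 1) * w s)))"
      by (simp split: split_indicator)
  qed
  also have "\<dots> = (\<Sum>n. 2 * (ennreal ((x n)\<^sup>2) * moment w n))"
    by (subst nn_integral_suminf, measurable, subst nn_integral_cmult, measurable)
      (simp add: moment_def mult.assoc)
  finally show ?thesis by simp
qed

section \<open>Weighted Hardy inequalities\<close>

text \<open>Nothing is assumed at the end points, where \<open>g\<close> may be unbounded. The
  fundamental theorem is applied on compact subintervals, and Fatou's lemma gives the inequality in
  the limit.\<close>

lemma nn_integral_FTC_Ioo_le:
  fixes G g :: "real \<Rightarrow> real"
  assumes ab: "a < b" and [measurable]: "g \<in> borel_measurable borel"
    and G: "\<And>x. a < x \<Longrightarrow> x < b \<Longrightarrow> (G has_real_derivative g x) (at x)"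
    and g: "\<And>x. a < x \<Longrightarrow> x < b \<Longrightarrow> 0 \<le> g x"
    and mM: "\<And>x. a < x \<Longrightarrow> x < b \<Longrightarrow> m \<le> G x \<and> G x \<le> M"
  shows "(\<integral>\<^sup>+x. indicator {a<..<b} x * ennreal (g x) \<partial>lborel) \<le> ennreal (M - m)"
proof -
  \<comment> \<open>The summand 3 keeps \<open>e n\<close> below half the length, so that every
    \<open>J n\<close> is a proper interval.\<close>
  define e where "e n = (b - a) / (real n + 3)" for n
  define J where "J n = {a + e n .. b - e n}" for n
  have e: "0 < e n" "e n < (b - a) / 2" for n
    unfolding e_def using ab by (simp, intro divide_strict_left_mono, auto)
  have "(\<lambda>n. (b - a) * (1 / real (n + 3))) \<longlonglongrightarrow> (b - a) * 0"
    by (intro tendsto_mult tendsto_const LIMSEQ_ignore_initial_segment lim_1_over_n)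
  then have e_lim: "e \<longlonglongrightarrow> 0" by (simp add: e_def[abs_def])
  have int: "(\<integral>\<^sup>+x. indicator (J n) x * ennreal (g x) \<partial>lborel) \<le> ennreal (M - m)" for n
  proof -
    have "(g has_integral (G (b - e n) - G (a + e n))) (J n)"
      unfolding J_def using e[of n]
      by (intro fundamental_theorem_of_calculus)
        (auto simp: has_real_derivative_iff_has_vector_derivative[symmetric] intro!: DERIV_subset[OF G])
    then have "(\<integral>\<^sup>+x. ennreal (g x) * indicator (J n) x \<partial>lborel) = ennreal (G (b - e n) - G (a + e n))"
      using e[of n] by (intro nn_integral_has_integral_lebesgue') (auto simp: J_def intro!: g)
    moreover have "G (b - e n) - G (a + e n) \<le> M - m"
      using mM[of "b - e n"] mM[of "a + e n"] e[of n] by auto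
    ultimately show ?thesis by (simp add: mult.commute ennreal_leI)
  qed
  have "(\<integral>\<^sup>+x. indicator {a<..<b} x * ennreal (g x) \<partial>lborel)
      = (\<integral>\<^sup>+x. liminf (\<lambda>n. indicator (J n) x * ennreal (g x)) \<partial>lborel)"
  proof (rule nn_integral_cong)
    fix x
    have "\<forall>\<^sub>F n in sequentially. indicator (J n) x * ennreal (g x) = indicator {a<..<b} x * ennreal (g x)"
    proof (cases "a < x \<and> x < b")
      case True
      then have "\<forall>\<^sub>F n in sequentially. e n < min (x - a) (b - x)"
        by (intro order_tendstoD(2)[OF e_lim]) auto
      then show ?thesis by eventually_elim (use True in \<open>auto simp: J_def\<close>)
    next
      case False
      then have "x \<notin> J n" for n using e[of n] by (auto simp: J_def)
      then show ?thesis using False by simp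
    qed
    then have "(\<lambda>n. indicator (J n) x * ennreal (g x)) \<longlonglongrightarrow> indicator {a<..<b} x * ennreal (g x)"
      by (rule tendsto_eventually)
    then show "indicator {a<..<b} x * ennreal (g x) = liminf (\<lambda>n. indicator (J n) x * ennreal (g x))"
      by (rule lim_imp_Liminf[OF trivial_limit_sequentially, symmetric])
  qed
  also have "\<dots> \<le> liminf (\<lambda>n. \<integral>\<^sup>+x. indicator (J n) x * ennreal (g x) \<partial>lborel)"
    by (rule nn_integral_liminf) (auto simp: J_def)
  also have "\<dots> \<le> ennreal (M - m)"
    using int by (intro Liminf_le) auto
  finally show ?thesis .
qed

lemma nn_integral_continuous_Icc:
  fixes f :: "real \<Rightarrow> real"
  assumes "continuous_on {c..d} f" "\<And>x. x \<in> {c..d} \<Longrightarrow> 0 \<le> f x"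
  shows "(\<integral>\<^sup>+x. indicator {c..d} x * ennreal (f x) \<partial>lborel) = ennreal (integral {c..d} f)"
  using nn_integral_has_integral_lebesgue'[of "{c..d}" f, OF _ integrable_integral[OF integrable_continuous_interval]] assms
  by (simp add: mult.commute)

text \<open>Only increments over compact subintervals enter, because the integrands to which this is
  applied may fail to be bounded near 0 and 1.\<close>

lemma has_real_derivative_primitive:
  fixes f H :: "real \<Rightarrow> real"
  assumes "continuous_on {a<..<b} f" "a < x" "x < b"
    and H: "\<And>c d. a < c \<Longrightarrow> c \<le> d \<Longrightarrow> d < b \<Longrightarrow> H d - H c = integral {c..d} f"
  shows "(H has_real_derivative f x) (at x)"
proof -
  obtain c where c: "a < c" "c < x" using dense assms by blast
  obtain d where d: "x < d" "d < b" using dense assms by blast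
  have "((\<lambda>y. integral {c..y} f) has_real_derivative f x) (at x within {c..d})"
    by (rule integral_has_real_derivative) (use c d assms(1) in \<open>auto intro: continuous_on_subset\<close>)
  then have "((\<lambda>y. integral {c..y} f) has_real_derivative f x) (at x)"
    using c d by (simp add: at_within_Icc_at)
  then have "((\<lambda>y. H c + integral {c..y} f) has_real_derivative f x) (at x)"
    by (auto intro!: derivative_eq_intros)
  then show ?thesis
  proof (rule has_field_derivative_transform_within_open[of _ _ _ "{c<..<d}"])
    fix y assume "y \<in> {c<..<d}"
    then have "H y - H c = integral {c..y} f" using c d by (intro H) auto
    then show "H c + integral {c..y} f = H y" by (simp add: algebra_simps)
  qed (use c d in auto)
qed

lemma nn_integral_Ioo_pos:
  fixes f :: "real \<Rightarrow> real"
  assumes "a < b" and [measurable]: "f \<in> borel_measurable borel" and "\<And>x. a < x \<Longrightarrow> x < b \<Longrightarrow> 0 < f x"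
  shows "0 < (\<integral>\<^sup>+x. indicator {a<..<b} x * ennreal (f x) \<partial>lborel)"
proof (rule ccontr)
  assume "\<not> ?thesis"
  then have "AE x in lborel. indicator {a<..<b} x * ennreal (f x) = 0"
    by (subst (asm) not_gr_zero, subst (asm) nn_integral_0_iff_AE) auto
  then have "AE x in lborel. x \<notin> {a<..<b}"
  proof eventually_elim
    case (elim x)
    then show ?case using assms(3)[of x] by (auto split: split_indicator_asm simp: ennreal_eq_0_iff)
  qed
  then have "emeasure lborel {a<..<b} = 0"
    using AE_iff_null_sets[of "{a<..<b}" lborel] by auto
  then show False using assms(1) by simp
qed

lemma nn_integral_Ioo_measurable [measurable]:
  fixes f :: "real \<Rightarrow> ennreal"
  assumes [measurable]: "f \<in> borel_measurable borel"
  shows "(\<lambda>x. \<integral>\<^sup>+t. indicator {x<..<1} t * f t \<partial>lborel) \<in> borel_measurable borel"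
    and "(\<lambda>x. \<integral>\<^sup>+t. indicator {0<..<x} t * f t \<partial>lborel) \<in> borel_measurable borel"
proof -
  have "(\<lambda>x. \<integral>\<^sup>+t. (if x < t \<and> t < 1 then f t else 0) \<partial>lborel) \<in> borel_measurable borel"
    "(\<lambda>x. \<integral>\<^sup>+t. (if 0 < t \<and> t < x then f t else 0) \<partial>lborel) \<in> borel_measurable borel"
    by measurable
  moreover have "(if x < t \<and> t < 1 then f t else 0) = indicator {x<..<1} t * f t"
    "(if 0 < t \<and> t < x then f t else 0) = indicator {0<..<x} t * f t" for x t
    by auto
  ultimately show "(\<lambda>x. \<integral>\<^sup>+t. indicator {x<..<1} t * f t \<partial>lborel) \<in> borel_measurable borel"
    "(\<lambda>x. \<integral>\<^sup>+t. indicator {0<..<x} t * f t \<partial>lborel) \<in> borel_measurable borel"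
    by (simp_all only:)
qed

text \<open>Muckenhoupt's argument: apply the Cauchy-Schwarz inequality after inserting the factor \<open>W\<^bsup>1/4\<^esup>\<close>, where
  \<open>W(x)\<close> is the integral of \<open>\<kappa>\<close> over \<open>(0, x)\<close>; both remaining integrals are then explicit.\<close>

theorem hardy_inequality:
  fixes u \<kappa> :: "real \<Rightarrow> real" and \<phi> :: "real \<Rightarrow> ennreal"
  assumes [measurable]: "u \<in> borel_measurable borel" "\<kappa> \<in> borel_measurable borel" "\<phi> \<in> borel_measurable borel"
    and cont: "continuous_on {0<..<1} u" "continuous_on {0<..<1} \<kappa>"
    and pos: "\<And>x. 0 < x \<Longrightarrow> x < 1 \<Longrightarrow> 0 < u x" "\<And>x. 0 < x \<Longrightarrow> x < 1 \<Longrightarrow> 0 < \<kappa> x"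
    and A: "0 \<le> A" and AB: "\<And>r. 0 < r \<Longrightarrow> r < 1 \<Longrightarrow>
      (\<integral>\<^sup>+s. indicator {r<..<1} s * ennreal (u s) \<partial>lborel) * (\<integral>\<^sup>+s. indicator {0<..<r} s * ennreal (\<kappa> s) \<partial>lborel) \<le> ennreal A"
  shows "(\<integral>\<^sup>+x. indicator {0<..<1} x * ennreal (u x) * (\<integral>\<^sup>+t. indicator {0<..<x} t * \<phi> t \<partial>lborel)\<^sup>2 \<partial>lborel)
    \<le> ennreal (4 * A) * (\<integral>\<^sup>+t. indicator {0<..<1} t * (\<phi> t)\<^sup>2 * ennreal (1 / \<kappa> t) \<partial>lborel)"
proof -
  define Wn where "Wn x = (\<integral>\<^sup>+s. indicator {0<..<x} s * ennreal (\<kappa> s) \<partial>lborel)" for x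
  define Qn where "Qn x = (\<integral>\<^sup>+s. indicator {x<..<1} s * ennreal (u s) \<partial>lborel)" for x
  define W where "W x = enn2real (Wn x)" for x
  define U where "U x = enn2real (Qn x)" for x
  have [measurable]: "W \<in> borel_measurable borel" unfolding W_def Wn_def by measurable
  have [measurable]: "U \<in> borel_measurable borel" unfolding U_def Qn_def by measurable
  have Wpos: "0 < Wn x" and Upos: "0 < Qn x" if "0 < x" "x < 1" for x
    unfolding Wn_def Qn_def using that pos by (auto intro!: nn_integral_Ioo_pos)
  have UW: "Qn x * Wn x \<le> ennreal A" if "0 < x" "x < 1" for x
    unfolding Wn_def Qn_def using that by (rule AB)
  \<comment> \<open>The product is finite and neither factor is zero, so each factor is finite; the
    condition at a single \<open>r\<close> already gives both local integrability
    statements.\<close>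
  have fin: "Wn x < top" "Qn x < top" if "0 < x" "x < 1" for x
  proof -
    have "Qn x * Wn x < top" using UW[OF that] le_less_trans ennreal_less_top by blast
    then show "Wn x < top" "Qn x < top"
      using Wpos[OF that] Upos[OF that] by (auto simp: ennreal_mult_less_top)
  qed
  have WnE: "Wn x = ennreal (W x)" and QnE: "Qn x = ennreal (U x)" if "0 < x" "x < 1" for x
    using fin[OF that] by (auto simp: W_def U_def)
  have W0: "0 < W x" and U0: "0 < U x" if "0 < x" "x < 1" for x
    using Wpos[OF that] Upos[OF that] fin[OF that] by (auto simp: W_def U_def enn2real_positive_iff)
  have UWA: "U x * W x \<le> A" if "0 < x" "x < 1" for x
    using UW[OF that] W0[OF that] U0[OF that] A by (simp add: WnE QnE that ennreal_mult[symmetric])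
  have Wdiff: "W d - W c = integral {c..d} \<kappa>" and Udiff: "(- U d) - (- U c) = integral {c..d} u"
    and nonneg_int: "0 \<le> integral {c..d} \<kappa>" "0 \<le> integral {c..d} u"
    if "0 < c" "c \<le> d" "d < 1" for c d
  proof -
    have c: "continuous_on {c..d} \<kappa>" "continuous_on {c..d} u"
      using cont that by (auto intro: continuous_on_subset)
    have p: "0 \<le> \<kappa> x" "0 \<le> u x" if "x \<in> {c..d}" for x
      using that pos[of x] \<open>0 < c\<close> \<open>d < 1\<close> by (auto intro!: less_imp_le)
    show i: "0 \<le> integral {c..d} \<kappa>" "0 \<le> integral {c..d} u"
      using p c by (auto intro!: integral_nonneg integrable_continuous_interval)
    have AE: "AE x in lborel. x \<noteq> c \<and> x \<noteq> d"
      using AE_lborel_singleton[of c] AE_lborel_singleton[of d] by eventually_elim auto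
    have "Wn d = (\<integral>\<^sup>+s. (indicator {0<..<c} s * ennreal (\<kappa> s) + indicator {c..d} s * ennreal (\<kappa> s)) \<partial>lborel)"
      unfolding Wn_def by (rule nn_integral_cong_AE)
        (use AE in eventually_elim, use that in \<open>auto split: split_indicator\<close>)
    also have "\<dots> = Wn c + ennreal (integral {c..d} \<kappa>)"
      unfolding Wn_def using nn_integral_continuous_Icc[OF c(1) p(1)] by (subst nn_integral_add) auto
    finally show "W d - W c = integral {c..d} \<kappa>"
      using WnE[of d] WnE[of c] that i W0[of c] W0[of d] by (simp add: ennreal_plus[symmetric] del: ennreal_plus)
    have "Qn c = (\<integral>\<^sup>+s. (indicator {d<..<1} s * ennreal (u s) + indicator {c..d} s * ennreal (u s)) \<partial>lborel)"
      unfolding Qn_def by (rule nn_integral_cong_AE)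
        (use AE in eventually_elim, use that in \<open>auto split: split_indicator\<close>)
    also have "\<dots> = Qn d + ennreal (integral {c..d} u)"
      unfolding Qn_def using nn_integral_continuous_Icc[OF c(2) p(2)] by (subst nn_integral_add) auto
    finally show "(- U d) - (- U c) = integral {c..d} u"
      using QnE[of d] QnE[of c] that i U0[of c] U0[of d] by (simp add: ennreal_plus[symmetric] del: ennreal_plus)
  qed
  have dW: "(W has_real_derivative \<kappa> x) (at x)" and dU: "((\<lambda>x. - U x) has_real_derivative u x) (at x)"
    if "0 < x" "x < 1" for x
    using that by (auto intro!: has_real_derivative_primitive[of 0 1] cont Wdiff Udiff)
  have dU': "(U has_real_derivative - u x) (at x)" if "0 < x" "x < 1" for x
    using DERIV_minus[OF dU[OF that]] by simp
  have I1: "(\<integral>\<^sup>+t. indicator {0<..<x} t * ennreal (\<kappa> t / sqrt (W t)) \<partial>lborel) \<le> ennreal (2 * sqrt (W x))"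
    if x: "0 < x" "x < 1" for x
  proof -
    have "(\<integral>\<^sup>+t. indicator {0<..<x} t * ennreal (\<kappa> t / sqrt (W t)) \<partial>lborel) \<le> ennreal (2 * sqrt (W x) - 0)"
    proof (rule nn_integral_FTC_Ioo_le[where G = "\<lambda>t. 2 * sqrt (W t)"])
      fix t assume t: "0 < t" "t < x"
      then have t1: "t < 1" using x by simp
      show "((\<lambda>t. 2 * sqrt (W t)) has_real_derivative \<kappa> t / sqrt (W t)) (at t)"
        using W0[OF t(1) t1] by (auto intro!: derivative_eq_intros dW[OF t(1) t1] simp: field_simps)
      show "0 \<le> \<kappa> t / sqrt (W t)" using pos(2)[OF t(1) t1] W0[OF t(1) t1] by simp
      show "0 \<le> 2 * sqrt (W t) \<and> 2 * sqrt (W t) \<le> 2 * sqrt (W x)"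
        using Wdiff[of t x] nonneg_int(1)[of t x] t x W0[OF t(1) t1] by simp
    qed (use x in auto)
    then show ?thesis by simp
  qed
  have I2: "(\<integral>\<^sup>+t. indicator {x<..<1} t * ennreal (u t / sqrt (U t)) \<partial>lborel) \<le> ennreal (2 * sqrt (U x))"
    if x: "0 < x" "x < 1" for x
  proof -
    have "(\<integral>\<^sup>+t. indicator {x<..<1} t * ennreal (u t / sqrt (U t)) \<partial>lborel) \<le> ennreal (0 - (- 2 * sqrt (U x)))"
    proof (rule nn_integral_FTC_Ioo_le[where G = "\<lambda>t. - 2 * sqrt (U t)"])
      fix t assume t: "x < t" "t < 1"
      then have t0: "0 < t" using x by simp
      show "((\<lambda>t. - 2 * sqrt (U t)) has_real_derivative u t / sqrt (U t)) (at t)"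
        using U0[OF t0 t(2)] by (auto intro!: derivative_eq_intros dU'[OF t0 t(2)] simp: field_simps)
      show "0 \<le> u t / sqrt (U t)" using pos(1)[OF t0 t(2)] U0[OF t0 t(2)] by simp
      show "- 2 * sqrt (U x) \<le> - 2 * sqrt (U t) \<and> - 2 * sqrt (U t) \<le> 0"
        using Udiff[of x t] nonneg_int(2)[of x t] t x U0[OF t0 t(2)] by simp
    qed (use x in auto)
    then show ?thesis by simp
  qed
  \<comment> \<open>The integrand of the first factor after Cauchy-Schwarz; the second factor has
    the integrand \<open>\<kappa> t / sqrt (W t)\<close>, the derivative of
    \<open>2 * sqrt (W t)\<close>, and is evaluated in \<open>I1\<close>.\<close>
  define \<psi> where "\<psi> t = (\<phi> t)\<^sup>2 * ennreal (sqrt (W t) / \<kappa> t)" for t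
  have [measurable]: "\<psi> \<in> borel_measurable borel" unfolding \<psi>_def by measurable
  have CS: "(\<integral>\<^sup>+t. indicator {0<..<x} t * \<phi> t \<partial>lborel)\<^sup>2
      \<le> (\<integral>\<^sup>+t. indicator {0<..<x} t * \<psi> t \<partial>lborel) * ennreal (2 * sqrt (W x))"
    if x: "0 < x" "x < 1" for x
  proof -
    define f where "f t = indicator {0<..<x} t * \<phi> t * ennreal (sqrt (sqrt (W t) / \<kappa> t))" for t
    define h where "h t = indicator {0<..<x} t * ennreal (sqrt (\<kappa> t / sqrt (W t)))" for t
    have [measurable]: "f \<in> borel_measurable lborel" "h \<in> borel_measurable lborel"
      unfolding f_def h_def by measurable
    have pt: "f t * h t = indicator {0<..<x} t * \<phi> t"
      "(f t)\<^sup>2 = indicator {0<..<x} t * \<psi> t" "(h t)\<^sup>2 = indicator {0<..<x} t * ennreal (\<kappa> t / sqrt (W t))" for t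
    proof -
      have "ennreal (sqrt (sqrt (W t) / \<kappa> t)) * ennreal (sqrt (\<kappa> t / sqrt (W t))) = 1"
        if "0 < t" "t < x"
        using W0[of t] pos(2)[of t] that x
        by (simp add: ennreal_mult[symmetric] real_sqrt_mult[symmetric])
      then show "f t * h t = indicator {0<..<x} t * \<phi> t"
        by (simp add: f_def h_def mult.assoc split: split_indicator)
      show "(f t)\<^sup>2 = indicator {0<..<x} t * \<psi> t" "(h t)\<^sup>2 = indicator {0<..<x} t * ennreal (\<kappa> t / sqrt (W t))"
        using W0[of t] pos(2)[of t] x
        by (auto simp: f_def h_def \<psi>_def power_mult_distrib ennreal_power split: split_indicator)
    qed
    have "(\<integral>\<^sup>+t. indicator {0<..<x} t * \<phi> t \<partial>lborel)\<^sup>2 \<le> (\<integral>\<^sup>+t. (f t)\<^sup>2 \<partial>lborel) * (\<integral>\<^sup>+t. (h t)\<^sup>2 \<partial>lborel)"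
      unfolding pt(1)[symmetric] by (rule Cauchy_Schwarz_nn_integral) measurable
    also have "\<dots> \<le> (\<integral>\<^sup>+t. indicator {0<..<x} t * \<psi> t \<partial>lborel) * ennreal (2 * sqrt (W x))"
      unfolding pt by (intro mult_left_mono I1 x) simp
    finally show ?thesis .
  qed
  have "(\<integral>\<^sup>+x. indicator {0<..<1} x * ennreal (u x) * (\<integral>\<^sup>+t. indicator {0<..<x} t * \<phi> t \<partial>lborel)\<^sup>2 \<partial>lborel)
     \<le> (\<integral>\<^sup>+x. \<integral>\<^sup>+t. (if 0 < t \<and> t < x \<and> x < 1 then ennreal (u x * (2 * sqrt (W x))) * \<psi> t else 0) \<partial>lborel \<partial>lborel)"
  proof (rule nn_integral_mono)
    fix x :: real
    show "indicator {0<..<1} x * ennreal (u x) * (\<integral>\<^sup>+t. indicator {0<..<x} t * \<phi> t \<partial>lborel)\<^sup>2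
      \<le> (\<integral>\<^sup>+t. (if 0 < t \<and> t < x \<and> x < 1 then ennreal (u x * (2 * sqrt (W x))) * \<psi> t else 0) \<partial>lborel)"
    proof (cases "x \<in> {0<..<1}")
      case True
      then have x: "0 < x" "x < 1" by auto
      have "(\<integral>\<^sup>+t. (if 0 < t \<and> t < x \<and> x < 1 then ennreal (u x * (2 * sqrt (W x))) * \<psi> t else 0) \<partial>lborel)
        = (\<integral>\<^sup>+t. ennreal (u x * (2 * sqrt (W x))) * (indicator {0<..<x} t * \<psi> t) \<partial>lborel)"
        using x by (intro nn_integral_cong) (auto split: split_indicator)
      also have "\<dots> = ennreal (u x * (2 * sqrt (W x))) * (\<integral>\<^sup>+t. indicator {0<..<x} t * \<psi> t \<partial>lborel)"
        by (rule nn_integral_cmult) measurable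
      also have "\<dots> = ennreal (u x) * ((\<integral>\<^sup>+t. indicator {0<..<x} t * \<psi> t \<partial>lborel) * ennreal (2 * sqrt (W x)))"
        using pos(1)[OF x] W0[OF x] by (subst ennreal_mult) (auto simp: mult_ac)
      finally show ?thesis
        using True mult_left_mono[OF CS[OF x], of "ennreal (u x)"] by simp
    qed simp
  qed
  also have "\<dots> = (\<integral>\<^sup>+t. \<integral>\<^sup>+x. (if 0 < t \<and> t < x \<and> x < 1 then ennreal (u x * (2 * sqrt (W x))) * \<psi> t else 0) \<partial>lborel \<partial>lborel)"
    by (subst lborel_pair.Fubini') auto
  also have "\<dots> \<le> (\<integral>\<^sup>+t. ennreal (4 * A) * (indicator {0<..<1} t * (\<phi> t)\<^sup>2 * ennreal (1 / \<kappa> t)) \<partial>lborel)"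
  proof (rule nn_integral_mono)
    fix t :: real
    show "(\<integral>\<^sup>+x. (if 0 < t \<and> t < x \<and> x < 1 then ennreal (u x * (2 * sqrt (W x))) * \<psi> t else 0) \<partial>lborel)
       \<le> ennreal (4 * A) * (indicator {0<..<1} t * (\<phi> t)\<^sup>2 * ennreal (1 / \<kappa> t))"
    proof (cases "t \<in> {0<..<1}")
      case True
      then have t: "0 < t" "t < 1" by auto
      have "(\<integral>\<^sup>+x. (if 0 < t \<and> t < x \<and> x < 1 then ennreal (u x * (2 * sqrt (W x))) * \<psi> t else 0) \<partial>lborel)
        \<le> (\<integral>\<^sup>+x. (\<psi> t * ennreal (2 * sqrt A)) * (indicator {t<..<1} x * ennreal (u x / sqrt (U x))) \<partial>lborel)"
      proof (rule nn_integral_mono)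
        fix x :: real
        show "(if 0 < t \<and> t < x \<and> x < 1 then ennreal (u x * (2 * sqrt (W x))) * \<psi> t else 0)
          \<le> (\<psi> t * ennreal (2 * sqrt A)) * (indicator {t<..<1} x * ennreal (u x / sqrt (U x)))"
        proof (cases "t < x \<and> x < 1")
          case True
          then have x: "0 < x" "x < 1" using t by auto
          \<comment> \<open>The Muckenhoupt condition at \<open>x\<close> trades \<open>W\<close>
            for \<open>U\<close>; the outer integrand becomes \<open>u x / sqrt (U x)\<close>, the
            derivative of \<open>- 2 * sqrt (U x)\<close>.\<close>
          have "sqrt (U x) * sqrt (W x) \<le> sqrt A"
            using UWA[OF x] by (simp add: real_sqrt_mult[symmetric])
          then have "sqrt (W x) \<le> sqrt A / sqrt (U x)"
            using U0[OF x] by (simp add: field_simps)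
          then have "u x * (2 * sqrt (W x)) \<le> u x * (2 * (sqrt A / sqrt (U x)))"
            using pos(1)[OF x] by (intro mult_left_mono) auto
          then have "ennreal (u x * (2 * sqrt (W x))) \<le> ennreal (2 * sqrt A) * ennreal (u x / sqrt (U x))"
            using A pos(1)[OF x] U0[OF x] by (subst ennreal_mult[symmetric]) (auto simp: mult_ac intro!: ennreal_leI)
          then have "ennreal (u x * (2 * sqrt (W x))) * \<psi> t \<le> ennreal (2 * sqrt A) * ennreal (u x / sqrt (U x)) * \<psi> t"
            by (rule mult_right_mono) simp
          then show ?thesis using True t by (simp add: mult_ac)
        qed auto
      qed
      also have "\<dots> = (\<psi> t * ennreal (2 * sqrt A)) * (\<integral>\<^sup>+x. indicator {t<..<1} x * ennreal (u x / sqrt (U x)) \<partial>lborel)"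
        by (rule nn_integral_cmult) measurable
      also have "\<dots> \<le> (\<psi> t * ennreal (2 * sqrt A)) * ennreal (2 * sqrt (U t))"
        by (intro mult_left_mono I2 t) simp
      also have "\<dots> = (\<phi> t)\<^sup>2 * ennreal (sqrt (W t) / \<kappa> t * (2 * sqrt A) * (2 * sqrt (U t)))"
      proof -
        have "0 \<le> 2 * sqrt (U t)" "0 \<le> 2 * sqrt A * (2 * sqrt (U t))"
          using U0[OF t] A by auto
        then show ?thesis
          unfolding \<psi>_def by (simp only: mult.assoc ennreal_mult''[symmetric])
      qed
      also have "\<dots> \<le> (\<phi> t)\<^sup>2 * ennreal (4 * A * (1 / \<kappa> t))"
      proof (intro mult_left_mono ennreal_leI)
        \<comment> \<open>The condition is used again, now at \<open>t\<close>. With a factor 2 from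
          each of the two primitives this accounts for the constant \<open>4 * A\<close>.\<close>
        have "sqrt (W t) * sqrt (U t) \<le> sqrt A"
          using UWA[OF t] by (simp add: real_sqrt_mult[symmetric] mult.commute)
        then have "sqrt A * (sqrt (W t) * sqrt (U t)) \<le> sqrt A * sqrt A"
          using A by (intro mult_left_mono) auto
        then have "sqrt A * (sqrt (W t) * sqrt (U t)) \<le> A" using A by simp
        then show "sqrt (W t) / \<kappa> t * (2 * sqrt A) * (2 * sqrt (U t)) \<le> 4 * A * (1 / \<kappa> t)"
          using pos(2)[OF t] by (simp add: field_simps)
      qed simp
      also have "\<dots> = ennreal (4 * A) * (indicator {0<..<1} t * (\<phi> t)\<^sup>2 * ennreal (1 / \<kappa> t))"
        using True A pos(2)[OF t] by (subst ennreal_mult) (auto simp: mult_ac)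
      finally show ?thesis .
    next
      case False
      then have "\<not> (0 < t \<and> t < x \<and> x < 1)" for x by auto
      then show ?thesis by (simp only: if_False) simp
    qed
  qed
  also have "\<dots> = ennreal (4 * A) * (\<integral>\<^sup>+t. indicator {0<..<1} t * (\<phi> t)\<^sup>2 * ennreal (1 / \<kappa> t) \<partial>lborel)"
    by (rule nn_integral_cmult) measurable
  finally show ?thesis .
qed

text \<open>The reflection of the unit interval exchanges the two Hardy operators and, at the same
  time, the two integrals in the Muckenhoupt condition.\<close>

corollary hardy_inequality_dual:
  fixes u \<kappa> :: "real \<Rightarrow> real" and \<phi> :: "real \<Rightarrow> ennreal"
  assumes [measurable]: "u \<in> borel_measurable borel" "\<kappa> \<in> borel_measurable borel" "\<phi> \<in> borel_measurable borel"
    and cont: "continuous_on {0<..<1} u" "continuous_on {0<..<1} \<kappa>"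
    and pos: "\<And>x. 0 < x \<Longrightarrow> x < 1 \<Longrightarrow> 0 < u x" "\<And>x. 0 < x \<Longrightarrow> x < 1 \<Longrightarrow> 0 < \<kappa> x"
    and A: "0 \<le> A" and AB: "\<And>r. 0 < r \<Longrightarrow> r < 1 \<Longrightarrow>
      (\<integral>\<^sup>+s. indicator {0<..<r} s * ennreal (u s) \<partial>lborel) * (\<integral>\<^sup>+s. indicator {r<..<1} s * ennreal (\<kappa> s) \<partial>lborel) \<le> ennreal A"
  shows "(\<integral>\<^sup>+x. indicator {0<..<1} x * ennreal (u x) * (\<integral>\<^sup>+t. indicator {x<..<1} t * \<phi> t \<partial>lborel)\<^sup>2 \<partial>lborel)
    \<le> ennreal (4 * A) * (\<integral>\<^sup>+t. indicator {0<..<1} t * (\<phi> t)\<^sup>2 * ennreal (1 / \<kappa> t) \<partial>lborel)"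
proof -
  have reflect: "(\<integral>\<^sup>+x. f x \<partial>lborel) = (\<integral>\<^sup>+x. f (1 - x) \<partial>lborel)" if "f \<in> borel_measurable borel" for f :: "real \<Rightarrow> ennreal"
    using nn_integral_real_affine[OF that, of "-1" 1] by simp
  have ind: "indicator {a<..<b} (1 - x) = (indicator {1 - b<..<1 - a} x :: ennreal)" for a b x :: real
    by (auto split: split_indicator)
  have inner: "(\<integral>\<^sup>+t. indicator {x<..<1} t * f t \<partial>lborel) = (\<integral>\<^sup>+t. indicator {0<..<1 - x} t * f (1 - t) \<partial>lborel)"
    "(\<integral>\<^sup>+t. indicator {0<..<x} t * f t \<partial>lborel) = (\<integral>\<^sup>+t. indicator {1 - x<..<1} t * f (1 - t) \<partial>lborel)"
    if "f \<in> borel_measurable borel" for x and f :: "real \<Rightarrow> ennreal"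
    by (subst reflect; use that in \<open>simp add: ind\<close>)+
  have "(\<integral>\<^sup>+x. indicator {0<..<1} x * ennreal (u x) * (\<integral>\<^sup>+t. indicator {x<..<1} t * \<phi> t \<partial>lborel)\<^sup>2 \<partial>lborel)
    = (\<integral>\<^sup>+x. indicator {0<..<1} x * ennreal (u (1 - x)) * (\<integral>\<^sup>+t. indicator {0<..<x} t * \<phi> (1 - t) \<partial>lborel)\<^sup>2 \<partial>lborel)"
  proof -
    have "(\<lambda>x. indicator {0<..<1} x * ennreal (u x) * (\<integral>\<^sup>+t. indicator {x<..<1} t * \<phi> t \<partial>lborel)\<^sup>2) \<in> borel_measurable borel"
      by measurable
    from reflect[OF this] show ?thesis
      by (simp only: ind inner(1)[OF assms(3)] diff_self diff_zero diff_diff_eq2 add_diff_cancel_left')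
  qed
  also have "\<dots> \<le> ennreal (4 * A) * (\<integral>\<^sup>+t. indicator {0<..<1} t * (\<phi> (1 - t))\<^sup>2 * ennreal (1 / \<kappa> (1 - t)) \<partial>lborel)"
  proof (rule hardy_inequality)
    show "continuous_on {0<..<1} (\<lambda>x. u (1 - x))" "continuous_on {0<..<1} (\<lambda>x. \<kappa> (1 - x))"
      by (auto intro!: continuous_on_compose2[OF cont(1)] continuous_on_compose2[OF cont(2)] continuous_intros)
    fix r :: real assume r: "0 < r" "r < 1"
    show "(\<integral>\<^sup>+s. indicator {r<..<1} s * ennreal (u (1 - s)) \<partial>lborel) *
      (\<integral>\<^sup>+s. indicator {0<..<r} s * ennreal (\<kappa> (1 - s)) \<partial>lborel) \<le> ennreal A"
      using AB[of "1 - r"] r inner(1)[of "\<lambda>s. ennreal (\<kappa> s)" "1 - r"] inner(2)[of "\<lambda>s. ennreal (u s)" "1 - r"] by simp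
  qed (use pos A in auto)
  also have "(\<integral>\<^sup>+t. indicator {0<..<1} t * (\<phi> (1 - t))\<^sup>2 * ennreal (1 / \<kappa> (1 - t)) \<partial>lborel)
     = (\<integral>\<^sup>+t. indicator {0<..<1} t * (\<phi> t)\<^sup>2 * ennreal (1 / \<kappa> t) \<partial>lborel)"
    by (subst reflect[of "\<lambda>t. indicator {0<..<1} t * (\<phi> t)\<^sup>2 * ennreal (1 / \<kappa> t)"]) (simp_all add: ind)
  finally show ?thesis .
qed

section \<open>The weight and its moments\<close>

lemma ennsqrt_power2: "(ennsqrt x)\<^sup>2 = x"
  by (cases x) (auto simp: ennsqrt_def ennreal_power power2_eq_square ennreal_top_mult ennreal_mult''[symmetric])

text \<open>Each of the \<open>k + 1\<close> terms of the geometric sum is at least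
  \<open>s ^ k\<close>, and the geometric sum times \<open>1 - s\<close> is at most 1.\<close>

lemma power_mult_one_minus_le:
  fixes s :: real
  assumes "0 \<le> s" "s \<le> 1"
  shows "real (k + 1) * (s ^ k * (1 - s)) \<le> 1"
proof -
  have "real (k + 1) * s ^ k = (\<Sum>i<k + 1. s ^ k)" by simp
  also have "\<dots> \<le> (\<Sum>i<k + 1. s ^ i)"
    using assms by (intro sum_mono power_decreasing) auto
  finally have "real (k + 1) * s ^ k * (1 - s) \<le> (\<Sum>i<k + 1. s ^ i) * (1 - s)"
    using assms by (intro mult_right_mono) auto
  also have "\<dots> = 1 - s ^ (k + 1)"
    using one_diff_power_eq[of s "k + 1"] by (simp add: mult.commute)
  also have "\<dots> \<le> 1" using assms by simp
  finally show ?thesis by (simp add: mult.assoc)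
qed

text \<open>The \<open>p\<close>-th power of the previous bound for \<open>k = n div p\<close>;
  rounding down is harmless because \<open>n + 1 \<le> p * (k + 1)\<close>.\<close>

lemma power_mult_one_minus_power_le:
  fixes s :: real
  assumes s: "0 \<le> s" "s \<le> 1" and p: "p \<ge> 1"
  shows "s ^ n * (1 - s) ^ p \<le> (real p / (real n + 1)) ^ p"
proof -
  define k where "k = n div p"
  have "real (n + 1) \<le> real (p * (k + 1))"
    unfolding of_nat_le_iff k_def using p dividend_less_div_times[of p n] by (simp add: mult.commute)
  then have k: "real n + 1 \<le> real p * real (k + 1)" by (simp add: algebra_simps)
  have "s ^ n \<le> s ^ (k * p)"
    using s by (intro power_decreasing) (auto simp: k_def)
  then have "s ^ n * (1 - s) ^ p \<le> s ^ (k * p) * (1 - s) ^ p"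
    using s by (intro mult_right_mono) auto
  also have "\<dots> = (s ^ k * (1 - s)) ^ p"
    by (simp add: power_mult power_mult_distrib)
  also have "\<dots> \<le> (real p / (real n + 1)) ^ p"
  proof (rule power_mono)
    have "s ^ k * (1 - s) \<le> 1 / real (k + 1)"
      using power_mult_one_minus_le[OF s, of k] by (simp add: field_simps)
    also have "\<dots> \<le> real p / (real n + 1)"
      using k p by (simp add: field_simps)
    finally show "s ^ k * (1 - s) \<le> real p / (real n + 1)" .
  qed (use s in auto)
  finally show ?thesis .
qed

text \<open>\<open>w\<close> is a Borel representative of the radial profile of \<open>v\<close>, which itself is only Lebesgue measurable.\<close>

locale hilbert_weight =
  fixes v :: "complex \<Rightarrow> real" and w :: "real \<Rightarrow> real"
  assumes D_hat: "v \<in> D_hat"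
    and w_borel [measurable]: "w \<in> borel_measurable borel" and w_nonneg: "\<And>r. 0 \<le> w r"
    and v_meas: "(\<lambda>r. indicator {0<..<1} r * v (of_real r)) \<in> borel_measurable lebesgue"
    and v_eq_w: "AE r in lborel. 0 < r \<and> r < 1 \<longrightarrow> v (of_real r) = w r"
    and v_eq_w_cmod: "AE z in lborel. cmod z < 1 \<longrightarrow> v z = w (cmod z)"
    and M1: "(SUP r\<in>{0<..<1::real}.
            ennsqrt (\<integral>\<^sup>+s\<in>{r<..<1}. ennreal (vhat v s / (1 - s)\<^sup>2) \<partial>lebesgue) *
            ennsqrt (\<integral>\<^sup>+s\<in>{0<..<r}. ennreal (1 / vhat v s) \<partial>lebesgue)) < \<infinity>"
    and M2: "(SUP r\<in>{0<..<1::real}.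
            ennsqrt (\<integral>\<^sup>+s\<in>{0<..<r}. ennreal (vhat v s / (1 - s) ^ 4) \<partial>lebesgue) *
            ennsqrt (\<integral>\<^sup>+s\<in>{r<..<1}. ennreal ((1 - s)\<^sup>2 / vhat v s) \<partial>lebesgue)) < \<infinity>"
begin

lemma v_pos: "0 < v z" if "cmod z < 1"
  using D_hat that unfolding D_hat_def radial_weight_def weight_def mem_ball_0[symmetric] by blast

lemma v_integrable: "set_integrable lebesgue (ball 0 1) v"
  using D_hat unfolding D_hat_def radial_weight_def weight_def by blast

lemma w_pos: "AE r in lborel. 0 < r \<and> r < 1 \<longrightarrow> 0 < w r"
  using v_eq_w
proof eventually_elim
  case (elim r)
  then show ?case using v_pos[of "of_real r"] by auto
qed

lemma nn_integral_ball_v: "(\<integral>\<^sup>+z. indicator (ball 0 1) z * ennreal (f z * v z) \<partial>lebesgue)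
  = (\<integral>\<^sup>+z. indicator (ball 0 1) z * ennreal (f z * w (cmod z)) \<partial>lborel)"
  unfolding nn_integral_completion
  by (rule nn_integral_cong_AE) (use v_eq_w_cmod in eventually_elim, auto split: split_indicator)

lemma moment_finite: "moment w n < top"
proof -
  have "(\<integral>\<^sup>+z. ennreal (norm (indicator (ball 0 1) z *\<^sub>R v z)) \<partial>lebesgue) < \<infinity>"
    using v_integrable by (auto simp: set_integrable_def integrable_iff_bounded)
  also have "(\<integral>\<^sup>+z. ennreal (norm (indicator (ball 0 1) z *\<^sub>R v z)) \<partial>lebesgue)
      = (\<integral>\<^sup>+z. indicator (ball 0 1) z * ennreal (1 * v z) \<partial>lebesgue)"
    using v_pos by (intro nn_integral_cong) (auto split: split_indicator simp: less_imp_le)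
  also have "\<dots> = (\<integral>\<^sup>+z. indicator {..<1} (cmod z) * ennreal (w (cmod z)) \<partial>(lborel :: complex measure))"
    unfolding nn_integral_ball_v by (intro nn_integral_cong) (auto split: split_indicator)
  also have "\<dots> = (\<integral>\<^sup>+r. ennreal (2 * pi * r) * indicator {0<..} r * (indicator {..<1} r * ennreal (w r)) \<partial>lborel)"
    by (rule nn_integral_cmod) measurable
  finally have fin: "(\<integral>\<^sup>+r. ennreal (2 * pi * r) * indicator {0<..} r * (indicator {..<1} r * ennreal (w r)) \<partial>lborel) < \<infinity>" .
  have "moment w n \<le> (\<integral>\<^sup>+r. ennreal (2 * pi * r) * indicator {0<..} r * (indicator {..<1} r * ennreal (w r)) \<partial>lborel)"
    unfolding moment_def
  proof (rule nn_integral_mono)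
    fix r :: real
    show "indicator {0<..<1} r * ennreal (2 * r ^ (2 * n + 1) * w r)
      \<le> ennreal (2 * pi * r) * indicator {0<..} r * (indicator {..<1} r * ennreal (w r))"
    proof (cases "0 < r \<and> r < 1")
      case True
      have "r ^ (2 * n) * 1 \<le> 1 * pi"
        using True pi_gt3 by (intro mult_mono power_le_one) auto
      then have "2 * r * w r * r ^ (2 * n) \<le> 2 * r * w r * pi"
        using True w_nonneg[of r] by (intro mult_left_mono) auto
      then have "2 * r ^ (2 * n + 1) * w r \<le> 2 * pi * r * w r"
        by (simp add: mult_ac)
      then show ?thesis
        using True w_nonneg[of r] by (simp add: ennreal_mult[symmetric] ennreal_leI)
    qed auto
  qed
  then show ?thesis using fin by (simp add: order_le_less_trans)
qed

definition \<mu> :: "nat \<Rightarrow> real" where "\<mu> n = enn2real (moment w n)"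

lemma moment_eq: "moment w n = ennreal (\<mu> n)"
  using moment_finite[of n] by (simp add: \<mu>_def)

lemma \<mu>_nonneg: "0 \<le> \<mu> n"
  by (simp add: \<mu>_def)

lemma \<mu>_antimono: "m \<le> n \<Longrightarrow> \<mu> n \<le> \<mu> m"
proof -
  assume "m \<le> n"
  then have "moment w n \<le> moment w m"
    unfolding moment_def using w_nonneg
    by (intro nn_integral_mono)
      (auto split: split_indicator intro!: ennreal_leI mult_right_mono power_decreasing)
  then show ?thesis by (simp add: moment_eq \<mu>_nonneg)
qed

text \<open>Integrability in the plane controls only \<open>s * w s\<close>, so finiteness of the
  tail is obtained by dividing by \<open>r\<close>. This is why \<open>r > 0\<close> is required; at
  0 the tail may diverge.\<close>

lemma tail_eq_vhat:
  assumes r: "0 < r" "r < 1"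
  shows "tail w r = ennreal (vhat v r)" "0 < vhat v r"
proof -
  have fin: "tail w r < top"
  proof -
    have "tail w r \<le> (\<integral>\<^sup>+s. ennreal (1 / (2 * r)) * (indicator {0<..<1} s * ennreal (2 * s ^ (2 * 0 + 1) * w s)) \<partial>lborel)"
      unfolding tail_def
    proof (rule nn_integral_mono)
      fix s :: real
      show "indicator {r<..<1} s * ennreal (w s) \<le>
        ennreal (1 / (2 * r)) * (indicator {0<..<1} s * ennreal (2 * s ^ (2 * 0 + 1) * w s))"
      proof (cases "r < s \<and> s < 1")
        case True
        have "1 * w s \<le> s / r * w s"
          using True r w_nonneg by (intro mult_right_mono) auto
        then show ?thesis
          using True r w_nonneg[of s] by (simp add: ennreal_mult''[symmetric] ennreal_leI mult.commute)
      qed auto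
    qed
    also have "\<dots> = ennreal (1 / (2 * r)) * moment w 0"
      unfolding moment_def by (rule nn_integral_cmult) measurable
    also have "\<dots> < top" using moment_finite[of 0] by (simp add: ennreal_mult_less_top)
    finally show ?thesis .
  qed
  have "vhat v r = (\<integral>s. indicator {r<..<1} s * (indicator {0<..<1} s * v (of_real s)) \<partial>lebesgue)"
    unfolding vhat_def set_lebesgue_integral_def using r
    by (intro Bochner_Integration.integral_cong) (auto split: split_indicator)
  also have "\<dots> = enn2real (\<integral>\<^sup>+s. ennreal (indicator {r<..<1} s * (indicator {0<..<1} s * v (of_real s))) \<partial>lebesgue)"
  proof (rule integral_eq_nn_integral)
    show "(\<lambda>s. indicator {r<..<1} s * (indicator {0<..<1} s * v (of_real s))) \<in> borel_measurable lebesgue"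
      by (rule borel_measurable_times[OF borel_measurable_indicator v_meas]) simp
  qed (use v_pos in \<open>auto split: split_indicator intro!: less_imp_le\<close>)
  also have "(\<integral>\<^sup>+s. ennreal (indicator {r<..<1} s * (indicator {0<..<1} s * v (of_real s))) \<partial>lebesgue) = tail w r"
    unfolding tail_def nn_integral_completion
    by (rule nn_integral_cong_AE) (use v_eq_w in eventually_elim, use r in \<open>auto split: split_indicator\<close>)
  finally have eq: "vhat v r = enn2real (tail w r)" .
  then show "tail w r = ennreal (vhat v r)" using fin by simp
  have "tail w r \<noteq> 0"
  proof
    assume "tail w r = 0"
    then have "AE s in lborel. indicator {r<..<1} s * ennreal (w s) = 0"
      unfolding tail_def by (subst (asm) nn_integral_0_iff_AE) auto
    then have "AE s in lborel. s \<notin> {r<..<1}"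
      using w_pos
    proof eventually_elim
      case (elim s)
      then show ?case using r by (auto split: split_indicator_asm simp: ennreal_eq_0_iff)
    qed
    then show False
      using AE_iff_null_sets[of "{r<..<1}" lborel] r by auto
  qed
  then show "0 < vhat v r"
    using fin by (simp add: eq enn2real_positive_iff zero_less_iff_neq_zero)
qed

text \<open>Nothing is known about \<open>vhat v\<close> for \<open>r \<le> 0\<close>; the cut-off
  produces a Borel function on the line.\<close>

definition V :: "real \<Rightarrow> real" where "V r = indicator {0<..<1} r * vhat v r"

lemma V_eq: "0 < r \<Longrightarrow> r < 1 \<Longrightarrow> V r = vhat v r"
  by (simp add: V_def)

lemma V_pos: "0 < r \<Longrightarrow> r < 1 \<Longrightarrow> 0 < V r"
  using tail_eq_vhat by (simp add: V_def)

lemma tail_eq_V: "0 < r \<Longrightarrow> r < 1 \<Longrightarrow> tail w r = ennreal (V r)"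
  using tail_eq_vhat by (simp add: V_def)

lemma V_antimono: "0 < r \<Longrightarrow> r \<le> s \<Longrightarrow> s < 1 \<Longrightarrow> V s \<le> V r"
proof -
  assume *: "0 < r" "r \<le> s" "s < 1"
  have "tail w s \<le> tail w r"
    unfolding tail_def using * by (intro nn_integral_mono) (auto split: split_indicator)
  then show ?thesis using * V_pos[of r] by (simp add: tail_eq_V)
qed

text \<open>The Hardy inequalities are stated for continuous weights. Away from 0 the profile
  \<open>w\<close> is integrable, so there \<open>V\<close> is a constant minus a primitive of
  \<open>w\<close>.\<close>

lemma V_continuous: "continuous_on {0<..<1} V"
proof (rule continuous_at_imp_continuous_on, rule ballI)
  fix x :: real assume "x \<in> {0<..<1}"
  then obtain c d where cd: "0 < c" "c < x" "x < d" "d < 1"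
    using dense[of 0 x] dense[of x 1] by auto
  have "(\<integral>\<^sup>+s. ennreal (norm (indicator {c..d} s *\<^sub>R w s)) \<partial>lborel) \<le> tail w (c / 2)"
    unfolding tail_def using cd w_nonneg by (intro nn_integral_mono) (auto split: split_indicator)
  also have "\<dots> < \<infinity>" using tail_eq_V[of "c / 2"] cd by simp
  finally have "set_integrable lborel {c..d} w"
    unfolding set_integrable_def by (intro integrableI_bounded) auto
  then have int: "w integrable_on {c..d}"
    using set_borel_integral_eq_integral(1) by blast
  have eq: "V y = V c - integral {c..y} w" if y: "y \<in> {c..d}" for y
  proof -
    have i: "(w has_integral integral {c..y} w) {c..y}"
      using integrable_on_subinterval[OF int, of c y] y by (simp add: integrable_integral)
    have "tail w c = (\<integral>\<^sup>+s. (ennreal (w s) * indicator {c..y} s + indicator {y<..<1} s * ennreal (w s)) \<partial>lborel)"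
      unfolding tail_def
      by (rule nn_integral_cong_AE) (use AE_lborel_singleton[of c] in eventually_elim, use y cd in \<open>auto split: split_indicator\<close>)
    also have "\<dots> = ennreal (integral {c..y} w) + tail w y"
      unfolding tail_def using nn_integral_has_integral_lebesgue'[OF _ i] w_nonneg
      by (subst nn_integral_add) auto
    finally show ?thesis
      using tail_eq_V[of c] tail_eq_V[of y] y cd V_pos[of c] V_pos[of y] w_nonneg
        integral_nonneg[of w "{c..y}"] i
      by (simp add: ennreal_plus[symmetric] has_integral_integrable del: ennreal_plus)
  qed
  have "continuous_on {c..d} (\<lambda>y. V c - integral {c..y} w)"
    by (intro continuous_intros indefinite_integral_continuous_1 int)
  moreover have "continuous_on {c..d} V \<longleftrightarrow> continuous_on {c..d} (\<lambda>y. V c - integral {c..y} w)"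
    by (rule continuous_on_cong[OF _ eq]) simp_all
  ultimately have "continuous_on {c..d} V" by (rule iffD2[rotated])
  then show "isCont V x"
    using cd by (intro continuous_on_interior[of "{c..d}"]) (auto simp: interior_atLeastAtMost_real)
qed

lemma V_borel [measurable]: "V \<in> borel_measurable borel"
proof -
  have "(\<lambda>x. indicator {0<..<1} x *\<^sub>R V x) \<in> borel_measurable borel"
    by (intro borel_measurable_continuous_on_indicator V_continuous) auto
  also have "(\<lambda>x. indicator {0<..<1} x *\<^sub>R V x) = V"
    by (auto simp: V_def fun_eq_iff split: split_indicator)
  finally show ?thesis .
qed

end

lemma nn_integral_Ioo_power:
  assumes "0 \<le> r"
  shows "(\<integral>\<^sup>+s. indicator {0<..<r} s * ennreal (real (k + 1) * s ^ k) \<partial>lborel) = ennreal (r ^ (k + 1))"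
proof -
  have "(\<integral>\<^sup>+s. indicator {0<..<r} s * ennreal (real (k + 1) * s ^ k) \<partial>lborel)
      = (\<integral>\<^sup>+s. ennreal (real (k + 1) * s ^ k) * indicator {0..r} s \<partial>lborel)"
  proof (rule nn_integral_cong_AE)
    have "AE s in lborel. s \<noteq> 0 \<and> s \<noteq> r"
      using AE_lborel_singleton[of 0] AE_lborel_singleton[of r] by eventually_elim auto
    then show "AE s in lborel. indicator {0<..<r} s * ennreal (real (k + 1) * s ^ k)
        = ennreal (real (k + 1) * s ^ k) * indicator {0..r} s"
      by eventually_elim (auto split: split_indicator)
  qed
  also have "\<dots> = ennreal (r ^ (k + 1) - 0 ^ (k + 1))"
  proof (rule nn_integral_FTC_Icc)
    fix s :: real
    show "((\<lambda>s. s ^ (k + 1)) has_real_derivative real (k + 1) * s ^ k) (at s)"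
      by (rule DERIV_cong[OF DERIV_power[OF DERIV_ident]]) simp
  qed (use assms in auto)
  finally show ?thesis by simp
qed

lemma SUP_ennsqrt_bound:
  fixes P Q :: "real \<Rightarrow> ennreal"
  assumes "(SUP r\<in>{0<..<1}. ennsqrt (P r) * ennsqrt (Q r)) < \<infinity>"
  obtains A where "0 \<le> A" "\<And>r. 0 < r \<Longrightarrow> r < 1 \<Longrightarrow> P r * Q r \<le> ennreal A"
proof -
  obtain s where s: "0 \<le> s" "(SUP r\<in>{0<..<1}. ennsqrt (P r) * ennsqrt (Q r)) = ennreal s"
    using assms by (cases "(SUP r\<in>{0<..<1}. ennsqrt (P r) * ennsqrt (Q r))") auto
  show ?thesis
  proof (rule that[of "s\<^sup>2"])
    fix r :: real assume "0 < r" "r < 1"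
    then have "ennsqrt (P r) * ennsqrt (Q r) \<le> ennreal s"
      unfolding s(2)[symmetric] by (intro SUP_upper) auto
    then have "(ennsqrt (P r) * ennsqrt (Q r))\<^sup>2 \<le> (ennreal s)\<^sup>2"
      by (rule power_mono) simp
    then show "P r * Q r \<le> ennreal (s\<^sup>2)"
      using s(1) by (simp add: power_mult_distrib ennsqrt_power2 ennreal_power)
  qed simp
qed

context hilbert_weight
begin

section \<open>Consequences of the doubling condition\<close>

lemma V_doubling: obtains K where "1 \<le> K" "\<And>r. 0 < r \<Longrightarrow> r < 1 \<Longrightarrow> V r \<le> K * V ((1 + r) / 2)"
proof -
  have "bdd_above ((\<lambda>r. vhat v r / vhat v ((1 + r) / 2)) ` {0<..<1})"
    using D_hat unfolding D_hat_def by simp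
  then obtain K where K: "\<forall>r\<in>{0<..<1}. vhat v r / vhat v ((1 + r) / 2) \<le> K"
    by (auto simp: bdd_above_def)
  show ?thesis
  proof (rule that[of "max 1 K"])
    fix r :: real assume r: "0 < r" "r < 1"
    have pos: "0 < V ((1 + r) / 2)" using r by (intro V_pos) auto
    have "V r / V ((1 + r) / 2) \<le> max 1 K"
      using K[rule_format, of r] r by (simp add: V_eq)
    then show "V r \<le> max 1 K * V ((1 + r) / 2)"
      using pos by (simp add: field_simps)
  qed simp
qed

text \<open>Doubling iterated \<open>m\<close> times moves \<open>r\<close> so that its distance to
  1 shrinks by \<open>2 ^ m\<close>. With \<open>K \<le> 2 ^ p\<close> the loss is
  \<open>K ^ m \<le> (2 ^ m) ^ p\<close>, and the least \<open>m\<close> with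
  \<open>(1 - r) / (1 - x) \<le> 2 ^ m\<close> exceeds this ratio by at most a factor 2.\<close>

lemma V_growth:
  obtains p :: nat where "1 \<le> p"
    "\<And>r x. 0 < r \<Longrightarrow> r \<le> x \<Longrightarrow> x < 1 \<Longrightarrow> V r \<le> (2 * ((1 - r) / (1 - x))) ^ p * V x"
proof -
  obtain K where K: "1 \<le> K" "\<And>r. 0 < r \<Longrightarrow> r < 1 \<Longrightarrow> V r \<le> K * V ((1 + r) / 2)"
    using V_doubling by blast
  obtain p0 :: nat where "K < 2 ^ p0" using real_arch_pow[of 2 K] by auto
  then have p: "K \<le> 2 ^ (p0 + 1)" using K(1) by simp
  show ?thesis
  proof (rule that[of "p0 + 1"])
    fix r x :: real assume rx: "0 < r" "r \<le> x" "x < 1"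
    have iter: "V r \<le> K ^ m * V (1 - (1 - r) / 2 ^ m)" for m
    proof (induction m)
      case (Suc m)
      define e where "e = (1 - r) / 2 ^ m"
      define y where "y = 1 - e"
      have "e \<le> (1 - r) / 1" unfolding e_def using rx by (intro divide_left_mono) auto
      moreover have "0 < e" using rx by (simp add: e_def)
      ultimately have y: "0 < y \<and> y < 1" using rx by (simp add: y_def)
      have "K ^ m * V y \<le> K ^ m * (K * V ((1 + y) / 2))"
        using K y by (intro mult_left_mono) auto
      also have "(1 + y) / 2 = 1 - (1 - r) / 2 ^ Suc m"
        by (simp add: y_def e_def field_simps)
      finally have "K ^ m * V y \<le> K ^ Suc m * V (1 - (1 - r) / 2 ^ Suc m)"
        by (simp only: power_Suc mult_ac)
      moreover have "V r \<le> K ^ m * V y" using Suc by (simp only: y_def e_def)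
      ultimately show ?case by linarith
    qed simp
    define q where "q = (1 - r) / (1 - x)"
    have q: "1 \<le> q" using rx by (simp add: q_def)
    define m where "m = (LEAST m. q \<le> 2 ^ m)"
    have ex: "\<exists>m. q \<le> 2 ^ m" using real_arch_pow[of 2 q] by (auto intro: less_imp_le)
    have m1: "q \<le> 2 ^ m" unfolding m_def using ex by (rule LeastI_ex)
    have m2: "2 ^ m \<le> 2 * q"
    proof (cases m)
      case (Suc m')
      then have "\<not> q \<le> 2 ^ m'" using not_less_Least[of m' "\<lambda>m. q \<le> 2 ^ m"] by (auto simp: m_def)
      then show ?thesis using Suc by simp
    qed (use q in auto)
    define y where "y = 1 - (1 - r) / 2 ^ m"
    have "(1 - r) / 2 ^ m \<le> 1 - x" using m1 rx by (simp add: q_def field_simps)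
    moreover have "0 < (1 - r) / 2 ^ m" using rx by simp
    ultimately have y: "x \<le> y" "y < 1" by (auto simp: y_def)
    have "V r \<le> K ^ m * V y" using iter[of m] by (simp add: y_def)
    also have "\<dots> \<le> (2 ^ (p0 + 1)) ^ m * V x"
      using K p y rx V_antimono[of x y] V_pos[of y] by (intro mult_mono power_mono) auto
    also have "(2 ^ (p0 + 1)) ^ m = ((2::real) ^ m) ^ (p0 + 1)"
      by (simp only: power_mult[symmetric] mult.commute)
    also have "\<dots> * V x \<le> (2 * q) ^ (p0 + 1) * V x"
      using m2 V_pos[of x] rx by (intro mult_right_mono power_mono) auto
    finally show "V r \<le> (2 * ((1 - r) / (1 - x))) ^ (p0 + 1) * V x" by (simp add: q_def)
  qed simp
qed

text \<open>Integration by parts, carried out with Tonelli's theorem: \<open>r ^ (2 * n + 1)\<close>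
  is the integral of its derivative over \<open>(0, r)\<close>.\<close>

lemma moment_eq_V:
  "moment w n = (\<integral>\<^sup>+s. indicator {0<..<1} s * ennreal (2 * (real (2 * n + 1) * s ^ (2 * n)) * V s) \<partial>lborel)"
proof -
  have "(\<integral>\<^sup>+s. indicator {0<..<1} s * ennreal (2 * (real (2 * n + 1) * s ^ (2 * n)) * V s) \<partial>lborel)
     = (\<integral>\<^sup>+s. (\<integral>\<^sup>+r. (if 0 < s \<and> s < r \<and> r < 1 then ennreal (2 * (real (2 * n + 1) * s ^ (2 * n))) * ennreal (w r) else 0) \<partial>lborel) \<partial>lborel)"
  proof (rule nn_integral_cong)
    fix s :: real
    show "indicator {0<..<1} s * ennreal (2 * (real (2 * n + 1) * s ^ (2 * n)) * V s)
      = (\<integral>\<^sup>+r. (if 0 < s \<and> s < r \<and> r < 1 then ennreal (2 * (real (2 * n + 1) * s ^ (2 * n))) * ennreal (w r) else 0) \<partial>lborel)"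
    proof (cases "0 < s \<and> s < 1")
      case True
      then have s: "0 < s" "s < 1" by auto
      have "ennreal (2 * (real (2 * n + 1) * s ^ (2 * n)) * V s) = ennreal (2 * (real (2 * n + 1) * s ^ (2 * n))) * tail w s"
        using s V_pos[OF s] by (subst tail_eq_V) (auto simp: ennreal_mult'')
      also have "\<dots> = (\<integral>\<^sup>+r. ennreal (2 * (real (2 * n + 1) * s ^ (2 * n))) * (indicator {s<..<1} r * ennreal (w r)) \<partial>lborel)"
        unfolding tail_def by (rule nn_integral_cmult[symmetric]) measurable
      also have "\<dots> = (\<integral>\<^sup>+r. (if 0 < s \<and> s < r \<and> r < 1 then ennreal (2 * (real (2 * n + 1) * s ^ (2 * n))) * ennreal (w r) else 0) \<partial>lborel)"
        using s by (intro nn_integral_cong) auto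
      finally show ?thesis using s by simp
    next
      case False
      then have "\<not> (0 < s \<and> s < r \<and> r < 1)" for r by auto
      then show ?thesis using False by (simp only: if_False) simp
    qed
  qed
  also have "\<dots> = (\<integral>\<^sup>+r. (\<integral>\<^sup>+s. (if 0 < s \<and> s < r \<and> r < 1 then ennreal (2 * (real (2 * n + 1) * s ^ (2 * n))) * ennreal (w r) else 0) \<partial>lborel) \<partial>lborel)"
    by (subst lborel_pair.Fubini') auto
  also have "\<dots> = moment w n"
    unfolding moment_def
  proof (rule nn_integral_cong)
    fix r :: real
    show "(\<integral>\<^sup>+s. (if 0 < s \<and> s < r \<and> r < 1 then ennreal (2 * (real (2 * n + 1) * s ^ (2 * n))) * ennreal (w r) else 0) \<partial>lborel)
      = indicator {0<..<1} r * ennreal (2 * r ^ (2 * n + 1) * w r)"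
    proof (cases "0 < r \<and> r < 1")
      case True
      have "(\<integral>\<^sup>+s. (if 0 < s \<and> s < r \<and> r < 1 then ennreal (2 * (real (2 * n + 1) * s ^ (2 * n))) * ennreal (w r) else 0) \<partial>lborel)
         = (\<integral>\<^sup>+s. ennreal (2 * w r) * (indicator {0<..<r} s * ennreal (real (2 * n + 1) * s ^ (2 * n))) \<partial>lborel)"
        using True w_nonneg[of r]
        by (intro nn_integral_cong) (auto simp: ennreal_mult''[symmetric] mult_ac split: split_indicator)
      also have "\<dots> = ennreal (2 * w r) * (\<integral>\<^sup>+s. indicator {0<..<r} s * ennreal (real (2 * n + 1) * s ^ (2 * n)) \<partial>lborel)"
        by (rule nn_integral_cmult) measurable
      also have "\<dots> = ennreal (2 * w r) * ennreal (r ^ (2 * n + 1))"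
        using True by (subst nn_integral_Ioo_power) auto
      also have "\<dots> = ennreal (2 * r ^ (2 * n + 1) * w r)"
        using True w_nonneg[of r] by (simp add: ennreal_mult''[symmetric] mult_ac)
      finally show ?thesis using True by simp
    next
      case False
      then have "\<not> (0 < s \<and> s < r \<and> r < 1)" for s by auto
      then show ?thesis using False by (simp only: if_False) simp
    qed
  qed
  finally show ?thesis ..
qed

text \<open>In \<open>moment_eq_V\<close> the part \<open>s \<ge> x\<close> is controlled by
  monotonicity of \<open>V\<close>. For \<open>s < x\<close> the growth bound costs
  \<open>((1 - s) / (1 - x)) ^ p\<close>; one half of \<open>s ^ (2 * n)\<close> absorbs
  \<open>(1 - s) ^ p\<close> at the price of \<open>(n + 1) ^ p\<close> in the denominator, which
  cancels \<open>(1 - x) ^ p\<close> by hypothesis, and the other half remains for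
  integration.\<close>

lemma \<mu>_le_V:
  obtains C where "0 < C" "\<And>n x. 0 < x \<Longrightarrow> x < 1 \<Longrightarrow> 1 \<le> real (n + 1) * (1 - x) \<Longrightarrow> \<mu> n \<le> C * V x"
proof -
  obtain p :: nat where p: "1 \<le> p"
    "\<And>r x. 0 < r \<Longrightarrow> r \<le> x \<Longrightarrow> x < 1 \<Longrightarrow> V r \<le> (2 * ((1 - r) / (1 - x))) ^ p * V x"
    using V_growth by blast
  \<comment> \<open>The factor 2 comes from \<open>V_growth\<close> and the factor \<open>p\<close>
    from \<open>power_mult_one_minus_power_le\<close>.\<close>
  define c where "c = (2 * real p) ^ p"
  have c: "0 \<le> c" by (simp add: c_def)
  show ?thesis
  proof (rule that[of "2 + 4 * c"])
    fix n :: nat and x :: real assume x: "0 < x" "x < 1" and nx: "1 \<le> real (n + 1) * (1 - x)"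
    have Vx: "0 < V x" using V_pos x by simp
    have pt: "2 * (real (2 * n + 1) * s ^ (2 * n)) * V s
        \<le> 2 * V x * (real (2 * n + 1) * s ^ (2 * n)) + 4 * c * V x * (real (n + 1) * s ^ n)"
      if s: "0 < s" "s < 1" for s
    proof (cases "x \<le> s")
      case True
      then have "2 * (real (2 * n + 1) * s ^ (2 * n)) * V s \<le> 2 * (real (2 * n + 1) * s ^ (2 * n)) * V x"
        using V_antimono[of x s] s x by (intro mult_left_mono) auto
      moreover have "0 \<le> 4 * c * V x * (real (n + 1) * s ^ n)"
        using s c Vx by simp
      ultimately show ?thesis by (simp only: mult_ac)
    next
      case False
      have nx': "real n + 1 > 0" "1 - x > 0" using x by auto
      have "s ^ (2 * n) * V s \<le> s ^ (2 * n) * ((2 * ((1 - s) / (1 - x))) ^ p * V x)"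
        using p(2)[of s x] False s x by (intro mult_left_mono) auto
      also have "\<dots> = s ^ n * (s ^ n * (1 - s) ^ p) * (2 / (1 - x)) ^ p * V x"
        unfolding mult_2[of n] power_add
        by (simp only: power_mult_distrib power_divide times_divide_eq_right times_divide_eq_left mult_ac)
      also have "\<dots> \<le> s ^ n * (real p / (real n + 1)) ^ p * (2 / (1 - x)) ^ p * V x"
        using power_mult_one_minus_power_le[of s p n] s p(1) x Vx
        by (intro mult_right_mono mult_left_mono) auto
      also have "\<dots> = s ^ n * ((2 * real p) * (1 / ((real n + 1) * (1 - x)))) ^ p * V x"
      proof -
        have "real p / (real n + 1) * (2 / (1 - x)) = (2 * real p) * (1 / ((real n + 1) * (1 - x)))"
          by simp
        then show ?thesis
          by (simp only: mult.assoc[of "s ^ n"] power_mult_distrib[symmetric])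
      qed
      also have "\<dots> \<le> s ^ n * ((2 * real p) * 1) ^ p * V x"
        using nx nx' s Vx by (intro mult_right_mono mult_left_mono power_mono) (auto simp: add.commute)
      finally have le: "s ^ (2 * n) * V s \<le> c * V x * s ^ n" by (simp add: c_def mult_ac)
      have "2 * real (2 * n + 1) * (s ^ (2 * n) * V s) \<le> (4 * real (n + 1)) * (c * V x * s ^ n)"
        by (rule mult_mono[OF _ le]) (use s V_pos[OF s] in auto)
      moreover have "0 \<le> 2 * V x * (real (2 * n + 1) * s ^ (2 * n))" using s Vx by simp
      ultimately show ?thesis by (simp only: mult_ac)
    qed
    have "moment w n \<le> (\<integral>\<^sup>+s. ennreal (2 * V x) * (indicator {0<..<1} s * ennreal (real (2 * n + 1) * s ^ (2 * n)))
         + ennreal (4 * c * V x) * (indicator {0<..<1} s * ennreal (real (n + 1) * s ^ n)) \<partial>lborel)"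
      unfolding moment_eq_V
    proof (rule nn_integral_mono)
      fix s :: real
      show "indicator {0<..<1} s * ennreal (2 * (real (2 * n + 1) * s ^ (2 * n)) * V s)
        \<le> ennreal (2 * V x) * (indicator {0<..<1} s * ennreal (real (2 * n + 1) * s ^ (2 * n)))
         + ennreal (4 * c * V x) * (indicator {0<..<1} s * ennreal (real (n + 1) * s ^ n))"
      proof (cases "0 < s \<and> s < 1")
        case True
        have "ennreal (2 * V x) * ennreal (real (2 * n + 1) * s ^ (2 * n)) + ennreal (4 * c * V x) * ennreal (real (n + 1) * s ^ n)
          = ennreal (2 * V x * (real (2 * n + 1) * s ^ (2 * n)) + 4 * c * V x * (real (n + 1) * s ^ n))"
          using True Vx c by (subst ennreal_plus) (auto simp: ennreal_mult''[symmetric])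
        then show ?thesis using True pt[of s] by (simp del: ennreal_plus add: ennreal_leI)
      qed auto
    qed
    also have "\<dots> = ennreal (2 * V x) * ennreal (1 ^ (2 * n + 1)) + ennreal (4 * c * V x) * ennreal (1 ^ (n + 1))"
      by (subst nn_integral_add, measurable, subst (1 2) nn_integral_cmult, measurable, subst (1 2) nn_integral_Ioo_power) auto
    also have "\<dots> = ennreal ((2 + 4 * c) * V x)"
      using Vx c by (simp add: ennreal_plus[symmetric] algebra_simps del: ennreal_plus)
    finally show "\<mu> n \<le> (2 + 4 * c) * V x"
      using Vx c by (simp add: moment_eq)
  qed (use c in auto)
qed

section \<open>The hypotheses on the weight as Hardy inequalities\<close>

lemma set_nn_integral_lebesgue_eq:
  fixes f h :: "real \<Rightarrow> real"
  assumes "\<And>s. s \<in> S \<Longrightarrow> f s = h s"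
  shows "(\<integral>\<^sup>+s\<in>S. ennreal (f s) \<partial>lebesgue) = (\<integral>\<^sup>+s. indicator S s * ennreal (h s) \<partial>lborel)"
  unfolding nn_integral_completion using assms
  by (intro nn_integral_cong) (auto split: split_indicator)

lemma weight_conditions:
  obtains A where "0 \<le> A"
    "\<And>r. 0 < r \<Longrightarrow> r < 1 \<Longrightarrow> (\<integral>\<^sup>+s. indicator {r<..<1} s * ennreal (V s / (1 - s)\<^sup>2) \<partial>lborel) *
       (\<integral>\<^sup>+s. indicator {0<..<r} s * ennreal (1 / V s) \<partial>lborel) \<le> ennreal A"
    "\<And>r. 0 < r \<Longrightarrow> r < 1 \<Longrightarrow> (\<integral>\<^sup>+s. indicator {0<..<r} s * ennreal (V s / (1 - s) ^ 4) \<partial>lborel) *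
       (\<integral>\<^sup>+s. indicator {r<..<1} s * ennreal ((1 - s)\<^sup>2 / V s) \<partial>lborel) \<le> ennreal A"
proof -
  obtain A1 where A1: "0 \<le> A1" "\<And>r. 0 < r \<Longrightarrow> r < 1 \<Longrightarrow>
      (\<integral>\<^sup>+s\<in>{r<..<1}. ennreal (vhat v s / (1 - s)\<^sup>2) \<partial>lebesgue) *
      (\<integral>\<^sup>+s\<in>{0<..<r}. ennreal (1 / vhat v s) \<partial>lebesgue) \<le> ennreal A1"
    using SUP_ennsqrt_bound[OF M1] by blast
  obtain A2 where A2: "0 \<le> A2" "\<And>r. 0 < r \<Longrightarrow> r < 1 \<Longrightarrow>
      (\<integral>\<^sup>+s\<in>{0<..<r}. ennreal (vhat v s / (1 - s) ^ 4) \<partial>lebesgue) *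
      (\<integral>\<^sup>+s\<in>{r<..<1}. ennreal ((1 - s)\<^sup>2 / vhat v s) \<partial>lebesgue) \<le> ennreal A2"
    using SUP_ennsqrt_bound[OF M2] by blast
  show ?thesis
  proof (rule that[of "max A1 A2"])
    fix r :: real assume r: "0 < r" "r < 1"
    have eq: "(\<integral>\<^sup>+s\<in>{r<..<1}. ennreal (vhat v s / (1 - s)\<^sup>2) \<partial>lebesgue) = (\<integral>\<^sup>+s. indicator {r<..<1} s * ennreal (V s / (1 - s)\<^sup>2) \<partial>lborel)"
      "(\<integral>\<^sup>+s\<in>{0<..<r}. ennreal (1 / vhat v s) \<partial>lebesgue) = (\<integral>\<^sup>+s. indicator {0<..<r} s * ennreal (1 / V s) \<partial>lborel)"
      "(\<integral>\<^sup>+s\<in>{0<..<r}. ennreal (vhat v s / (1 - s) ^ 4) \<partial>lebesgue) = (\<integral>\<^sup>+s. indicator {0<..<r} s * ennreal (V s / (1 - s) ^ 4) \<partial>lborel)"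
      "(\<integral>\<^sup>+s\<in>{r<..<1}. ennreal ((1 - s)\<^sup>2 / vhat v s) \<partial>lebesgue) = (\<integral>\<^sup>+s. indicator {r<..<1} s * ennreal ((1 - s)\<^sup>2 / V s) \<partial>lborel)"
      by (rule set_nn_integral_lebesgue_eq, use r in \<open>simp add: V_eq\<close>)+
    have le: "ennreal A1 \<le> ennreal (max A1 A2)" "ennreal A2 \<le> ennreal (max A1 A2)"
      by (auto intro: ennreal_leI)
    show "(\<integral>\<^sup>+s. indicator {r<..<1} s * ennreal (V s / (1 - s)\<^sup>2) \<partial>lborel) *
       (\<integral>\<^sup>+s. indicator {0<..<r} s * ennreal (1 / V s) \<partial>lborel) \<le> ennreal (max A1 A2)"
      using order_trans[OF A1(2)[OF r] le(1)] unfolding eq .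
    show "(\<integral>\<^sup>+s. indicator {0<..<r} s * ennreal (V s / (1 - s) ^ 4) \<partial>lborel) *
       (\<integral>\<^sup>+s. indicator {r<..<1} s * ennreal ((1 - s)\<^sup>2 / V s) \<partial>lborel) \<le> ennreal (max A1 A2)"
      using order_trans[OF A2(2)[OF r] le(2)] unfolding eq .
  qed (use A1(1) in auto)
qed

text \<open>Muckenhoupt's condition with \<open>\<kappa> = 1 / V\<close> in the first inequality and
  \<open>\<kappa> = (1 - x)^2 / V\<close> in the second. The two compose, since the weight produced
  by the first is the one consumed by the second.\<close>

lemma V_Hardy:
  obtains A where "0 \<le> A"
    "\<And>\<phi>. \<phi> \<in> borel_measurable borel \<Longrightarrow>
      (\<integral>\<^sup>+x. indicator {0<..<1} x * ennreal (V x / (1 - x)\<^sup>2) * (\<integral>\<^sup>+t. indicator {0<..<x} t * \<phi> t \<partial>lborel)\<^sup>2 \<partial>lborel)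
      \<le> ennreal A * (\<integral>\<^sup>+t. indicator {0<..<1} t * (\<phi> t)\<^sup>2 * ennreal (V t) \<partial>lborel)"
    "\<And>\<phi>. \<phi> \<in> borel_measurable borel \<Longrightarrow>
      (\<integral>\<^sup>+x. indicator {0<..<1} x * ennreal (V x / (1 - x) ^ 4) * (\<integral>\<^sup>+t. indicator {x<..<1} t * \<phi> t \<partial>lborel)\<^sup>2 \<partial>lborel)
      \<le> ennreal A * (\<integral>\<^sup>+t. indicator {0<..<1} t * (\<phi> t)\<^sup>2 * ennreal (V t / (1 - t)\<^sup>2) \<partial>lborel)"
proof -
  obtain A where A: "0 \<le> A"
    "\<And>r. 0 < r \<Longrightarrow> r < 1 \<Longrightarrow> (\<integral>\<^sup>+s. indicator {r<..<1} s * ennreal (V s / (1 - s)\<^sup>2) \<partial>lborel) *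
       (\<integral>\<^sup>+s. indicator {0<..<r} s * ennreal (1 / V s) \<partial>lborel) \<le> ennreal A"
    "\<And>r. 0 < r \<Longrightarrow> r < 1 \<Longrightarrow> (\<integral>\<^sup>+s. indicator {0<..<r} s * ennreal (V s / (1 - s) ^ 4) \<partial>lborel) *
       (\<integral>\<^sup>+s. indicator {r<..<1} s * ennreal ((1 - s)\<^sup>2 / V s) \<partial>lborel) \<le> ennreal A"
    using weight_conditions by blast
  show ?thesis
  proof (rule that[of "4 * A"])
    fix \<phi> :: "real \<Rightarrow> ennreal" assume [measurable]: "\<phi> \<in> borel_measurable borel"
    have nz: "V x \<noteq> 0" if "0 < x" "x < 1" for x
      using V_pos[OF that] by simp
    have cont: "continuous_on {0<..<1} (\<lambda>x. V x / (1 - x)\<^sup>2)" "continuous_on {0<..<1} (\<lambda>x. 1 / V x)"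
      "continuous_on {0<..<1} (\<lambda>x. V x / (1 - x) ^ 4)" "continuous_on {0<..<1} (\<lambda>x. (1 - x)\<^sup>2 / V x)"
      using nz by (auto intro!: continuous_intros V_continuous)
    have "(\<integral>\<^sup>+x. indicator {0<..<1} x * ennreal (V x / (1 - x)\<^sup>2) * (\<integral>\<^sup>+t. indicator {0<..<x} t * \<phi> t \<partial>lborel)\<^sup>2 \<partial>lborel)
      \<le> ennreal (4 * A) * (\<integral>\<^sup>+t. indicator {0<..<1} t * (\<phi> t)\<^sup>2 * ennreal (1 / (1 / V t)) \<partial>lborel)"
      by (rule hardy_inequality[OF _ _ _ cont(1,2) _ _ A(1,2)]) (use V_pos in auto)
    then show "(\<integral>\<^sup>+x. indicator {0<..<1} x * ennreal (V x / (1 - x)\<^sup>2) * (\<integral>\<^sup>+t. indicator {0<..<x} t * \<phi> t \<partial>lborel)\<^sup>2 \<partial>lborel)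
      \<le> ennreal (4 * A) * (\<integral>\<^sup>+t. indicator {0<..<1} t * (\<phi> t)\<^sup>2 * ennreal (V t) \<partial>lborel)"
      by simp
    have "(\<integral>\<^sup>+x. indicator {0<..<1} x * ennreal (V x / (1 - x) ^ 4) * (\<integral>\<^sup>+t. indicator {x<..<1} t * \<phi> t \<partial>lborel)\<^sup>2 \<partial>lborel)
      \<le> ennreal (4 * A) * (\<integral>\<^sup>+t. indicator {0<..<1} t * (\<phi> t)\<^sup>2 * ennreal (1 / ((1 - t)\<^sup>2 / V t)) \<partial>lborel)"
      by (rule hardy_inequality_dual[OF _ _ _ cont(3,4) _ _ A(1,3)]) (use V_pos in auto)
    then show "(\<integral>\<^sup>+x. indicator {0<..<1} x * ennreal (V x / (1 - x) ^ 4) * (\<integral>\<^sup>+t. indicator {x<..<1} t * \<phi> t \<partial>lborel)\<^sup>2 \<partial>lborel)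
      \<le> ennreal (4 * A) * (\<integral>\<^sup>+t. indicator {0<..<1} t * (\<phi> t)\<^sup>2 * ennreal (V t / (1 - t)\<^sup>2) \<partial>lborel)"
      by simp
  qed (use A in auto)
qed

lemma nn_integral_split_half_finite:
  fixes f :: "real \<Rightarrow> ennreal"
  assumes [measurable]: "f \<in> borel_measurable borel"
    and "(\<integral>\<^sup>+s. indicator {0<..<1/2::real} s * f s \<partial>lborel) < top"
    and "(\<integral>\<^sup>+s. indicator {1/2<..<1} s * f s \<partial>lborel) < top"
  shows "(\<integral>\<^sup>+s. indicator {0<..<1} s * f s \<partial>lborel) < top"
proof -
  have "(\<integral>\<^sup>+s. indicator {0<..<1} s * f s \<partial>lborel)
     = (\<integral>\<^sup>+s. (indicator {0<..<1/2::real} s * f s + indicator {1/2<..<1} s * f s) \<partial>lborel)"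
    by (rule nn_integral_cong_AE)
      (use AE_lborel_singleton[of "1/2"] in eventually_elim, auto split: split_indicator)
  also have "\<dots> < top" using assms by (subst nn_integral_add) auto
  finally show ?thesis .
qed

text \<open>At \<open>r = 1/2\<close> each integral over \<open>(1/2, 1)\<close> is a factor of a
  bounded product whose other factor is positive. The half next to 0 is treated directly, by a
  moment and by monotonicity of \<open>V\<close>. The first integral is used for the constant Taylor
  coefficient, the second for integrability of \<open>f\<close> on the radius.\<close>

lemma V_integrals_finite:
  "(\<integral>\<^sup>+s. indicator {0<..<1} s * ennreal (V s / (1 - s)\<^sup>2) \<partial>lborel) < top"
  "(\<integral>\<^sup>+s. indicator {0<..<1} s * ennreal ((1 - s)\<^sup>2 / V s) \<partial>lborel) < top"
proof -
  obtain A where A: "0 \<le> A"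
    "\<And>r. 0 < r \<Longrightarrow> r < 1 \<Longrightarrow> (\<integral>\<^sup>+s. indicator {r<..<1} s * ennreal (V s / (1 - s)\<^sup>2) \<partial>lborel) *
       (\<integral>\<^sup>+s. indicator {0<..<r} s * ennreal (1 / V s) \<partial>lborel) \<le> ennreal A"
    "\<And>r. 0 < r \<Longrightarrow> r < 1 \<Longrightarrow> (\<integral>\<^sup>+s. indicator {0<..<r} s * ennreal (V s / (1 - s) ^ 4) \<partial>lborel) *
       (\<integral>\<^sup>+s. indicator {r<..<1} s * ennreal ((1 - s)\<^sup>2 / V s) \<partial>lborel) \<le> ennreal A"
    using weight_conditions by blast
  have fin: "P < top" if "P * Q \<le> ennreal A" "0 < Q" for P Q
  proof -
    have "P * Q < top" using that(1) le_less_trans ennreal_less_top by blast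
    then show ?thesis using that(2) by (auto simp: ennreal_mult_less_top)
  qed
  have pos1: "0 < (\<integral>\<^sup>+s. indicator {0<..<1/2::real} s * ennreal (1 / V s) \<partial>lborel)"
    "0 < (\<integral>\<^sup>+s. indicator {0<..<1/2::real} s * ennreal (V s / (1 - s) ^ 4) \<partial>lborel)"
    using V_pos by (auto intro!: nn_integral_Ioo_pos divide_pos_pos)
  have h: "0 < (1/2::real)" "(1/2::real) < 1" by auto
  show "(\<integral>\<^sup>+s. indicator {0<..<1} s * ennreal (V s / (1 - s)\<^sup>2) \<partial>lborel) < top"
  proof (rule nn_integral_split_half_finite)
    show "(\<integral>\<^sup>+s. indicator {1/2<..<1} s * ennreal (V s / (1 - s)\<^sup>2) \<partial>lborel) < top"
      by (rule fin[OF A(2)[OF h] pos1(1)])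
    \<comment> \<open>Here \<open>1 / (1 - s)^2\<close> is at most 4, and \<open>moment w 0\<close>
      is the integral of \<open>2 * V\<close>.\<close>
    have "(\<integral>\<^sup>+s. indicator {0<..<1/2::real} s * ennreal (V s / (1 - s)\<^sup>2) \<partial>lborel)
       \<le> (\<integral>\<^sup>+s. ennreal 2 * (indicator {0<..<1} s * ennreal (2 * (real (2 * 0 + 1) * s ^ (2 * 0)) * V s)) \<partial>lborel)"
    proof (rule nn_integral_mono)
      fix s :: real
      show "indicator {0<..<1/2::real} s * ennreal (V s / (1 - s)\<^sup>2)
        \<le> ennreal 2 * (indicator {0<..<1} s * ennreal (2 * (real (2 * 0 + 1) * s ^ (2 * 0)) * V s))"
      proof (cases "0 < s \<and> s < 1/2")
        case True
        then have "(1/2)\<^sup>2 \<le> (1 - s)\<^sup>2" by (intro power_mono) auto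
        then have "V s / (1 - s)\<^sup>2 \<le> V s / (1/2)\<^sup>2"
          using V_pos[of s] True by (intro divide_left_mono) (auto intro!: mult_pos_pos)
        then show ?thesis
          using True V_pos[of s] by (simp add: ennreal_mult''[symmetric] power2_eq_square ennreal_leI del: ennreal_numeral)
      qed simp
    qed
    also have "\<dots> = ennreal 2 * moment w 0"
      unfolding moment_eq_V by (rule nn_integral_cmult) measurable
    also have "\<dots> < top" using moment_finite[of 0] by (simp add: ennreal_mult_less_top)
    finally show "(\<integral>\<^sup>+s. indicator {0<..<1/2::real} s * ennreal (V s / (1 - s)\<^sup>2) \<partial>lborel) < top" .
  qed measurable
  show "(\<integral>\<^sup>+s. indicator {0<..<1} s * ennreal ((1 - s)\<^sup>2 / V s) \<partial>lborel) < top"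
  proof (rule nn_integral_split_half_finite)
    show "(\<integral>\<^sup>+s. indicator {1/2<..<1} s * ennreal ((1 - s)\<^sup>2 / V s) \<partial>lborel) < top"
      by (rule fin[OF _ pos1(2)]) (use A(3)[OF h] in \<open>simp add: mult.commute\<close>)
    have "(\<integral>\<^sup>+s. indicator {0<..<1/2::real} s * ennreal ((1 - s)\<^sup>2 / V s) \<partial>lborel)
       \<le> (\<integral>\<^sup>+s. ennreal (1 / V (1/2)) * indicator {0<..<1/2::real} s \<partial>lborel)"
    proof (rule nn_integral_mono)
      fix s :: real
      show "indicator {0<..<1/2::real} s * ennreal ((1 - s)\<^sup>2 / V s) \<le> ennreal (1 / V (1/2)) * indicator {0<..<1/2::real} s"
      proof (cases "0 < s \<and> s < 1/2")
        case True
        then have "(1 - s)\<^sup>2 / V s \<le> 1 / V (1/2)"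
          using V_pos[of s] V_pos[of "1/2"] V_antimono[of s "1/2"]
          by (intro frac_le power_le_one) auto
        then show ?thesis using True by (simp add: ennreal_leI)
      qed simp
    qed
    also have "\<dots> = ennreal (1 / V (1/2)) * emeasure lborel {0<..<1/2::real}"
      by (rule nn_integral_cmult_indicator) simp
    also have "\<dots> < top"
      using emeasure_bounded_finite[of "{0<..<1/2::real}"] by (intro ennreal_mult_less_top[THEN iffD2] disjI2 conjI) auto
    finally show "(\<integral>\<^sup>+s. indicator {0<..<1/2::real} s * ennreal ((1 - s)\<^sup>2 / V s) \<partial>lborel) < top" .
  qed measurable
qed

end

section \<open>Estimates for majorants\<close>

lemma ennreal_add_square_le: "((a::ennreal) + b)\<^sup>2 \<le> 2 * a\<^sup>2 + 2 * b\<^sup>2"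
proof (cases "a = top \<or> b = top")
  case True
  then show ?thesis by (auto simp: power2_eq_square ennreal_mult_top)
next
  case False
  then obtain x y where [simp]: "a = ennreal x" "b = ennreal y" and xy: "0 \<le> x" "0 \<le> y"
    by (metis ennreal_cases)
  have "(x + y)\<^sup>2 \<le> 2 * x\<^sup>2 + 2 * y\<^sup>2"
    using sum_squares_bound[of x y] by (simp add: power2_sum)
  then have "ennreal ((x + y)\<^sup>2) \<le> ennreal (2 * x\<^sup>2 + 2 * y\<^sup>2)" by (rule ennreal_leI)
  moreover have "ennreal ((x + y)\<^sup>2) = (a + b)\<^sup>2"
    using xy by (simp add: ennreal_plus[symmetric] ennreal_power del: ennreal_plus)
  moreover have "ennreal (2 * x\<^sup>2 + 2 * y\<^sup>2) = 2 * a\<^sup>2 + 2 * b\<^sup>2"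
    using xy by (subst ennreal_plus) (simp_all add: ennreal_mult ennreal_power)
  ultimately show ?thesis by simp
qed

lemma nn_integral_Fubini_triangle:
  fixes f h :: "real \<Rightarrow> ennreal"
  assumes [measurable]: "f \<in> borel_measurable borel" "h \<in> borel_measurable borel"
  shows "(\<integral>\<^sup>+t. indicator {0<..<1} t * f t * (\<integral>\<^sup>+x. indicator {0<..<t} x * h x \<partial>lborel) \<partial>lborel)
     = (\<integral>\<^sup>+x. indicator {0<..<1} x * h x * (\<integral>\<^sup>+t. indicator {x<..<1} t * f t \<partial>lborel) \<partial>lborel)"
proof -
  have z: "(\<integral>\<^sup>+s. (if 0 < s \<and> s < x then c s else 0) \<partial>lborel) = 0" if "\<not> 0 < x" for x :: real and c
  proof -
    have "\<not> (0 < s \<and> s < x)" for s using that by auto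
    then show ?thesis by (simp only: if_False) simp
  qed
  have z': "(\<integral>\<^sup>+s. (if x < s \<and> s < 1 then c s else 0) \<partial>lborel) = 0" if "\<not> x < 1" for x :: real and c
  proof -
    have "\<not> (x < s \<and> s < 1)" for s using that by auto
    then show ?thesis by (simp only: if_False) simp
  qed
  have "(\<integral>\<^sup>+t. indicator {0<..<1} t * f t * (\<integral>\<^sup>+x. indicator {0<..<t} x * h x \<partial>lborel) \<partial>lborel)
    = (\<integral>\<^sup>+t. \<integral>\<^sup>+x. (if 0 < x \<and> x < t \<and> t < 1 then f t * h x else 0) \<partial>lborel \<partial>lborel)"
    by (intro nn_integral_cong, subst nn_integral_cmult[symmetric], measurable)
      (auto intro!: nn_integral_cong simp: mult.assoc z split: split_indicator)
  also have "\<dots> = (\<integral>\<^sup>+x. \<integral>\<^sup>+t. (if 0 < x \<and> x < t \<and> t < 1 then f t * h x else 0) \<partial>lborel \<partial>lborel)"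
    by (subst lborel_pair.Fubini') auto
  also have "\<dots> = (\<integral>\<^sup>+x. indicator {0<..<1} x * h x * (\<integral>\<^sup>+t. indicator {x<..<1} t * f t \<partial>lborel) \<partial>lborel)"
    by (intro nn_integral_cong, subst nn_integral_cmult[symmetric], measurable)
      (auto intro!: nn_integral_cong simp: mult_ac z' split: split_indicator)
  finally show ?thesis .
qed

text \<open>The reciprocal of \<open>(1 - 1 / k) ^ k\<close> is at most
  \<open>exp (k / (k - 1))\<close>, where the exponent is at most 2; then
  \<open>exp 1 \<le> 3\<close> gives the constant 9.\<close>

lemma one_minus_inverse_power_ge:
  assumes "k \<ge> 2"
  shows "1 \<le> 9 * (1 - 1 / real k) ^ k"
proof -
  define y where "y = 1 - 1 / real k"
  have y: "0 < y" using assms by (simp add: y_def field_simps)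
  have "1 / y = 1 + 1 / (real k - 1)" using assms by (simp add: y_def field_simps)
  also have "\<dots> \<le> exp (1 / (real k - 1))" by (rule exp_ge_add_one_self)
  finally have "(1 / y) ^ k \<le> exp (1 / (real k - 1)) ^ k"
    using y by (intro power_mono) auto
  also have "\<dots> = exp (real k / (real k - 1))"
    by (simp add: exp_of_nat_mult[symmetric])
  also have "\<dots> \<le> exp (1 + 1)" using assms by (simp add: field_simps)
  also have "\<dots> = exp 1 * exp (1::real)" by (rule exp_add)
  also have "\<dots> \<le> 3 * 3" using exp_le by (intro mult_mono) auto
  finally show ?thesis using y by (simp add: y_def[symmetric] power_divide field_simps)
qed

text \<open>With \<open>q = 1 - 1 / k\<close>, up to a factor 9 the power \<open>t ^ k\<close> is
  \<open>min t q ^ k\<close>, the integral over \<open>(0, t)\<close> of a kernel supported below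
  \<open>q\<close>. Exchanging the integrals turns the moment into an average of tail integrals of
  \<open>F\<close>; the kernel has mass at most 1, so Cauchy-Schwarz moves the square inside. The
  truncation at \<open>q\<close> is essential later, because \<open>\<mu>_le_V\<close> compares
  \<open>\<mu> (k - 1)\<close> with \<open>V x\<close> only in this range.\<close>

lemma power_moment_square_le:
  fixes F :: "real \<Rightarrow> ennreal"
  assumes [measurable]: "F \<in> borel_measurable borel" and k: "k \<ge> 2"
  shows "(\<integral>\<^sup>+t. indicator {0<..<1} t * (ennreal (t ^ k) * F t) \<partial>lborel)\<^sup>2
    \<le> 81 * (\<integral>\<^sup>+x. indicator {0<..<1} x * (indicator {..<1 - 1 / real k} x * ennreal (real k * x ^ (k - 1)))
          * (\<integral>\<^sup>+t. indicator {x<..<1} t * F t \<partial>lborel)\<^sup>2 \<partial>lborel)"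
proof -
  define q where "q = 1 - 1 / real k"
  have q: "0 < q" "q < 1" using k by (auto simp: q_def field_simps)
  define h where "h x = indicator {..<q} x * ennreal (real k * x ^ (k - 1))" for x :: real
  define G where "G x = (\<integral>\<^sup>+t. indicator {x<..<1} t * F t \<partial>lborel)" for x
  have [measurable]: "h \<in> borel_measurable borel" unfolding h_def by measurable
  have [measurable]: "G \<in> borel_measurable borel" unfolding G_def by measurable
  have inner: "(\<integral>\<^sup>+x. indicator {0<..<t} x * h x \<partial>lborel) = ennreal (min t q ^ k)" if "0 \<le> t" for t
  proof -
    have "(\<integral>\<^sup>+x. indicator {0<..<t} x * h x \<partial>lborel)
        = (\<integral>\<^sup>+x. indicator {0<..<min t q} x * ennreal (real (k - 1 + 1) * x ^ (k - 1)) \<partial>lborel)"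
      using k by (intro nn_integral_cong) (auto simp: h_def split: split_indicator)
    also have "\<dots> = ennreal (min t q ^ (k - 1 + 1))"
      by (rule nn_integral_Ioo_power) (use that q in auto)
    finally show ?thesis using k by simp
  qed
  have le: "t ^ k \<le> 9 * min t q ^ k" if t: "0 \<le> t" "t \<le> 1" for t
  proof (cases "t \<le> q")
    case True
    then show ?thesis using t by simp
  next
    case False
    have "t ^ k \<le> 1" using t by (simp add: power_le_one)
    also have "\<dots> \<le> 9 * q ^ k" unfolding q_def by (rule one_minus_inverse_power_ge[OF k])
    finally show ?thesis using False by simp
  qed
  have "(\<integral>\<^sup>+t. indicator {0<..<1} t * (ennreal (t ^ k) * F t) \<partial>lborel)
     \<le> (\<integral>\<^sup>+t. 9 * (indicator {0<..<1} t * F t * (\<integral>\<^sup>+x. indicator {0<..<t} x * h x \<partial>lborel)) \<partial>lborel)"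
  proof (rule nn_integral_mono)
    fix t :: real
    show "indicator {0<..<1} t * (ennreal (t ^ k) * F t) \<le> 9 * (indicator {0<..<1} t * F t * (\<integral>\<^sup>+x. indicator {0<..<t} x * h x \<partial>lborel))"
    proof (cases "0 < t \<and> t < 1")
      case True
      have "ennreal (t ^ k) \<le> ennreal (9 * min t q ^ k)" using le[of t] True by (intro ennreal_leI) auto
      also have "\<dots> = 9 * ennreal (min t q ^ k)" using True q by (simp add: ennreal_mult)
      finally have "ennreal (t ^ k) * F t \<le> 9 * ennreal (min t q ^ k) * F t" by (rule mult_right_mono) simp
      then have "ennreal (t ^ k) * F t \<le> 9 * (F t * ennreal (min t q ^ k))" by (simp add: mult_ac)
      then show ?thesis using True by (simp add: inner)
    qed auto
  qed
  also have "\<dots> = 9 * (\<integral>\<^sup>+t. indicator {0<..<1} t * F t * (\<integral>\<^sup>+x. indicator {0<..<t} x * h x \<partial>lborel) \<partial>lborel)"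
    by (rule nn_integral_cmult) measurable
  also have "\<dots> = 9 * (\<integral>\<^sup>+x. indicator {0<..<1} x * h x * G x \<partial>lborel)"
    unfolding G_def by (subst nn_integral_Fubini_triangle) auto
  finally have 1: "(\<integral>\<^sup>+t. indicator {0<..<1} t * (ennreal (t ^ k) * F t) \<partial>lborel) \<le> 9 * (\<integral>\<^sup>+x. indicator {0<..<1} x * h x * G x \<partial>lborel)" .
  define f where "f x = indicator {0<..<1} x * (indicator {..<q} x * ennreal (sqrt (real k * x ^ (k - 1))))" for x :: real
  have [measurable]: "f \<in> borel_measurable borel" unfolding f_def by measurable
  have f2: "(f x)\<^sup>2 = indicator {0<..<1} x * h x" for x
    by (simp add: f_def h_def ennreal_power split: split_indicator)
  have "(\<integral>\<^sup>+x. indicator {0<..<1} x * h x * G x \<partial>lborel)\<^sup>2 = (\<integral>\<^sup>+x. f x * (f x * G x) \<partial>lborel)\<^sup>2"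
    by (simp add: f2[symmetric] power2_eq_square mult.assoc)
  also have "\<dots> \<le> (\<integral>\<^sup>+x. (f x)\<^sup>2 \<partial>lborel) * (\<integral>\<^sup>+x. (f x * G x)\<^sup>2 \<partial>lborel)"
    by (rule Cauchy_Schwarz_nn_integral) measurable
  also have "\<dots> \<le> 1 * (\<integral>\<^sup>+x. (f x * G x)\<^sup>2 \<partial>lborel)"
  proof (rule mult_right_mono)
    have "(\<integral>\<^sup>+x. (f x)\<^sup>2 \<partial>lborel) = ennreal (q ^ k)"
      unfolding f2 using inner[of 1] q by simp
    also have "\<dots> \<le> ennreal 1" using q by (intro ennreal_leI power_le_one) auto
    finally show "(\<integral>\<^sup>+x. (f x)\<^sup>2 \<partial>lborel) \<le> 1" by simp
  qed simp
  also have "\<dots> = (\<integral>\<^sup>+x. indicator {0<..<1} x * h x * (G x)\<^sup>2 \<partial>lborel)"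
    by (simp add: power_mult_distrib f2)
  finally have 2: "(\<integral>\<^sup>+x. indicator {0<..<1} x * h x * G x \<partial>lborel)\<^sup>2 \<le> (\<integral>\<^sup>+x. indicator {0<..<1} x * h x * (G x)\<^sup>2 \<partial>lborel)" .
  have "(\<integral>\<^sup>+t. indicator {0<..<1} t * (ennreal (t ^ k) * F t) \<partial>lborel)\<^sup>2 \<le> (9 * (\<integral>\<^sup>+x. indicator {0<..<1} x * h x * G x \<partial>lborel))\<^sup>2"
    by (rule power_mono[OF 1]) simp
  also have "\<dots> = 81 * (\<integral>\<^sup>+x. indicator {0<..<1} x * h x * G x \<partial>lborel)\<^sup>2"
    by (simp add: power_mult_distrib)
  also have "\<dots> \<le> 81 * (\<integral>\<^sup>+x. indicator {0<..<1} x * h x * (G x)\<^sup>2 \<partial>lborel)"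
    by (rule mult_left_mono[OF 2]) simp
  finally show ?thesis unfolding h_def G_def q_def .
qed

text \<open>Meant for \<open>a n = cmod (coef f n)\<close>: it dominates \<open>cmod (f t)\<close>
  on the radius, and the passage to absolute values leaves the Dirichlet norm unchanged.\<close>

definition majorant :: "(nat \<Rightarrow> real) \<Rightarrow> real \<Rightarrow> ennreal" where
  "majorant a t = (\<Sum>n. ennreal (a n * t ^ n))"

lemma majorant_measurable [measurable]: "majorant a \<in> borel_measurable borel"
  unfolding majorant_def[abs_def] by measurable

lemma majorant_eq:
  assumes a: "\<And>n. 0 \<le> a n" and t: "0 \<le> t"
  shows "majorant a t = ennreal (a 0) + (\<integral>\<^sup>+s. indicator {0<..<t} s * (\<Sum>n. ennreal (real (n + 1) * a (n + 1) * s ^ n)) \<partial>lborel)"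
proof -
  have "(\<integral>\<^sup>+s. indicator {0<..<t} s * (\<Sum>n. ennreal (real (n + 1) * a (n + 1) * s ^ n)) \<partial>lborel)
     = (\<integral>\<^sup>+s. (\<Sum>n. ennreal (a (n + 1)) * (indicator {0<..<t} s * ennreal (real (n + 1) * s ^ n))) \<partial>lborel)"
  proof (rule nn_integral_cong)
    fix s :: real
    have "ennreal (real (n + 1) * a (n + 1) * s ^ n) = ennreal (a (n + 1)) * ennreal (real (n + 1) * s ^ n)" if "0 < s" for n
      using a that by (subst ennreal_mult''[symmetric]) (auto simp: mult_ac)
    then show "indicator {0<..<t} s * (\<Sum>n. ennreal (real (n + 1) * a (n + 1) * s ^ n))
      = (\<Sum>n. ennreal (a (n + 1)) * (indicator {0<..<t} s * ennreal (real (n + 1) * s ^ n)))"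
      by (auto split: split_indicator)
  qed
  also have "\<dots> = (\<Sum>n. ennreal (a (n + 1)) * ennreal (t ^ (n + 1)))"
    by (subst nn_integral_suminf, measurable, subst nn_integral_cmult, measurable, subst nn_integral_Ioo_power[OF t]) simp
  also have "\<dots> = (\<Sum>n. ennreal (a (n + 1) * t ^ (n + 1)))"
    using t by (simp add: ennreal_mult'')
  finally show ?thesis
    unfolding majorant_def using suminf_offset[of "\<lambda>n. ennreal (a n * t ^ n)" 1]
    by (simp add: add.commute)
qed

context hilbert_weight
begin

text \<open>For \<open>a n = cmod (coef f n)\<close> this is the squared Dirichlet norm; it is
  extended-valued so that no membership has to be assumed.\<close>

definition energy :: "(nat \<Rightarrow> real) \<Rightarrow> ennreal" where
  "energy a = ennreal ((a 0)\<^sup>2) + (\<Sum>n. ennreal ((real (n + 1) * a (n + 1))\<^sup>2) * moment w n)"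

text \<open>The chain of estimates: Hilbert's inequality puts the derivative of the majorant in
  \<open>L^2\<close> with weight \<open>V\<close> (\<open>S1\<close>), the first Hardy inequality
  puts the majorant in \<open>L^2\<close> with weight \<open>V / (1 - x)^2\<close>
  (\<open>S2\<close>). From there Cauchy-Schwarz gives the first bound and the second Hardy
  inequality gives the second.\<close>

lemma majorant_energy_bounds:
  obtains C where "0 \<le> C"
    "\<forall>a. (\<forall>n. 0 \<le> a n) \<longrightarrow> (\<integral>\<^sup>+t. indicator {0<..<1} t * majorant a t \<partial>lborel)\<^sup>2 \<le> ennreal C * energy a"
    "\<forall>a. (\<forall>n. 0 \<le> a n) \<longrightarrow>
      (\<integral>\<^sup>+x. indicator {0<..<1} x * ennreal (V x / (1 - x) ^ 4) * (\<integral>\<^sup>+t. indicator {x<..<1} t * majorant a t \<partial>lborel)\<^sup>2 \<partial>lborel)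
      \<le> ennreal C * energy a"
proof -
  obtain A where A: "0 \<le> A"
    "\<And>\<phi>. \<phi> \<in> borel_measurable borel \<Longrightarrow>
      (\<integral>\<^sup>+x. indicator {0<..<1} x * ennreal (V x / (1 - x)\<^sup>2) * (\<integral>\<^sup>+t. indicator {0<..<x} t * \<phi> t \<partial>lborel)\<^sup>2 \<partial>lborel)
      \<le> ennreal A * (\<integral>\<^sup>+t. indicator {0<..<1} t * (\<phi> t)\<^sup>2 * ennreal (V t) \<partial>lborel)"
    "\<And>\<phi>. \<phi> \<in> borel_measurable borel \<Longrightarrow>
      (\<integral>\<^sup>+x. indicator {0<..<1} x * ennreal (V x / (1 - x) ^ 4) * (\<integral>\<^sup>+t. indicator {x<..<1} t * \<phi> t \<partial>lborel)\<^sup>2 \<partial>lborel)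
      \<le> ennreal A * (\<integral>\<^sup>+t. indicator {0<..<1} t * (\<phi> t)\<^sup>2 * ennreal (V t / (1 - t)\<^sup>2) \<partial>lborel)"
    using V_Hardy by blast
  obtain c0 where c0: "0 \<le> c0" "(\<integral>\<^sup>+s. indicator {0<..<1} s * ennreal (V s / (1 - s)\<^sup>2) \<partial>lborel) = ennreal c0"
    using V_integrals_finite(1) by (cases "(\<integral>\<^sup>+s. indicator {0<..<1} s * ennreal (V s / (1 - s)\<^sup>2) \<partial>lborel)") auto
  obtain c1 where c1: "0 \<le> c1" "(\<integral>\<^sup>+s. indicator {0<..<1} s * ennreal ((1 - s)\<^sup>2 / V s) \<partial>lborel) = ennreal c1"
    using V_integrals_finite(2) by (cases "(\<integral>\<^sup>+s. indicator {0<..<1} s * ennreal ((1 - s)\<^sup>2 / V s) \<partial>lborel)") auto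
  \<comment> \<open>Separating the constant coefficient inside the square costs a factor 2 on both
    parts; the derivative part carries a further 2 from \<open>S1\<close>.\<close>
  define C2 where "C2 = 2 * c0 + 4 * A"
  have C2: "0 \<le> C2" using c0 A by (simp add: C2_def)
  have S2: "(\<integral>\<^sup>+x. indicator {0<..<1} x * (majorant a x)\<^sup>2 * ennreal (V x / (1 - x)\<^sup>2) \<partial>lborel) \<le> ennreal C2 * energy a"
    if a: "\<And>n. 0 \<le> a n" for a
  proof -
    define \<phi> where "\<phi> t = (\<Sum>n. ennreal (real (n + 1) * a (n + 1) * t ^ n))" for t
    define \<Phi> where "\<Phi> x = (\<integral>\<^sup>+t. indicator {0<..<x} t * \<phi> t \<partial>lborel)" for x
    have [measurable]: "\<phi> \<in> borel_measurable borel" unfolding \<phi>_def by measurable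
    have [measurable]: "\<Phi> \<in> borel_measurable borel" unfolding \<Phi>_def by measurable
    have "(\<integral>\<^sup>+t. indicator {0<..<1} t * (\<phi> t)\<^sup>2 * ennreal (V t) \<partial>lborel)
       = (\<integral>\<^sup>+t. indicator {0<..<1} t * (\<Sum>n. ennreal ((real (n + 1) * a (n + 1)) * t ^ n))\<^sup>2 * tail w t \<partial>lborel)"
      by (intro nn_integral_cong) (auto simp: tail_eq_V \<phi>_def split: split_indicator)
    also have "\<dots> \<le> 2 * (\<Sum>n. ennreal ((real (n + 1) * a (n + 1))\<^sup>2) * moment w n)"
      by (rule nn_integral_power_series_tail_le) (use a w_nonneg in auto)
    also have "\<dots> \<le> 2 * energy a"
      unfolding energy_def by (intro mult_left_mono) auto
    finally have S1: "(\<integral>\<^sup>+t. indicator {0<..<1} t * (\<phi> t)\<^sup>2 * ennreal (V t) \<partial>lborel) \<le> 2 * energy a" .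
    have "(\<integral>\<^sup>+x. indicator {0<..<1} x * (majorant a x)\<^sup>2 * ennreal (V x / (1 - x)\<^sup>2) \<partial>lborel)
      \<le> (\<integral>\<^sup>+x. 2 * ennreal ((a 0)\<^sup>2) * (indicator {0<..<1} x * ennreal (V x / (1 - x)\<^sup>2))
           + 2 * (indicator {0<..<1} x * ennreal (V x / (1 - x)\<^sup>2) * (\<Phi> x)\<^sup>2) \<partial>lborel)"
    proof (rule nn_integral_mono)
      fix x :: real
      show "indicator {0<..<1} x * (majorant a x)\<^sup>2 * ennreal (V x / (1 - x)\<^sup>2)
        \<le> 2 * ennreal ((a 0)\<^sup>2) * (indicator {0<..<1} x * ennreal (V x / (1 - x)\<^sup>2))
           + 2 * (indicator {0<..<1} x * ennreal (V x / (1 - x)\<^sup>2) * (\<Phi> x)\<^sup>2)"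
      proof (cases "0 < x \<and> x < 1")
        case True
        have "majorant a x = ennreal (a 0) + \<Phi> x"
          unfolding \<Phi>_def \<phi>_def using True by (intro majorant_eq a) auto
        then have "(majorant a x)\<^sup>2 \<le> 2 * ennreal ((a 0)\<^sup>2) + 2 * (\<Phi> x)\<^sup>2"
          using ennreal_add_square_le[of "ennreal (a 0)" "\<Phi> x"] a[of 0] by (simp add: ennreal_power)
        then have "(majorant a x)\<^sup>2 * ennreal (V x / (1 - x)\<^sup>2) \<le> (2 * ennreal ((a 0)\<^sup>2) + 2 * (\<Phi> x)\<^sup>2) * ennreal (V x / (1 - x)\<^sup>2)"
          by (rule mult_right_mono) simp
        then show ?thesis using True unfolding distrib_right by (simp add: mult_ac)
      qed auto
    qed
    also have "\<dots> = 2 * ennreal ((a 0)\<^sup>2) * ennreal c0 + 2 * (\<integral>\<^sup>+x. indicator {0<..<1} x * ennreal (V x / (1 - x)\<^sup>2) * (\<Phi> x)\<^sup>2 \<partial>lborel)"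
      by (subst nn_integral_add, measurable, subst (1 2) nn_integral_cmult, measurable) (simp add: c0(2))
    also have "\<dots> \<le> 2 * energy a * ennreal c0 + 2 * (ennreal A * (2 * energy a))"
    proof (intro add_mono mult_right_mono mult_left_mono)
      have "(\<integral>\<^sup>+x. indicator {0<..<1} x * ennreal (V x / (1 - x)\<^sup>2) * (\<Phi> x)\<^sup>2 \<partial>lborel)
         \<le> ennreal A * (\<integral>\<^sup>+t. indicator {0<..<1} t * (\<phi> t)\<^sup>2 * ennreal (V t) \<partial>lborel)"
        unfolding \<Phi>_def by (rule A(2)) measurable
      also have "\<dots> \<le> ennreal A * (2 * energy a)"
        by (rule mult_left_mono[OF S1]) simp
      finally show "(\<integral>\<^sup>+x. indicator {0<..<1} x * ennreal (V x / (1 - x)\<^sup>2) * (\<Phi> x)\<^sup>2 \<partial>lborel) \<le> ennreal A * (2 * energy a)" .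
    qed (auto simp: energy_def)
    also have "\<dots> = ennreal (2 * c0) * energy a + ennreal (4 * A) * energy a"
      using c0 A by (simp add: ennreal_mult mult_ac)
    also have "\<dots> = ennreal C2 * energy a"
      using c0 A by (simp add: C2_def distrib_right)
    finally show ?thesis .
  qed
  show ?thesis
  proof (rule that[of "C2 * c1 + A * C2"]; (intro allI impI)?)
    fix a :: "nat \<Rightarrow> real" assume "\<forall>n. 0 \<le> a n"
    then have a: "\<And>n. 0 \<le> a n" by blast
    have up: "ennreal (C2 * c1) * energy a \<le> ennreal (C2 * c1 + A * C2) * energy a"
      "ennreal (A * C2) * energy a \<le> ennreal (C2 * c1 + A * C2) * energy a"
      using C2 c1 A by (auto intro!: mult_right_mono ennreal_leI)
    \<comment> \<open>Factors for Cauchy-Schwarz: the square of \<open>f\<close> is the integrand of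
      \<open>S2\<close>, and the square of \<open>h\<close> integrates to \<open>c1\<close>.\<close>
    define f where "f x = indicator {0<..<1} x * majorant a x * ennreal (sqrt (V x) / (1 - x))" for x
    define h where "h x = indicator {0<..<1} x * ennreal ((1 - x) / sqrt (V x))" for x
    have [measurable]: "f \<in> borel_measurable lborel" "h \<in> borel_measurable lborel"
      unfolding f_def h_def by measurable
    have fh: "f x * h x = indicator {0<..<1} x * majorant a x"
      "(f x)\<^sup>2 = indicator {0<..<1} x * (majorant a x)\<^sup>2 * ennreal (V x / (1 - x)\<^sup>2)"
      "(h x)\<^sup>2 = indicator {0<..<1} x * ennreal ((1 - x)\<^sup>2 / V x)" for x
    proof -
      have "ennreal (sqrt (V x) / (1 - x)) * ennreal ((1 - x) / sqrt (V x)) = 1" if "0 < x" "x < 1"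
        using that V_pos[of x] by (simp add: ennreal_mult''[symmetric])
      then show "f x * h x = indicator {0<..<1} x * majorant a x"
        by (simp add: f_def h_def mult.assoc split: split_indicator)
      show "(f x)\<^sup>2 = indicator {0<..<1} x * (majorant a x)\<^sup>2 * ennreal (V x / (1 - x)\<^sup>2)"
        "(h x)\<^sup>2 = indicator {0<..<1} x * ennreal ((1 - x)\<^sup>2 / V x)"
        using V_pos[of x]
        by (auto simp: f_def h_def power_mult_distrib ennreal_power power_divide split: split_indicator)
    qed
    have "(\<integral>\<^sup>+t. indicator {0<..<1} t * majorant a t \<partial>lborel)\<^sup>2 \<le> (\<integral>\<^sup>+t. (f t)\<^sup>2 \<partial>lborel) * (\<integral>\<^sup>+t. (h t)\<^sup>2 \<partial>lborel)"
      unfolding fh(1)[symmetric] by (rule Cauchy_Schwarz_nn_integral) measurable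
    also have "\<dots> \<le> (ennreal C2 * energy a) * ennreal c1"
      unfolding fh c1(2) by (intro mult_right_mono S2 a) auto
    also have "\<dots> = ennreal (C2 * c1) * energy a"
      using C2 c1 by (simp add: ennreal_mult mult_ac)
    finally show "(\<integral>\<^sup>+t. indicator {0<..<1} t * majorant a t \<partial>lborel)\<^sup>2 \<le> ennreal (C2 * c1 + A * C2) * energy a"
      using up(1) by (rule order_trans)
    have "(\<integral>\<^sup>+x. indicator {0<..<1} x * ennreal (V x / (1 - x) ^ 4) * (\<integral>\<^sup>+t. indicator {x<..<1} t * majorant a t \<partial>lborel)\<^sup>2 \<partial>lborel)
      \<le> ennreal A * (\<integral>\<^sup>+t. indicator {0<..<1} t * (majorant a t)\<^sup>2 * ennreal (V t / (1 - t)\<^sup>2) \<partial>lborel)"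
      by (rule A(3)) measurable
    also have "\<dots> \<le> ennreal A * (ennreal C2 * energy a)"
      by (intro mult_left_mono S2 a) auto
    also have "\<dots> = ennreal (A * C2) * energy a"
      using A C2 by (simp add: ennreal_mult mult_ac)
    finally show "(\<integral>\<^sup>+x. indicator {0<..<1} x * ennreal (V x / (1 - x) ^ 4) * (\<integral>\<^sup>+t. indicator {x<..<1} t * majorant a t \<partial>lborel)\<^sup>2 \<partial>lborel)
      \<le> ennreal (C2 * c1 + A * C2) * energy a"
      using up(2) by (rule order_trans)
  qed (use C2 c1 A in auto)
qed

text \<open>On the support \<open>x < 1 - 1 / k\<close> of the kernel in
  \<open>power_moment_square_le\<close> the moment \<open>\<mu> (k - 1)\<close> is at most a
  multiple of \<open>V x\<close>, independent of \<open>k\<close>. Summation over \<open>k\<close>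
  under the integral then meets the assumed bound \<open>\<delta> / (1 - x)^4\<close>, and what is
  left is the second integral of \<open>majorant_energy_bounds\<close>.\<close>

lemma image_tail_energy_le:
  obtains C where "0 < C"
    "\<And>a b K \<delta>. (\<And>n. 0 \<le> a n) \<Longrightarrow> (\<And>k. 0 \<le> b k) \<Longrightarrow> 2 \<le> K \<Longrightarrow> 0 \<le> \<delta> \<Longrightarrow>
      (\<And>x. 0 < x \<Longrightarrow> x < 1 \<Longrightarrow>
        (\<Sum>k. if K \<le> k then ennreal (real k ^ 3 * b k * x ^ (k - 1)) else 0) \<le> ennreal (\<delta> / (1 - x) ^ 4)) \<Longrightarrow>
      (\<Sum>k. if K \<le> k then ennreal ((real k)\<^sup>2 * b k * \<mu> (k - 1)) *
          (\<integral>\<^sup>+t. indicator {0<..<1} t * (ennreal (t ^ k) * majorant a t) \<partial>lborel)\<^sup>2 else 0) \<le> ennreal (C * \<delta>) * energy a"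
proof -
  obtain C0 where C0: "0 \<le> C0"
    "\<forall>a. (\<forall>n. 0 \<le> a n) \<longrightarrow> (\<integral>\<^sup>+t. indicator {0<..<1} t * majorant a t \<partial>lborel)\<^sup>2 \<le> ennreal C0 * energy a"
    "\<forall>a. (\<forall>n. 0 \<le> a n) \<longrightarrow>
      (\<integral>\<^sup>+x. indicator {0<..<1} x * ennreal (V x / (1 - x) ^ 4) * (\<integral>\<^sup>+t. indicator {x<..<1} t * majorant a t \<partial>lborel)\<^sup>2 \<partial>lborel)
      \<le> ennreal C0 * energy a"
    using majorant_energy_bounds .
  obtain C1 where C1: "0 < C1" "\<And>n x. 0 < x \<Longrightarrow> x < 1 \<Longrightarrow> 1 \<le> real (n + 1) * (1 - x) \<Longrightarrow> \<mu> n \<le> C1 * V x"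
    using \<mu>_le_V by blast
  show ?thesis
  \<comment> \<open>The summand 1 keeps the constant positive even if \<open>C0 = 0\<close>; it is
    divided by when \<open>\<delta>\<close> is chosen.\<close>
  proof (rule that[of "81 * C1 * C0 + 1"])
    show "0 < 81 * C1 * C0 + 1" using C0 C1 by (simp add: add_nonneg_pos)
    fix a b :: "nat \<Rightarrow> real" and K :: nat and \<delta> :: real
    assume a: "\<And>n. 0 \<le> a n" and b: "\<And>k. 0 \<le> b k" and K: "2 \<le> K" and \<delta>: "0 \<le> \<delta>"
      and bound: "\<And>x. 0 < x \<Longrightarrow> x < 1 \<Longrightarrow>
        (\<Sum>k. if K \<le> k then ennreal (real k ^ 3 * b k * x ^ (k - 1)) else 0) \<le> ennreal (\<delta> / (1 - x) ^ 4)"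
    define G where "G x = (\<integral>\<^sup>+t. indicator {x<..<1} t * majorant a t \<partial>lborel)" for x
    have [measurable]: "G \<in> borel_measurable borel" unfolding G_def by measurable
    define H where "H k x = indicator {0<..<1} x * (indicator {..<1 - 1 / real k} x * ennreal (real k * x ^ (k - 1))) * (G x)\<^sup>2" for k x
    have [measurable]: "H k \<in> borel_measurable borel" for k unfolding H_def by measurable
    define c where "c k = ennreal ((real k)\<^sup>2 * b k * \<mu> (k - 1))" for k
    have "(\<Sum>k. if K \<le> k then c k * (\<integral>\<^sup>+t. indicator {0<..<1} t * (ennreal (t ^ k) * majorant a t) \<partial>lborel)\<^sup>2 else 0)
      \<le> (\<Sum>k. \<integral>\<^sup>+x. (if K \<le> k then 81 * c k else 0) * H k x \<partial>lborel)"
    proof (rule suminf_le)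
      fix k
      show "(if K \<le> k then c k * (\<integral>\<^sup>+t. indicator {0<..<1} t * (ennreal (t ^ k) * majorant a t) \<partial>lborel)\<^sup>2 else 0)
        \<le> (\<integral>\<^sup>+x. (if K \<le> k then 81 * c k else 0) * H k x \<partial>lborel)"
      proof (cases "K \<le> k")
        case True
        have "c k * (\<integral>\<^sup>+t. indicator {0<..<1} t * (ennreal (t ^ k) * majorant a t) \<partial>lborel)\<^sup>2 \<le> c k * (81 * (\<integral>\<^sup>+x. H k x \<partial>lborel))"
          unfolding H_def G_def by (intro mult_left_mono power_moment_square_le) (use True K in auto)
        also have "\<dots> = (\<integral>\<^sup>+x. (81 * c k) * H k x \<partial>lborel)"
          by (subst nn_integral_cmult) (auto simp: mult_ac)
        finally show ?thesis using True by simp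
      qed simp
    qed auto
    also have "\<dots> = (\<integral>\<^sup>+x. (\<Sum>k. (if K \<le> k then 81 * c k else 0) * H k x) \<partial>lborel)"
      by (rule nn_integral_suminf[symmetric]) measurable
    also have "\<dots> \<le> (\<integral>\<^sup>+x. ennreal (81 * C1 * \<delta>) * (indicator {0<..<1} x * ennreal (V x / (1 - x) ^ 4) * (G x)\<^sup>2) \<partial>lborel)"
    proof (rule nn_integral_mono)
      fix x :: real
      show "(\<Sum>k. (if K \<le> k then 81 * c k else 0) * H k x)
        \<le> ennreal (81 * C1 * \<delta>) * (indicator {0<..<1} x * ennreal (V x / (1 - x) ^ 4) * (G x)\<^sup>2)"
      proof (cases "0 < x \<and> x < 1")
        case True
        then have x: "0 < x" "x < 1" by auto
        have Vx: "0 < V x" by (rule V_pos[OF x])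
        have "(\<Sum>k. (if K \<le> k then 81 * c k else 0) * H k x)
          \<le> (\<Sum>k. (81 * ennreal (C1 * V x) * (G x)\<^sup>2) * (if K \<le> k then ennreal (real k ^ 3 * b k * x ^ (k - 1)) else 0))"
        proof (rule suminf_le)
          fix k
          show "(if K \<le> k then 81 * c k else 0) * H k x
            \<le> (81 * ennreal (C1 * V x) * (G x)\<^sup>2) * (if K \<le> k then ennreal (real k ^ 3 * b k * x ^ (k - 1)) else 0)"
          proof (cases "K \<le> k \<and> x < 1 - 1 / real k")
            case True
            then have k: "K \<le> k" "2 \<le> k" "x < 1 - 1 / real k" using K by auto
            \<comment> \<open>The hypothesis of \<open>\<mu>_le_V\<close> for the index
              \<open>k - 1\<close>; it is equivalent to \<open>x \<le> 1 - 1 / k\<close>.\<close>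
            have "1 \<le> real (k - 1 + 1) * (1 - x)"
              using k by (simp add: field_simps)
            then have "\<mu> (k - 1) \<le> C1 * V x" by (intro C1 x)
            then have "((real k)\<^sup>2 * b k * (real k * x ^ (k - 1))) * \<mu> (k - 1) \<le> ((real k)\<^sup>2 * b k * (real k * x ^ (k - 1))) * (C1 * V x)"
              using b[of k] x by (intro mult_left_mono) auto
            then have "((real k)\<^sup>2 * b k * \<mu> (k - 1)) * (real k * x ^ (k - 1)) \<le> (C1 * V x) * (real k ^ 3 * b k * x ^ (k - 1))"
              by (simp add: power2_eq_square power3_eq_cube mult_ac)
            then have "c k * ennreal (real k * x ^ (k - 1)) \<le> ennreal (C1 * V x) * ennreal (real k ^ 3 * b k * x ^ (k - 1))"
              unfolding c_def using b[of k] x C1 Vx by (simp add: ennreal_mult''[symmetric] ennreal_leI)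
            then have "(81 * (G x)\<^sup>2) * (c k * ennreal (real k * x ^ (k - 1))) \<le> (81 * (G x)\<^sup>2) * (ennreal (C1 * V x) * ennreal (real k ^ 3 * b k * x ^ (k - 1)))"
              by (rule mult_left_mono) simp
            then show ?thesis using k x by (simp add: H_def mult_ac)
          next
            case False
            then show ?thesis by (auto simp: H_def)
          qed
        qed auto
        also have "\<dots> = (81 * ennreal (C1 * V x) * (G x)\<^sup>2) * (\<Sum>k. if K \<le> k then ennreal (real k ^ 3 * b k * x ^ (k - 1)) else 0)"
          by (rule ennreal_suminf_cmult)
        also have "\<dots> \<le> (81 * ennreal (C1 * V x) * (G x)\<^sup>2) * ennreal (\<delta> / (1 - x) ^ 4)"
          by (intro mult_left_mono bound x) simp
        also have "\<dots> = (81 * (ennreal (C1 * V x) * ennreal (\<delta> / (1 - x) ^ 4))) * (G x)\<^sup>2"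
          by (simp only: mult_ac)
        also have "81 * (ennreal (C1 * V x) * ennreal (\<delta> / (1 - x) ^ 4)) = ennreal (81 * C1 * \<delta>) * ennreal (V x / (1 - x) ^ 4)"
        proof -
          have "81 * (ennreal (C1 * V x) * ennreal (\<delta> / (1 - x) ^ 4)) = ennreal (81 * (C1 * V x * (\<delta> / (1 - x) ^ 4)))"
            using C1 Vx \<delta> x by (subst ennreal_mult''[symmetric], simp, subst numeral_mult_ennreal) auto
          also have "81 * (C1 * V x * (\<delta> / (1 - x) ^ 4)) = (81 * C1 * \<delta>) * (V x / (1 - x) ^ 4)" by simp
          also have "ennreal \<dots> = ennreal (81 * C1 * \<delta>) * ennreal (V x / (1 - x) ^ 4)"
            using Vx x by (intro ennreal_mult'') simp
          finally show ?thesis .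
        qed
        finally show ?thesis using x by (simp add: mult_ac)
      qed (auto simp: H_def)
    qed
    also have "\<dots> = ennreal (81 * C1 * \<delta>) * (\<integral>\<^sup>+x. indicator {0<..<1} x * ennreal (V x / (1 - x) ^ 4) * (G x)\<^sup>2 \<partial>lborel)"
      by (rule nn_integral_cmult) measurable
    also have "\<dots> \<le> ennreal (81 * C1 * \<delta>) * (ennreal C0 * energy a)"
      unfolding G_def using C0(3) a by (intro mult_left_mono) auto
    also have "\<dots> = ennreal (81 * C1 * C0 * \<delta>) * energy a"
      using C0 by (simp add: mult.assoc[symmetric] ennreal_mult''[symmetric]) (simp add: mult_ac)
    also have "\<dots> \<le> ennreal ((81 * C1 * C0 + 1) * \<delta>) * energy a"
      using \<delta> by (intro mult_right_mono ennreal_leI) auto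
    finally show "(\<Sum>k. if K \<le> k then ennreal ((real k)\<^sup>2 * b k * \<mu> (k - 1)) *
          (\<integral>\<^sup>+t. indicator {0<..<1} t * (ennreal (t ^ k) * majorant a t) \<partial>lborel)\<^sup>2 else 0) \<le> ennreal ((81 * C1 * C0 + 1) * \<delta>) * energy a"
      unfolding c_def .
  qed
qed

end

section \<open>The operator on Taylor coefficients\<close>

definition coef :: "(complex \<Rightarrow> complex) \<Rightarrow> nat \<Rightarrow> complex" where
  "coef f n = (deriv ^^ n) f 0 / fact n"

lemma coef_sums:
  assumes "f holomorphic_on ball 0 1" "cmod z < 1"
  shows "(\<lambda>n. coef f n * z ^ n) sums f z"
  using holomorphic_power_series[OF assms(1), of z] assms(2) by (simp add: coef_def)

lemma coef_0: "coef f 0 = f 0"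
  by (simp add: coef_def)

lemma coef_deriv: "coef (deriv f) n = of_nat (n + 1) * coef f (n + 1)"
proof -
  have "(deriv ^^ n) (deriv f) 0 = (deriv ^^ (n + 1)) f 0"
    by (simp add: funpow_swap1)
  moreover have "of_nat (n + 1) \<noteq> (0 :: complex)" by (simp only: of_nat_eq_0_iff)
  ultimately show ?thesis by (simp add: coef_def del: of_nat_Suc of_nat_add funpow.simps)
qed

text \<open>Identifies Taylor coefficients from a convergent expansion, by way of formal power
  series. It is applied to \<open>hilbert_op g f\<close> and to the limit function in the
  compactness proof.\<close>

lemma power_series_ball:
  assumes "\<And>z. cmod z < 1 \<Longrightarrow> (\<lambda>n. c n * z ^ n) sums f z"
  shows "f holomorphic_on ball 0 1" "coef f n = c n"
proof -
  show "f holomorphic_on ball 0 1"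
    by (rule power_series_holomorphic[where a = c]) (use assms in auto)
  define F where "F = Abs_fps c"
  have "fps_conv_radius F \<ge> 1"
    unfolding fps_conv_radius_def
  proof (rule conv_radius_geI_ex')
    fix r :: real assume "0 < r" "ereal r < 1"
    then show "summable (\<lambda>n. fps_nth F n * of_real r ^ n)"
      using assms[of "of_real r"] by (auto simp: F_def sums_iff)
  qed
  then have "0 < fps_conv_radius F" by (rule less_le_trans[rotated]) simp
  moreover have "\<forall>\<^sub>F z in nhds 0. z \<in> ball (0::complex) 1"
    by (rule eventually_nhds_in_open) auto
  then have "\<forall>\<^sub>F z in nhds 0. eval_fps F z = f z"
    by eventually_elim (use assms in \<open>auto simp: eval_fps_def F_def sums_iff\<close>)
  ultimately have "f has_fps_expansion F" by (simp add: has_fps_expansion_def)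
  from fps_nth_fps_expansion[OF this] show "coef f n = c n"
    by (simp add: F_def coef_def)
qed

lemma coef_summable:
  assumes "f holomorphic_on ball 0 1" "0 \<le> r" "r < 1"
  shows "summable (\<lambda>n. cmod (coef f n) * r ^ n)"
proof -
  obtain s where s: "r < s" "s < 1" using dense assms by blast
  have "summable (\<lambda>n. coef f n * of_real s ^ n)"
    using coef_sums[OF assms(1), of "of_real s"] s assms by (auto simp: sums_iff)
  then have "summable (\<lambda>n. norm (coef f n * of_real r ^ n))"
    by (rule powser_insidea) (use s assms in auto)
  then show ?thesis using assms by (simp add: norm_mult norm_power)
qed

lemma norm_le_majorant:
  assumes f: "f holomorphic_on ball 0 1" and t: "0 \<le> t" "t < 1"
  shows "ennreal (cmod (f (of_real t))) \<le> majorant (\<lambda>n. cmod (coef f n)) t"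
proof -
  have s: "(\<lambda>n. coef f n * of_real t ^ n) sums f (of_real t)"
    by (rule coef_sums[OF f]) (use t in simp)
  have sm: "summable (\<lambda>n. norm (coef f n * of_real t ^ n))"
    using coef_summable[OF f t] t by (simp add: norm_mult norm_power)
  have "cmod (f (of_real t)) \<le> (\<Sum>n. cmod (coef f n) * t ^ n)"
    using summable_norm[OF sm] s t by (simp add: sums_iff norm_mult norm_power)
  then have "ennreal (cmod (f (of_real t))) \<le> ennreal (\<Sum>n. cmod (coef f n) * t ^ n)" by (rule ennreal_leI)
  also have "\<dots> = majorant (\<lambda>n. cmod (coef f n)) t"
    unfolding majorant_def using t coef_summable[OF f t] by (intro suminf_ennreal2[symmetric]) auto
  finally show ?thesis .
qed

text \<open>The numbers \<open>L_k\<close> of the overview, integrated against \<open>lborel\<close>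
  with a cut-off so that Borel measurability is at hand.\<close>

definition pmoment :: "(complex \<Rightarrow> complex) \<Rightarrow> nat \<Rightarrow> complex" where
  "pmoment f k = (\<integral>t. indicator {0<..<1} t *\<^sub>R (of_real t ^ k * f (of_real t)) \<partial>lborel)"

lemma holomorphic_on_real_measurable:
  assumes "f holomorphic_on ball 0 1"
  shows "(\<lambda>t. indicator {0<..<1} t *\<^sub>R f (of_real t)) \<in> borel_measurable borel"
proof (rule borel_measurable_continuous_on_indicator)
  show "continuous_on {0<..<1::real} (\<lambda>t. f (of_real t))"
    by (rule continuous_on_compose2[OF holomorphic_on_imp_continuous_on[OF assms]])
      (auto intro!: continuous_intros)
qed auto

text \<open>The derivative of \<open>g\<close> is expanded at \<open>t * z\<close> and the series
  integrated termwise. Since \<open>t ^ k \<le> 1\<close>, the terms are dominated by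
  \<open>cmod (f t)\<close> times the summable sequence
  \<open>cmod (\<beta> k) * cmod z ^ k\<close>.\<close>

lemma hilbert_op_power_series:
  assumes f: "f holomorphic_on ball 0 1" and g: "g holomorphic_on ball 0 1"
    and fin: "(\<integral>\<^sup>+t. indicator {0<..<1} t * ennreal (cmod (f (of_real t))) \<partial>lborel) < top"
    and z: "cmod z < 1"
  shows "(\<lambda>k. coef (deriv g) k * pmoment f k * z ^ k) sums hilbert_op g f z"
proof -
  have dg: "deriv g holomorphic_on ball 0 1" by (rule holomorphic_deriv[OF g]) auto
  define \<beta> where "\<beta> = coef (deriv g)"
  note [measurable] = holomorphic_on_real_measurable[OF f]
  have int_f: "integrable lborel (\<lambda>t. indicator {0<..<1} t *\<^sub>R f (of_real t))"
  proof (rule integrableI_bounded)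
    have "(\<integral>\<^sup>+t. ennreal (norm (indicator {0<..<1} t *\<^sub>R f (of_real t))) \<partial>lborel)
       = (\<integral>\<^sup>+t. indicator {0<..<1} t * ennreal (cmod (f (of_real t))) \<partial>lborel)"
      by (intro nn_integral_cong) (auto split: split_indicator)
    then show "(\<integral>\<^sup>+t. ennreal (norm (indicator {0<..<1} t *\<^sub>R f (of_real t))) \<partial>lborel) < \<infinity>"
      using fin by simp
  qed simp
  define \<Psi> where "\<Psi> k t = (\<beta> k * z ^ k) * (of_real t ^ k * (indicator {0<..<1} t *\<^sub>R f (of_real t)))" for k and t :: real
  have bd: "norm (of_real t ^ k * (indicator {0<..<1} t *\<^sub>R f (of_real t))) \<le> norm (indicator {0<..<1} t *\<^sub>R f (of_real t))" for k and t :: real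
    using mult_right_mono[of "t ^ k" 1 "cmod (f (of_real t))"]
    by (auto simp: norm_mult norm_power power_le_one split: split_indicator)
  have int: "integrable lborel (\<lambda>t. of_real t ^ k * (indicator {0<..<1} t *\<^sub>R f (of_real t)))" for k
  proof (rule Bochner_Integration.integrable_bound[OF int_f])
    show "(\<lambda>t. of_real t ^ k * (indicator {0<..<1} t *\<^sub>R f (of_real t))) \<in> borel_measurable lborel"
      by measurable
  qed (use bd in auto)
  have \<Psi>_int: "integrable lborel (\<Psi> k)" for k
    unfolding \<Psi>_def by (intro integrable_mult_right int)
  have sumz: "summable (\<lambda>k. cmod (\<beta> k) * cmod z ^ k)"
    unfolding \<beta>_def by (rule coef_summable[OF dg]) (use z in auto)
  define I where "I = (\<integral>t. norm (indicator {0<..<1} t *\<^sub>R f (of_real t)) \<partial>lborel)"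
  have \<Psi>_norm: "norm (\<Psi> k t) \<le> cmod (\<beta> k) * cmod z ^ k * norm (indicator {0<..<1} t *\<^sub>R f (of_real t))" for k t
    unfolding \<Psi>_def norm_mult[of "\<beta> k * z ^ k"] norm_mult[of "\<beta> k"] norm_power[of z]
    by (intro mult_left_mono bd) simp
  have "(\<lambda>k. integral\<^sup>L lborel (\<Psi> k)) sums (\<integral>t. (\<Sum>k. \<Psi> k t) \<partial>lborel)"
  proof (rule sums_integral[OF \<Psi>_int])
    show "AE t in lborel. summable (\<lambda>k. norm (\<Psi> k t))"
    proof (rule AE_I2)
      fix t
      show "summable (\<lambda>k. norm (\<Psi> k t))"
        by (rule summable_comparison_test[OF _ summable_mult2[OF sumz]]) (use \<Psi>_norm in auto)
    qed
    show "summable (\<lambda>k. \<integral>t. norm (\<Psi> k t) \<partial>lborel)"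
    proof (rule summable_comparison_test[OF _ summable_mult2[OF sumz, of I]], intro exI allI impI)
      fix k
      have "(\<integral>t. norm (\<Psi> k t) \<partial>lborel) \<le> (\<integral>t. cmod (\<beta> k) * cmod z ^ k * norm (indicator {0<..<1} t *\<^sub>R f (of_real t)) \<partial>lborel)"
        by (intro integral_mono integrable_norm \<Psi>_int integrable_mult_right int_f \<Psi>_norm)
      then show "norm (\<integral>t. norm (\<Psi> k t) \<partial>lborel) \<le> cmod (\<beta> k) * cmod z ^ k * I"
        unfolding I_def by simp
    qed
  qed
  moreover have "integral\<^sup>L lborel (\<Psi> k) = coef (deriv g) k * pmoment f k * z ^ k" for k
  proof -
    have "pmoment f k = (\<integral>t. of_real t ^ k * (indicator {0<..<1} t *\<^sub>R f (of_real t)) \<partial>lborel)"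
      unfolding pmoment_def by (intro Bochner_Integration.integral_cong) auto
    moreover have "integral\<^sup>L lborel (\<Psi> k) = (\<beta> k * z ^ k) * (\<integral>t. of_real t ^ k * (indicator {0<..<1} t *\<^sub>R f (of_real t)) \<partial>lborel)"
      unfolding \<Psi>_def by (rule integral_mult_right_zero)
    ultimately show ?thesis by (simp only: \<beta>_def mult_ac)
  qed
  moreover have "(\<integral>t. (\<Sum>k. \<Psi> k t) \<partial>lborel) = hilbert_op g f z"
  proof -
    have eq: "(\<Sum>k. \<Psi> k t) = indicator {0<..<1} t *\<^sub>R (f (of_real t) * deriv g (of_real t * z))" for t
    proof (cases "t \<in> {0<..<1}")
      case True
      have "cmod (of_real t * z) < 1"
        using True mult_strict_mono[of t 1 "cmod z" 1] z by (simp add: norm_mult)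
      from sums_mult[OF coef_sums[OF dg this], of "f (of_real t)"]
      have "(\<lambda>k. \<Psi> k t) sums (f (of_real t) * deriv g (of_real t * z))"
        using True by (simp add: \<Psi>_def \<beta>_def power_mult_distrib mult_ac)
      then show ?thesis using True by (simp add: sums_iff)
    qed (simp add: \<Psi>_def)
    have [measurable]: "(\<lambda>t. \<Sum>k. \<Psi> k t) \<in> borel_measurable lborel"
      unfolding \<Psi>_def by measurable
    have "hilbert_op g f z = (\<integral>t. (\<Sum>k. \<Psi> k t) \<partial>lebesgue)"
      unfolding hilbert_op_def set_lebesgue_integral_def eq ..
    also have "\<dots> = (\<integral>t. (\<Sum>k. \<Psi> k t) \<partial>lborel)"
      by (rule integral_completion) measurable
    finally show ?thesis ..
  qed
  ultimately show ?thesis by simp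
qed

lemma pmoment_le:
  assumes f: "f holomorphic_on ball 0 1"
  shows "ennreal ((cmod (pmoment f k))\<^sup>2) \<le>
    (\<integral>\<^sup>+t. indicator {0<..<1} t * (ennreal (t ^ k) * majorant (\<lambda>n. cmod (coef f n)) t) \<partial>lborel)\<^sup>2"
proof -
  have "ennreal (cmod (pmoment f k)) \<le> (\<integral>\<^sup>+t. ennreal (norm (indicator {0<..<1} t *\<^sub>R (of_real t ^ k * f (of_real t)))) \<partial>lborel)"
  \<comment> \<open>If the integrand is not integrable, the integral is 0 by convention and the
    bound is trivial.\<close>
  proof (cases "integrable lborel (\<lambda>t. indicator {0<..<1} t *\<^sub>R (complex_of_real t ^ k * f (of_real t)))")
    case True
    then show ?thesis unfolding pmoment_def by (rule integral_norm_bound_ennreal)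
  qed (simp add: pmoment_def not_integrable_integral_eq)
  also have "\<dots> \<le> (\<integral>\<^sup>+t. indicator {0<..<1} t * (ennreal (t ^ k) * majorant (\<lambda>n. cmod (coef f n)) t) \<partial>lborel)"
  proof (rule nn_integral_mono)
    fix t :: real
    show "ennreal (norm (indicator {0<..<1} t *\<^sub>R (of_real t ^ k * f (of_real t))))
      \<le> indicator {0<..<1} t * (ennreal (t ^ k) * majorant (\<lambda>n. cmod (coef f n)) t)"
    proof (cases "0 < t \<and> t < 1")
      case True
      then show ?thesis
        using mult_left_mono[OF norm_le_majorant[OF f, of t], of "ennreal (t ^ k)"]
        by (simp add: norm_mult norm_power ennreal_mult'')
    qed auto
  qed
  finally have "ennreal (cmod (pmoment f k)) ^ 2 \<le> (\<integral>\<^sup>+t. indicator {0<..<1} t * (ennreal (t ^ k) * majorant (\<lambda>n. cmod (coef f n)) t) \<partial>lborel)\<^sup>2"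
    by (rule power_mono) simp
  then show ?thesis by (simp add: ennreal_power)
qed

section \<open>The Dirichlet space in terms of Taylor coefficients\<close>

context hilbert_weight
begin

lemma nn_integral_deriv_v:
  assumes f: "f holomorphic_on ball 0 1"
  shows "(\<integral>\<^sup>+z. indicator (ball 0 1) z * ennreal ((cmod (deriv f z))\<^sup>2 * v z) \<partial>lebesgue)
    = ennreal pi * (\<Sum>n. ennreal ((real (n + 1) * cmod (coef f (n + 1)))\<^sup>2) * moment w n)"
proof -
  have df: "deriv f holomorphic_on ball 0 1" by (rule holomorphic_deriv[OF f]) auto
  have "(\<integral>\<^sup>+z. indicator (ball 0 1) z * ennreal ((cmod (deriv f z))\<^sup>2 * v z) \<partial>lebesgue)
     = ennreal pi * (\<Sum>n. ennreal ((cmod (coef (deriv f) n))\<^sup>2) * moment w n)"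
    unfolding nn_integral_ball_v
    by (rule nn_integral_disc_power_series[OF df coef_sums[OF df]]) (use w_nonneg in auto)
  then show ?thesis by (simp only: coef_deriv norm_mult norm_of_nat)
qed

lemma energy_coef_eq:
  assumes f: "f holomorphic_on ball 0 1"
  shows "energy (\<lambda>n. cmod (coef f n)) = ennreal ((cmod (f 0))\<^sup>2) +
    ennreal (1 / pi) * (\<integral>\<^sup>+z. indicator (ball 0 1) z * ennreal ((cmod (deriv f z))\<^sup>2 * v z) \<partial>lebesgue)"
  unfolding energy_def nn_integral_deriv_v[OF f] mult.assoc[symmetric]
  by (simp add: coef_0 ennreal_mult''[symmetric])

lemma deriv_v_measurable:
  assumes f: "f holomorphic_on ball 0 1"
  shows "(\<lambda>z. indicator (ball 0 1) z *\<^sub>R ((cmod (deriv f z))\<^sup>2 * v z)) \<in> borel_measurable lebesgue"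
proof -
  have df: "deriv f holomorphic_on ball 0 1" by (rule holomorphic_deriv[OF f]) auto
  define D where "D z = indicator (ball 0 1) z *\<^sub>R deriv f z" for z
  have [measurable]: "D \<in> borel_measurable borel"
    unfolding D_def using holomorphic_on_imp_continuous_on[OF df]
    by (intro borel_measurable_continuous_on_indicator) auto
  have "(\<lambda>z. (cmod (D z))\<^sup>2) \<in> borel_measurable lborel" by measurable
  then have 1: "(\<lambda>z. (cmod (D z))\<^sup>2) \<in> borel_measurable lebesgue"
    by (rule measurable_completion)
  have 2: "(\<lambda>z. indicator (ball 0 1) z *\<^sub>R v z) \<in> borel_measurable lebesgue"
    using v_integrable unfolding set_integrable_def by (rule borel_measurable_integrable)
  have "(\<lambda>z. (cmod (D z))\<^sup>2 * (indicator (ball 0 1) z *\<^sub>R v z)) \<in> borel_measurable lebesgue"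
    by (rule borel_measurable_times[OF 1 2])
  also have "(\<lambda>z. (cmod (D z))\<^sup>2 * (indicator (ball 0 1) z *\<^sub>R v z))
      = (\<lambda>z. indicator (ball 0 1) z *\<^sub>R ((cmod (deriv f z))\<^sup>2 * v z))"
    by (auto simp: D_def fun_eq_iff split: split_indicator)
  finally show ?thesis .
qed

lemma deriv_v_nonneg: "0 \<le> indicator (ball 0 1) z *\<^sub>R ((cmod (deriv f z))\<^sup>2 * v z)"
  using v_pos[of z] by (auto split: split_indicator)

lemma deriv_v_ennreal:
  "ennreal (indicator (ball 0 1) z *\<^sub>R ((cmod (deriv f z))\<^sup>2 * v z)) = indicator (ball 0 1) z * ennreal ((cmod (deriv f z))\<^sup>2 * v z)"
  by (auto split: split_indicator)

lemma dirichlet_space_iff: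
  "f \<in> dirichlet_space v \<longleftrightarrow> f holomorphic_on ball 0 1 \<and> energy (\<lambda>n. cmod (coef f n)) < top"
proof (cases "f holomorphic_on ball 0 1")
  case True
  have "set_integrable lebesgue (ball 0 1) (\<lambda>z. (cmod (deriv f z))\<^sup>2 * v z) \<longleftrightarrow>
    (\<integral>\<^sup>+z. indicator (ball 0 1) z * ennreal ((cmod (deriv f z))\<^sup>2 * v z) \<partial>lebesgue) < top"
    unfolding set_integrable_def integrable_iff_bounded
    using deriv_v_measurable[OF True] deriv_v_nonneg
    by (simp add: deriv_v_ennreal abs_of_nonneg del: scaleR_conv_of_real real_scaleR_def)
  then show ?thesis
    using True unfolding dirichlet_space_def energy_coef_eq[OF True]
    by (auto simp: ennreal_mult_less_top)
qed (simp add: dirichlet_space_def)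

lemma dirichlet_norm_power2:
  assumes "f \<in> dirichlet_space v"
  shows "ennreal ((dirichlet_norm v f)\<^sup>2) = energy (\<lambda>n. cmod (coef f n))"
proof -
  have f: "f holomorphic_on ball 0 1" using assms by (simp add: dirichlet_space_def)
  define J where "J = (LINT z:ball 0 1|lebesgue. (cmod (deriv f z))\<^sup>2 * v z)"
  have J0: "0 \<le> J" unfolding J_def set_lebesgue_integral_def by (intro Bochner_Integration.integral_nonneg deriv_v_nonneg)
  have "(\<integral>\<^sup>+z. indicator (ball 0 1) z * ennreal ((cmod (deriv f z))\<^sup>2 * v z) \<partial>lebesgue) = ennreal J"
    unfolding J_def set_lebesgue_integral_def deriv_v_ennreal[symmetric]
    using assms by (intro nn_integral_eq_integral AE_I2 deriv_v_nonneg) (auto simp: dirichlet_space_def set_integrable_def)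
  then have "energy (\<lambda>n. cmod (coef f n)) = ennreal ((cmod (f 0))\<^sup>2 + 1 / pi * J)"
    unfolding energy_coef_eq[OF f] using J0 by (simp only: ennreal_mult''[symmetric]) (simp add: ennreal_plus[symmetric] del: ennreal_plus)
  also have "(cmod (f 0))\<^sup>2 + 1 / pi * J = (dirichlet_norm v f)\<^sup>2"
    unfolding dirichlet_norm_def J_def[symmetric] using J0 by simp
  finally show ?thesis ..
qed

lemma dirichlet_norm_nonneg: "0 \<le> dirichlet_norm v f"
  unfolding dirichlet_norm_def set_lebesgue_integral_def
  by (intro real_sqrt_ge_zero add_nonneg_nonneg mult_nonneg_nonneg Bochner_Integration.integral_nonneg deriv_v_nonneg) auto

text \<open>Absolute convergence on the radius, which guarantees that \<open>hilbert_op\<close> is a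
  genuine integral on the Dirichlet space and not the default value 0.\<close>

lemma majorant_integral_finite:
  assumes "f \<in> dirichlet_space v"
  shows "(\<integral>\<^sup>+t. indicator {0<..<1} t * ennreal (cmod (f (of_real t))) \<partial>lborel) < top"
proof -
  obtain C where C: "0 \<le> C"
    "\<forall>a. (\<forall>n. 0 \<le> a n) \<longrightarrow> (\<integral>\<^sup>+t. indicator {0<..<1} t * majorant a t \<partial>lborel)\<^sup>2 \<le> ennreal C * energy a"
    by (rule majorant_energy_bounds)
  have f: "f holomorphic_on ball 0 1" "energy (\<lambda>n. cmod (coef f n)) < top"
    using assms by (auto simp: dirichlet_space_iff)
  let ?M = "\<integral>\<^sup>+t. indicator {0<..<1} t * majorant (\<lambda>n. cmod (coef f n)) t \<partial>lborel"
  have "?M\<^sup>2 < top"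
    using C(2)[rule_format, of "\<lambda>n. cmod (coef f n)"] f(2)
    by (auto intro: le_less_trans simp: ennreal_mult_less_top)
  then have "?M < top" by (auto simp: power2_eq_square ennreal_mult_less_top)
  moreover have "(\<integral>\<^sup>+t. indicator {0<..<1} t * ennreal (cmod (f (of_real t))) \<partial>lborel) \<le> ?M"
    using norm_le_majorant[OF f(1)] by (intro nn_integral_mono) (auto split: split_indicator)
  ultimately show ?thesis by (rule le_less_trans[rotated])
qed

lemma hilbert_op_coef:
  assumes "f \<in> dirichlet_space v" "g holomorphic_on ball 0 1"
  shows "hilbert_op g f holomorphic_on ball 0 1"
    and "coef (hilbert_op g f) k = coef (deriv g) k * pmoment f k"
proof -
  have f: "f holomorphic_on ball 0 1" using assms(1) by (simp add: dirichlet_space_def)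
  note s = hilbert_op_power_series[OF f assms(2) majorant_integral_finite[OF assms(1)]]
  show "hilbert_op g f holomorphic_on ball 0 1" by (rule power_series_ball(1)[OF s])
  show "coef (hilbert_op g f) k = coef (deriv g) k * pmoment f k" by (rule power_series_ball(2)[OF s])
qed

end

section \<open>Compactness\<close>

lemma M2_power2:
  assumes f: "f holomorphic_on ball 0 1" and r: "0 \<le> r" "r < 1"
  shows "summable (\<lambda>n. (cmod (coef f n))\<^sup>2 * r ^ (2 * n))"
    and "M2 r f = sqrt (\<Sum>n. (cmod (coef f n))\<^sup>2 * r ^ (2 * n))"
proof -
  have z: "cmod (of_real r) < 1" using r by simp
  note p = power_series_parseval[OF coef_sums[OF f] z]
  have n: "cmod (of_real r) = r" using r by simp
  show "summable (\<lambda>n. (cmod (coef f n))\<^sup>2 * r ^ (2 * n))" using p(1) unfolding n .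
  define S where "S = (\<Sum>n. (cmod (coef f n))\<^sup>2 * r ^ (2 * n))"
  have hi: "((\<lambda>\<theta>. (cmod (f (of_real r * exp (\<i> * of_real \<theta>))))\<^sup>2) has_integral 2 * pi * S) {-pi..pi}"
    using p(2) unfolding n S_def by (simp add: cis_conv_exp mult.commute)
  then have "(\<lambda>\<theta>. (cmod (f (of_real r * exp (\<i> * of_real \<theta>))))\<^sup>2) absolutely_integrable_on {-pi..pi}"
    by (intro nonnegative_absolutely_integrable_1) auto
  then have "(LINT \<theta>:{-pi..pi}|lebesgue. (cmod (f (of_real r * exp (\<i> * of_real \<theta>))))\<^sup>2) = 2 * pi * S"
    using set_lebesgue_integral_eq_integral(2) integral_unique[OF hi] by metis
  then show "M2 r f = sqrt S" unfolding M2_def by simp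
qed

text \<open>Squaring turns the condition into one that is linear in the numbers
  \<open>|\<beta>_k|^2\<close>, the form in which both implications use it.\<close>

lemma b_2_infinity_iff:
  "g \<in> b_2_infinity \<longleftrightarrow> g holomorphic_on ball 0 1 \<and>
     ((\<lambda>r. (\<Sum>n. (cmod (coef (deriv g) n))\<^sup>2 * r ^ (2 * n)) * (1 - r)) \<longlongrightarrow> 0) (at_left 1)"
proof (cases "g holomorphic_on ball 0 1")
  case True
  then have dg: "deriv g holomorphic_on ball 0 1" by (rule holomorphic_deriv) auto
  define S where "S r = (\<Sum>n. (cmod (coef (deriv g) n))\<^sup>2 * r ^ (2 * n)) * (1 - r)" for r :: real
  have ev: "\<forall>\<^sub>F r in at_left 1. r \<in> {0<..<1::real}"
    by (rule eventually_at_leftI[of 0]) auto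
  have eq: "\<forall>\<^sub>F r in at_left 1. M2 r (deriv g) * (1 - r) powr (1 / 2) = sqrt (S r)"
    using ev
  proof eventually_elim
    case (elim r)
    then show ?case
      by (subst M2_power2(2)[OF dg]) (auto simp: S_def powr_half_sqrt real_sqrt_mult)
  qed
  have nonneg: "\<forall>\<^sub>F r in at_left 1. (sqrt (S r))\<^sup>2 = S r"
    using ev
  proof eventually_elim
    case (elim r)
    then have "0 \<le> (\<Sum>n. (cmod (coef (deriv g) n))\<^sup>2 * r ^ (2 * n))"
      by (intro suminf_nonneg M2_power2(1)[OF dg]) auto
    then show ?case using elim by (simp add: S_def)
  qed
  have "((\<lambda>r. sqrt (S r)) \<longlongrightarrow> 0) (at_left 1) \<longleftrightarrow> (S \<longlongrightarrow> 0) (at_left 1)"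
  proof
    assume "((\<lambda>r. sqrt (S r)) \<longlongrightarrow> 0) (at_left 1)"
    from tendsto_power[OF this, of 2] show "(S \<longlongrightarrow> 0) (at_left 1)"
      using tendsto_cong[OF nonneg] by simp
  next
    assume "(S \<longlongrightarrow> 0) (at_left 1)"
    from tendsto_real_sqrt[OF this] show "((\<lambda>r. sqrt (S r)) \<longlongrightarrow> 0) (at_left 1)" by simp
  qed
  then show ?thesis
    using True tendsto_cong[OF eq, of 0] by (simp add: b_2_infinity_def S_def[abs_def])
qed (simp add: b_2_infinity_def)

section \<open>Tails of coefficient series and convergence in weighted sequence spaces\<close>

lemma suminf_from:
  fixes f :: "nat \<Rightarrow> ennreal"
  shows "(\<Sum>k. if K \<le> k then f k else 0) = (\<Sum>i. f (i + K))"
  using suminf_offset[of "\<lambda>k. if K \<le> k then f k else 0" K] by simp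

text \<open>With \<open>x = r ^ 4\<close> the power \<open>x ^ (k - 1)\<close> splits into
  \<open>r ^ (2 * k)\<close>, which is kept for the mean value of \<open>g'\<close>, and
  \<open>r ^ (2 * k - 4)\<close>, which absorbs \<open>k ^ 3\<close>. The constant is
  \<open>(3 * 2) ^ 3\<close>: 3 is the exponent, and \<open>k \<le> 2 * (2 * k - 3)\<close> for
  \<open>k \<ge> 2\<close>.\<close>

lemma cube_power_le:
  fixes r :: real
  assumes r: "0 \<le> r" "r < 1" and k: "k \<ge> 2"
  shows "real k ^ 3 * (r ^ 4) ^ (k - 1) \<le> 216 / (1 - r) ^ 3 * r ^ (2 * k)"
proof -
  define n where "n = 2 * k - 4"
  have e: "(r ^ 4) ^ (k - 1) = r ^ n * r ^ (2 * k)"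
  proof -
    have "4 * (k - 1) = n + 2 * k" using k by (simp add: n_def)
    then show ?thesis by (simp only: power_mult[symmetric] power_add[symmetric])
  qed
  have "r ^ n * (1 - r) ^ 3 \<le> (real 3 / (real n + 1)) ^ 3"
    using r by (intro power_mult_one_minus_power_le) auto
  then have "real k ^ 3 * (r ^ n * (1 - r) ^ 3) \<le> real k ^ 3 * (3 / (real n + 1)) ^ 3"
    by (intro mult_left_mono) auto
  also have "\<dots> = (3 * (real k / (real n + 1))) ^ 3"
    by (simp add: power_mult_distrib power_divide)
  also have "\<dots> \<le> (3 * 2) ^ 3"
  proof (intro power_mono mult_left_mono)
    have "real k \<le> 2 * (real n + 1)" using k by (simp add: n_def of_nat_diff)
    then show "real k / (real n + 1) \<le> 2" by (simp add: field_simps)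
  qed auto
  finally have "real k ^ 3 * r ^ n * (1 - r) ^ 3 \<le> 216" by (simp add: mult.assoc)
  then have "real k ^ 3 * r ^ n \<le> 216 / (1 - r) ^ 3"
    using r by (simp add: field_simps)
  then have "real k ^ 3 * r ^ n * r ^ (2 * k) \<le> 216 / (1 - r) ^ 3 * r ^ (2 * k)"
    using r by (intro mult_right_mono) auto
  then show ?thesis unfolding e by (simp add: mult.assoc)
qed

text \<open>The point is that one \<open>K\<close> serves all \<open>x\<close>. For
  \<open>x > r0 ^ 4\<close> the whole series is small relative to \<open>(1 - x)^(-4)\<close> by the
  limit hypothesis. For \<open>x \<le> r0 ^ 4\<close> the terms are dominated by a single convergent
  series, whose tail is cut at \<open>K\<close>, and \<open>(1 - x)^(-4)\<close> is at least
  1.\<close>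

lemma weighted_tail_small:
  fixes b :: "nat \<Rightarrow> real"
  assumes b: "\<And>n. 0 \<le> b n" and summ: "\<And>r. 0 \<le> r \<Longrightarrow> r < 1 \<Longrightarrow> summable (\<lambda>n. b n * r ^ (2 * n))"
    and lim: "((\<lambda>r. (\<Sum>n. b n * r ^ (2 * n)) * (1 - r)) \<longlongrightarrow> 0) (at_left 1)" and \<epsilon>: "0 < \<epsilon>"
  shows "\<exists>K\<ge>2. \<forall>x. 0 < x \<and> x < 1 \<longrightarrow>
    (\<Sum>k. if K \<le> k then ennreal (real k ^ 3 * b k * x ^ (k - 1)) else 0) \<le> ennreal (\<epsilon> / (1 - x) ^ 4)"
proof -
  define S where "S r = (\<Sum>n. b n * r ^ (2 * n))" for r
  \<comment> \<open>The factor 216 is from \<open>cube_power_le\<close>, and 256 is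
    \<open>4 ^ 4\<close> from \<open>1 - x \<le> 4 * (1 - r)\<close> with
    \<open>x = r ^ 4\<close>.\<close>
  define \<epsilon>' where "\<epsilon>' = \<epsilon> / (216 * 256)"
  have "\<epsilon>' > 0" using \<epsilon> by (simp add: \<epsilon>'_def)
  then have "\<forall>\<^sub>F r in at_left 1. S r * (1 - r) < \<epsilon>'"
    using order_tendstoD(2)[OF lim] by (simp add: S_def)
  then obtain r1 where r1: "r1 < 1" "\<And>r. r1 < r \<Longrightarrow> r < 1 \<Longrightarrow> S r * (1 - r) < \<epsilon>'"
    by (auto simp: eventually_at_left_field)
  define r0 where "r0 = (max r1 0 + 1) / 2"
  have r0: "r1 < r0" "0 < r0" "r0 < 1" using r1(1) by (auto simp: r0_def max_def)
  define f where "f k = real k ^ 3 * b k * (r0 ^ 4) ^ (k - 1)" for k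
  have f0: "0 \<le> f k" for k using b r0 by (simp add: f_def)
  have fle: "f k \<le> 216 / (1 - r0) ^ 3 * (b k * r0 ^ (2 * k))" if "k \<ge> 2" for k
    using mult_left_mono[OF cube_power_le[of r0 k] b[of k]] r0 that by (simp add: f_def mult_ac)
  have "summable f"
  proof (rule summable_comparison_test[OF _ summable_mult[OF summ[of r0], of "216 / (1 - r0) ^ 3"]])
    show "\<exists>N. \<forall>n\<ge>N. norm (f n) \<le> 216 / (1 - r0) ^ 3 * (b n * r0 ^ (2 * n))"
      using fle f0 by (intro exI[of _ 2]) auto
  qed (use r0 in auto)
  then obtain K0 where K0: "\<And>n. n \<ge> K0 \<Longrightarrow> norm (\<Sum>i. f (i + n)) < \<epsilon>"
    using suminf_exist_split[OF \<epsilon>, of f] by blast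
  define K where "K = max K0 2"
  show ?thesis
  proof (intro exI[of _ K] conjI allI impI)
    show "2 \<le> K" by (simp add: K_def)
    fix x :: real assume "0 < x \<and> x < 1"
    then have x: "0 < x" "x < 1" by auto
    show "(\<Sum>k. if K \<le> k then ennreal (real k ^ 3 * b k * x ^ (k - 1)) else 0) \<le> ennreal (\<epsilon> / (1 - x) ^ 4)"
    proof (cases "x \<le> r0 ^ 4")
      case True
      have "(\<Sum>k. if K \<le> k then ennreal (real k ^ 3 * b k * x ^ (k - 1)) else 0)
        \<le> (\<Sum>k. if K \<le> k then ennreal (f k) else 0)"
        using b x True unfolding f_def
        by (intro suminf_le) (auto intro!: ennreal_leI mult_left_mono power_mono)
      also have "\<dots> = (\<Sum>i. ennreal (f (i + K)))" by (rule suminf_from)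
      also have "\<dots> = ennreal (\<Sum>i. f (i + K))"
        using f0 \<open>summable f\<close> by (intro suminf_ennreal2 summable_ignore_initial_segment) auto
      also have "\<dots> \<le> ennreal (\<epsilon> / (1 - x) ^ 4)"
      proof (rule ennreal_leI)
        have "(\<Sum>i. f (i + K)) \<le> \<epsilon> / 1" using K0[of K] by (simp add: K_def)
        also have "\<dots> \<le> \<epsilon> / (1 - x) ^ 4"
          using x \<epsilon> by (intro divide_left_mono power_le_one) auto
        finally show "(\<Sum>i. f (i + K)) \<le> \<epsilon> / (1 - x) ^ 4" .
      qed
      finally show ?thesis .
    next
      case False
      define r where "r = root 4 x"
      have r: "0 < r" "r < 1" "r ^ 4 = x" using x by (auto simp: r_def)
      have "r0 < r" using False r r0 power_less_imp_less_base[of r0 4 r] by auto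
      then have Sr: "S r * (1 - r) < \<epsilon>'" using r1(2)[of r] r r0 by auto
      have "(\<Sum>k. if K \<le> k then ennreal (real k ^ 3 * b k * x ^ (k - 1)) else 0)
         \<le> (\<Sum>k. ennreal (216 / (1 - r) ^ 3 * (b k * r ^ (2 * k))))"
      proof (rule suminf_le)
        fix k
        show "(if K \<le> k then ennreal (real k ^ 3 * b k * x ^ (k - 1)) else 0) \<le> ennreal (216 / (1 - r) ^ 3 * (b k * r ^ (2 * k)))"
          using mult_left_mono[OF cube_power_le[of r k] b[of k]] r
          by (auto simp: K_def mult_ac intro!: ennreal_leI)
      qed auto
      also have "\<dots> = ennreal (\<Sum>k. 216 / (1 - r) ^ 3 * (b k * r ^ (2 * k)))"
        using b r summ[of r] by (intro suminf_ennreal2 summable_mult) auto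
      also have "(\<Sum>k. 216 / (1 - r) ^ 3 * (b k * r ^ (2 * k))) = 216 / (1 - r) ^ 3 * S r"
        unfolding S_def using r by (intro suminf_mult summ) auto
      also have "\<dots> = 216 * (S r * (1 - r)) / (1 - r) ^ 4"
        using r by (simp add: power4_eq_xxxx power3_eq_cube)
      also have "ennreal \<dots> \<le> ennreal (\<epsilon> / (1 - x) ^ 4)"
      proof (rule ennreal_leI)
        have "1 - x = (1 - r) * (1 + r + r\<^sup>2 + r ^ 3)"
          unfolding r(3)[symmetric] by (simp add: algebra_simps power2_eq_square power3_eq_cube power4_eq_xxxx)
        also have "\<dots> \<le> (1 - r) * (1 + 1 + 1 + 1)"
          using r by (intro mult_left_mono add_mono power_le_one) auto
        finally have "(1 - x) ^ 4 \<le> (4 * (1 - r)) ^ 4"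
          using x by (intro power_mono) auto
        also have "(4 * (1 - r)) ^ 4 = 256 * (1 - r) ^ 4"
          unfolding power_mult_distrib by simp
        finally have "\<epsilon> / (256 * (1 - r) ^ 4) \<le> \<epsilon> / (1 - x) ^ 4"
          by (rule divide_left_mono) (use x r \<epsilon> in auto)
        moreover have "216 * (S r * (1 - r)) / (1 - r) ^ 4 \<le> 216 * \<epsilon>' / (1 - r) ^ 4"
          using Sr r by (intro divide_right_mono) auto
        ultimately show "216 * (S r * (1 - r)) / (1 - r) ^ 4 \<le> \<epsilon> / (1 - x) ^ 4"
          by (simp add: \<epsilon>'_def field_simps)
      qed
      finally show ?thesis .
    qed
  qed
qed

lemma ennreal_weighted_norm_le:
  fixes a b :: complex
  assumes "0 \<le> c"
  shows "ennreal (c * (cmod (a - b))\<^sup>2) \<le> 2 * ennreal (c * (cmod a)\<^sup>2) + 2 * ennreal (c * (cmod b)\<^sup>2)"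
proof -
  have "(cmod (a - b))\<^sup>2 \<le> (cmod a + cmod b)\<^sup>2"
    by (intro power_mono norm_triangle_ineq4) simp
  also have "\<dots> \<le> 2 * (cmod a)\<^sup>2 + 2 * (cmod b)\<^sup>2"
    using sum_squares_bound[of "cmod a" "cmod b"] by (simp add: power2_sum)
  finally have "c * (cmod (a - b))\<^sup>2 \<le> c * (2 * (cmod a)\<^sup>2 + 2 * (cmod b)\<^sup>2)"
    using assms by (rule mult_left_mono)
  then have "ennreal (c * (cmod (a - b))\<^sup>2) \<le> ennreal (2 * (c * (cmod a)\<^sup>2) + 2 * (c * (cmod b)\<^sup>2))"
    by (intro ennreal_leI) (simp add: algebra_simps)
  also have "\<dots> = 2 * ennreal (c * (cmod a)\<^sup>2) + 2 * ennreal (c * (cmod b)\<^sup>2)"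
    using assms by (subst ennreal_plus) (auto simp: numeral_mult_ennreal)
  finally show ?thesis .
qed

text \<open>Coefficientwise convergence takes care of finitely many indices and the uniformly small
  tails of the others. Applied to a constant sequence, the first conclusion also shows that the
  operator maps into the space.\<close>

lemma coefficient_compactness:
  fixes c :: "nat \<Rightarrow> real" and x :: "nat \<Rightarrow> nat \<Rightarrow> complex"
  assumes c: "\<And>k. 0 \<le> c k" and lim: "\<And>k. (\<lambda>n. x n k) \<longlonglongrightarrow> l k"
    and tail: "\<And>\<epsilon>. 0 < \<epsilon> \<Longrightarrow> \<exists>K. \<forall>n. (\<Sum>k. if K \<le> k then ennreal (c k * (cmod (x n k))\<^sup>2) else 0) \<le> ennreal \<epsilon>"
  shows "(\<Sum>k. ennreal (c k * (cmod (l k))\<^sup>2)) < top"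
    and "(\<lambda>n. \<Sum>k. ennreal (c k * (cmod (x n k - l k))\<^sup>2)) \<longlonglongrightarrow> 0"
proof -
  have split: "(\<Sum>k. ennreal (h k)) = (\<Sum>k. if K \<le> k then ennreal (h k) else 0) + ennreal (\<Sum>k<K. h k)"
    if "\<And>k. 0 \<le> h k" for h K
    unfolding suminf_from sum_ennreal[OF that, symmetric] by (rule suminf_offset) simp
  have fs: "(\<Sum>k<m. if K \<le> k then ennreal (h k) else 0) = ennreal (\<Sum>k<m. if K \<le> k then h k else 0)"
    if "\<And>k. 0 \<le> h k" for h :: "nat \<Rightarrow> real" and m K
  proof -
    have "(\<Sum>k<m. if K \<le> k then ennreal (h k) else 0) = (\<Sum>k<m. ennreal (if K \<le> k then h k else 0))"
      by (rule sum.cong) auto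
    also have "\<dots> = ennreal (\<Sum>k<m. if K \<le> k then h k else 0)"
      by (rule sum_ennreal) (use that in auto)
    finally show ?thesis .
  qed
  \<comment> \<open>The limit inherits the tail bound: every finite section converges, and the
    bounds on the sections pass to the series.\<close>
  have ltail: "(\<Sum>k. if K \<le> k then ennreal (c k * (cmod (l k))\<^sup>2) else 0) \<le> ennreal \<epsilon>"
    if K: "\<forall>n. (\<Sum>k. if K \<le> k then ennreal (c k * (cmod (x n k))\<^sup>2) else 0) \<le> ennreal \<epsilon>" and \<epsilon>: "0 < \<epsilon>" for K \<epsilon>
  proof (rule suminf_le_const)
    fix m
    have "(\<Sum>k<m. if K \<le> k then c k * (cmod (x n k))\<^sup>2 else 0) \<le> \<epsilon>" for n
    proof -
      have "ennreal (\<Sum>k<m. if K \<le> k then c k * (cmod (x n k))\<^sup>2 else 0)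
          = (\<Sum>k<m. if K \<le> k then ennreal (c k * (cmod (x n k))\<^sup>2) else 0)"
        by (rule fs[symmetric]) (use c in simp)
      also have "\<dots> \<le> (\<Sum>k. if K \<le> k then ennreal (c k * (cmod (x n k))\<^sup>2) else 0)"
        by (rule sum_le_suminf) auto
      also have "\<dots> \<le> ennreal \<epsilon>" using K by blast
      finally show ?thesis using \<epsilon> by simp
    qed
    moreover have "(\<lambda>n. \<Sum>k<m. if K \<le> k then c k * (cmod (x n k))\<^sup>2 else 0) \<longlonglongrightarrow> (\<Sum>k<m. if K \<le> k then c k * (cmod (l k))\<^sup>2 else 0)"
      by (intro tendsto_sum) (auto intro!: tendsto_intros lim)
    ultimately have "(\<Sum>k<m. if K \<le> k then c k * (cmod (l k))\<^sup>2 else 0) \<le> \<epsilon>"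
      by (intro LIMSEQ_le_const2) auto
    then have "ennreal (\<Sum>k<m. if K \<le> k then c k * (cmod (l k))\<^sup>2 else 0) \<le> ennreal \<epsilon>" by (rule ennreal_leI)
    also have "ennreal (\<Sum>k<m. if K \<le> k then c k * (cmod (l k))\<^sup>2 else 0) = (\<Sum>k<m. if K \<le> k then ennreal (c k * (cmod (l k))\<^sup>2) else 0)"
      by (rule fs[symmetric]) (use c in simp)
    finally show "(\<Sum>k<m. if K \<le> k then ennreal (c k * (cmod (l k))\<^sup>2) else 0) \<le> ennreal \<epsilon>" .
  qed auto
  obtain K1 where "\<forall>n. (\<Sum>k. if K1 \<le> k then ennreal (c k * (cmod (x n k))\<^sup>2) else 0) \<le> ennreal 1"
    using tail[of 1] by auto
  from ltail[OF this] have l1: "(\<Sum>k. if K1 \<le> k then ennreal (c k * (cmod (l k))\<^sup>2) else 0) \<le> ennreal 1" by simp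
  show "(\<Sum>k. ennreal (c k * (cmod (l k))\<^sup>2)) < top"
    using c le_less_trans[OF l1 ennreal_less_top] by (subst split[of _ K1]) auto
  show "(\<lambda>n. \<Sum>k. ennreal (c k * (cmod (x n k - l k))\<^sup>2)) \<longlonglongrightarrow> 0"
  proof (rule order_tendstoI)
    fix e :: ennreal assume "0 < e"
    obtain e' where e': "0 < e'" "ennreal e' < e"
    proof (cases e)
      case (real r)
      then show ?thesis using \<open>0 < e\<close> that[of "r / 2"] by (simp add: ennreal_less_iff)
    qed (use that[of 1] in simp)
    \<comment> \<open>The tails contribute at most \<open>2 * \<epsilon> + 2 * \<epsilon>\<close>
      and the initial section \<open>\<epsilon>\<close>, so the total stays below
      \<open>e'\<close>.\<close>
    define \<epsilon> where "\<epsilon> = e' / 8"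
    have \<epsilon>: "0 < \<epsilon>" using e' by (simp add: \<epsilon>_def)
    obtain K where K: "\<forall>n. (\<Sum>k. if K \<le> k then ennreal (c k * (cmod (x n k))\<^sup>2) else 0) \<le> ennreal \<epsilon>"
      using tail[OF \<epsilon>] by auto
    have "(\<lambda>n. \<Sum>k<K. c k * (cmod (x n k - l k))\<^sup>2) \<longlonglongrightarrow> (\<Sum>k<K. c k * (cmod (l k - l k))\<^sup>2)"
      by (intro tendsto_intros lim)
    then have "\<forall>\<^sub>F n in sequentially. (\<Sum>k<K. c k * (cmod (x n k - l k))\<^sup>2) < \<epsilon>"
      using \<epsilon> by (intro order_tendstoD(2)) auto
    then show "\<forall>\<^sub>F n in sequentially. (\<Sum>k. ennreal (c k * (cmod (x n k - l k))\<^sup>2)) < e"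
    proof eventually_elim
      case (elim n)
      have "(\<Sum>k. if K \<le> k then ennreal (c k * (cmod (x n k - l k))\<^sup>2) else 0)
        \<le> (\<Sum>k. 2 * (if K \<le> k then ennreal (c k * (cmod (x n k))\<^sup>2) else 0) + 2 * (if K \<le> k then ennreal (c k * (cmod (l k))\<^sup>2) else 0))"
      proof (rule suminf_le)
        fix k
        show "(if K \<le> k then ennreal (c k * (cmod (x n k - l k))\<^sup>2) else 0) \<le>
          2 * (if K \<le> k then ennreal (c k * (cmod (x n k))\<^sup>2) else 0) + 2 * (if K \<le> k then ennreal (c k * (cmod (l k))\<^sup>2) else 0)"
          using ennreal_weighted_norm_le[OF c, of k "x n k" "l k"] by simp
      qed auto
      also have "\<dots> = 2 * (\<Sum>k. if K \<le> k then ennreal (c k * (cmod (x n k))\<^sup>2) else 0) + 2 * (\<Sum>k. if K \<le> k then ennreal (c k * (cmod (l k))\<^sup>2) else 0)"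
        by (subst suminf_add[symmetric]) (auto simp only: ennreal_suminf_cmult summableI)
      also have "\<dots> \<le> 2 * ennreal \<epsilon> + 2 * ennreal \<epsilon>"
        using K ltail[OF K \<epsilon>] by (intro add_mono mult_left_mono) auto
      also have "\<dots> = ennreal (4 * \<epsilon>)"
        using \<epsilon> by (simp add: numeral_mult_ennreal ennreal_plus[symmetric] del: ennreal_plus)
      finally have "(\<Sum>k. ennreal (c k * (cmod (x n k - l k))\<^sup>2)) \<le> ennreal (4 * \<epsilon>) + ennreal \<epsilon>"
        using elim c by (subst split[of _ K]) (auto intro!: add_mono ennreal_leI)
      also have "\<dots> \<le> ennreal e'"
        using \<epsilon> by (subst ennreal_plus[symmetric]) (auto simp: \<epsilon>_def intro!: ennreal_leI)
      finally show ?case using e'(2) by (rule le_less_trans)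
    qed
  qed simp
qed

text \<open>Abel summation writes both sides as combinations of partial sums with nonnegative
  weights, because the powers of \<open>\<rho>\<close> decrease; comparing partial sums is then
  enough.\<close>

lemma summation_by_parts_le:
  fixes b b' :: "nat \<Rightarrow> real"
  assumes le: "\<And>N. (\<Sum>k\<le>N. b k) \<le> (\<Sum>k\<le>N. b' k)" and \<rho>: "0 \<le> \<rho>" "\<rho> \<le> 1"
  shows "(\<Sum>k\<le>M. b k * \<rho> ^ k) \<le> (\<Sum>k\<le>M. b' k * \<rho> ^ k)"
proof -
  have eq: "(\<Sum>k\<le>M. c k * \<rho> ^ k) = (\<Sum>k\<le>M. c k) * \<rho> ^ M + (1 - \<rho>) * (\<Sum>N<M. (\<Sum>k\<le>N. c k) * \<rho> ^ N)" for c :: "nat \<Rightarrow> real"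
    by (induction M) (simp_all add: algebra_simps)
  show ?thesis
    unfolding eq using \<rho>
    by (intro add_mono mult_right_mono[OF le] mult_left_mono[OF sum_mono[OF mult_right_mono[OF le]]]) auto
qed

text \<open>Repeated halving adds up the block bounds as a geometric series, so the partial sums are
  at most \<open>D + 2 * \<epsilon> * N\<close> with a constant \<open>D\<close> for the finitely
  many early blocks. Abel summation turns this into a bound for the power series, and the factor
  \<open>1 - r\<close> removes \<open>D\<close> in the limit.\<close>

lemma block_sums_imp_radial_limit:
  fixes b :: "nat \<Rightarrow> real"
  assumes b: "\<And>k. 0 \<le> b k"
    and blocks: "\<And>\<epsilon>. 0 < \<epsilon> \<Longrightarrow> \<forall>\<^sub>F N in sequentially. (\<Sum>k\<in>{(N + 1) div 2..N}. b k) \<le> \<epsilon> * real N"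
    and summ: "\<And>r. 0 \<le> r \<Longrightarrow> r < 1 \<Longrightarrow> summable (\<lambda>n. b n * r ^ (2 * n))"
  shows "((\<lambda>r. (\<Sum>n. b n * r ^ (2 * n)) * (1 - r)) \<longlongrightarrow> 0) (at_left 1)"
proof (rule order_tendstoI)
  have ev: "\<forall>\<^sub>F r in at_left 1. r \<in> {0<..<1::real}"
    by (rule eventually_at_leftI[of 0]) auto
  fix e :: real assume "e < 0"
  show "\<forall>\<^sub>F r in at_left 1. e < (\<Sum>n. b n * r ^ (2 * n)) * (1 - r)"
    using ev
  proof eventually_elim
    case (elim r)
    have "0 \<le> (\<Sum>n. b n * r ^ (2 * n))"
      using elim b by (intro suminf_nonneg summ) auto
    then have "0 \<le> (\<Sum>n. b n * r ^ (2 * n)) * (1 - r)"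
      using elim by (intro mult_nonneg_nonneg) auto
    then show ?case using \<open>e < 0\<close> by linarith
  qed
next
  have ev: "\<forall>\<^sub>F r in at_left 1. r \<in> {0<..<1::real}"
    by (rule eventually_at_leftI[of 0]) auto
  fix e :: real assume e: "0 < e"
  define \<epsilon> where "\<epsilon> = e / 4"
  have \<epsilon>: "0 < \<epsilon>" using e by (simp add: \<epsilon>_def)
  obtain N0 where N0: "\<And>N. N0 \<le> N \<Longrightarrow> (\<Sum>k\<in>{(N + 1) div 2..N}. b k) \<le> \<epsilon> * real N"
    using blocks[OF \<epsilon>] by (auto simp: eventually_sequentially)
  define D where "D = (\<Sum>k\<le>N0. b k)"
  have D: "0 \<le> D" using b by (simp add: D_def sum_nonneg)
  have B: "(\<Sum>k\<le>N. b k) \<le> D + 2 * \<epsilon> * real N" for N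
  proof (induction N rule: less_induct)
    case (less N)
    show ?case
    proof (cases "N \<le> N0")
      case True
      have "(\<Sum>k\<le>N. b k) \<le> D" unfolding D_def using True b by (intro sum_mono2) auto
      then show ?thesis using \<epsilon> by (simp add: add_increasing2)
    next
      case False
      \<comment> \<open>Chosen so that \<open>m + 1 = (N + 1) div 2\<close>: the block ending at
        \<open>N\<close> begins right after \<open>m\<close>.\<close>
      define m where "m = (N - 1) div 2"
      have m: "m < N" "2 * m \<le> N" "m + 1 = (N + 1) div 2" using False by (auto simp: m_def)
      have "{..N} = {..m} \<union> {(N + 1) div 2..N}" using m by auto
      then have "(\<Sum>k\<le>N. b k) = (\<Sum>k\<le>m. b k) + (\<Sum>k\<in>{(N + 1) div 2..N}. b k)"
        using m(3) by (simp only:) (rule sum.union_disjoint, auto)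
      also have "\<dots> \<le> (D + 2 * \<epsilon> * real m) + \<epsilon> * real N"
        using less[OF m(1)] N0[of N] False by (intro add_mono) auto
      also have "\<dots> \<le> D + 2 * \<epsilon> * real N"
      proof -
        have "\<epsilon> * (2 * real m) \<le> \<epsilon> * real N" using m(2) \<epsilon> by (intro mult_left_mono) auto
        then show ?thesis by simp
      qed
      finally show ?thesis .
    qed
  qed
  \<comment> \<open>A comparison sequence whose partial sums are exactly the bounds in
    \<open>B\<close>.\<close>
  define b' where "b' k = (if k = 0 then D else 2 * \<epsilon>)" for k :: nat
  have b': "(\<Sum>k\<le>N. b' k) = D + 2 * \<epsilon> * real N" for N
    by (induction N) (auto simp: b'_def algebra_simps)
  have bound: "(\<Sum>n. b n * r ^ (2 * n)) \<le> D + 2 * \<epsilon> / (1 - r)" if r: "0 < r" "r < 1" for r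
  proof (rule suminf_le_const)
    show "summable (\<lambda>n. b n * r ^ (2 * n))" using r by (intro summ) auto
    fix M
    have "r\<^sup>2 \<le> r" using r mult_left_mono[of r 1 r] by (simp add: power2_eq_square)
    then have r2: "0 \<le> r\<^sup>2" "r\<^sup>2 \<le> r" "r\<^sup>2 < 1" using r by auto
    have "(\<Sum>n<M. b n * r ^ (2 * n)) \<le> (\<Sum>n\<le>M. b n * (r\<^sup>2) ^ n)"
      unfolding power_mult using b by (intro sum_mono2) auto
    also have "\<dots> \<le> (\<Sum>n\<le>M. b' n * (r\<^sup>2) ^ n)"
      by (rule summation_by_parts_le) (use B b' r2 in auto)
    also have "\<dots> \<le> (\<Sum>n\<le>M. (if n = 0 then D else 0) + 2 * \<epsilon> * (r\<^sup>2) ^ n)"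
      using \<epsilon> by (intro sum_mono) (auto simp: b'_def)
    also have "\<dots> = D + 2 * \<epsilon> * (\<Sum>n\<le>M. (r\<^sup>2) ^ n)"
      by (simp add: sum.distrib sum_distrib_left)
    also have "\<dots> \<le> D + 2 * \<epsilon> * (1 / (1 - r\<^sup>2))"
    proof (intro add_left_mono mult_left_mono)
      have "(\<Sum>n\<le>M. (r\<^sup>2) ^ n) \<le> (\<Sum>n. (r\<^sup>2) ^ n)"
        using r2 by (intro sum_le_suminf summable_geometric) auto
      also have "\<dots> = 1 / (1 - r\<^sup>2)" using r2 by (intro suminf_geometric) auto
      finally show "(\<Sum>n\<le>M. (r\<^sup>2) ^ n) \<le> 1 / (1 - r\<^sup>2)" .
    qed (use \<epsilon> in auto)
    also have "\<dots> \<le> D + 2 * \<epsilon> / (1 - r)"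
      using r r2 \<epsilon> by (simp add: frac_le)
    finally show "(\<Sum>n<M. b n * r ^ (2 * n)) \<le> D + 2 * \<epsilon> / (1 - r)" .
  qed
  have "((\<lambda>r. D * (1 - r) + 2 * \<epsilon>) \<longlongrightarrow> D * (1 - 1) + 2 * \<epsilon>) (at_left 1)"
    by (intro tendsto_intros)
  then have "\<forall>\<^sub>F r in at_left 1. D * (1 - r) + 2 * \<epsilon> < e"
    by (rule order_tendstoD(2)) (use e in \<open>simp add: \<epsilon>_def\<close>)
  then show "\<forall>\<^sub>F r in at_left 1. (\<Sum>n. b n * r ^ (2 * n)) * (1 - r) < e"
    using ev
  proof eventually_elim
    case (elim r)
    have "(\<Sum>n. b n * r ^ (2 * n)) * (1 - r) \<le> (D + 2 * \<epsilon> / (1 - r)) * (1 - r)"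
      using elim bound[of r] by (intro mult_right_mono) auto
    also have "\<dots> = D * (1 - r) + 2 * \<epsilon>" using elim by (simp add: field_simps)
    finally show ?case using elim by simp
  qed
qed

lemma coef_diff:
  assumes "f holomorphic_on ball 0 1" "g holomorphic_on ball 0 1"
  shows "(\<lambda>z. f z - g z) holomorphic_on ball 0 1" "coef (\<lambda>z. f z - g z) n = coef f n - coef g n"
proof -
  have s: "(\<lambda>n. (coef f n - coef g n) * z ^ n) sums (f z - g z)" if "cmod z < 1" for z
    using sums_diff[OF coef_sums[OF assms(1) that] coef_sums[OF assms(2) that]] by (simp add: left_diff_distrib)
  show "(\<lambda>z. f z - g z) holomorphic_on ball 0 1" "coef (\<lambda>z. f z - g z) n = coef f n - coef g n"
    using power_series_ball[OF s] by blast+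
qed

lemma integral_Ioo_power:
  "has_bochner_integral lborel (\<lambda>t. indicator {0<..<1} t * t ^ m) (1 / (real m + 1))"
proof -
  have "has_bochner_integral lborel (\<lambda>t. indicator {0<..<1} t * (real (m + 1) * t ^ m)) 1"
  proof (rule has_bochner_integral_nn_integral)
    have "(\<integral>\<^sup>+t. ennreal (indicator {0<..<1} t * (real (m + 1) * t ^ m)) \<partial>lborel)
       = (\<integral>\<^sup>+t. indicator {0<..<1} t * ennreal (real (m + 1) * t ^ m) \<partial>lborel)"
      by (intro nn_integral_cong) (auto split: split_indicator)
    then show "(\<integral>\<^sup>+t. ennreal (indicator {0<..<1} t * (real (m + 1) * t ^ m)) \<partial>lborel) = ennreal 1"
      using nn_integral_Ioo_power[of 1 m] by simp
  qed (auto split: split_indicator)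
  from has_bochner_integral_divide_zero[OF this, of "real (m + 1)"] show ?thesis
    by (simp add: add.commute)
qed

lemma pmoment_block:
  assumes A: "finite A"
  shows "pmoment (\<lambda>z. of_real s * (\<Sum>n\<in>A. z ^ n)) k = of_real (s * (\<Sum>n\<in>A. 1 / (real k + real n + 1)))"
proof -
  have "has_bochner_integral lborel (\<lambda>t. s * (\<Sum>n\<in>A. indicator {0<..<1} t * t ^ (k + n))) (s * (\<Sum>n\<in>A. 1 / (real (k + n) + 1)))"
    by (intro has_bochner_integral_mult_right has_bochner_integral_sum integral_Ioo_power)
  then have "has_bochner_integral lborel (\<lambda>t. complex_of_real (s * (\<Sum>n\<in>A. indicator {0<..<1} t * t ^ (k + n)))) (of_real (s * (\<Sum>n\<in>A. 1 / (real (k + n) + 1))))"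
    by (rule has_bochner_integral_of_real)
  moreover have "(\<lambda>t. complex_of_real (s * (\<Sum>n\<in>A. indicator {0<..<1} t * t ^ (k + n))))
      = (\<lambda>t. indicator {0<..<1} t *\<^sub>R (of_real t ^ k * (of_real s * (\<Sum>n\<in>A. of_real t ^ n))))"
    by (auto simp: fun_eq_iff sum_distrib_left power_add mult_ac split: split_indicator)
  ultimately have "has_bochner_integral lborel (\<lambda>t. indicator {0<..<1} t *\<^sub>R (complex_of_real t ^ k * (of_real s * (\<Sum>n\<in>A. of_real t ^ n))))
      (of_real (s * (\<Sum>n\<in>A. 1 / (real (k + n) + 1))))"
    by (simp only:)
  then show ?thesis
    unfolding pmoment_def by (simp only: has_bochner_integral_integral_eq of_nat_add)
qed

section \<open>Sufficiency: symbols in b(2, infinity) give compact operators\<close>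

context hilbert_weight
begin

text \<open>Puts the term \<open>|f(0)|^2\<close> and the shifted moments into a single weight, so
  that the Dirichlet space becomes one weighted sequence space.\<close>

definition cweight :: "nat \<Rightarrow> real" where
  "cweight k = (if k = 0 then 1 else (real k)\<^sup>2 * \<mu> (k - 1))"

lemma cweight_nonneg: "0 \<le> cweight k"
  by (simp add: cweight_def \<mu>_nonneg)

lemma energy_eq: "energy a = (\<Sum>k. ennreal (cweight k * (a k)\<^sup>2))"
proof -
  have "(\<Sum>k. ennreal (cweight k * (a k)\<^sup>2)) = (\<Sum>j. ennreal (cweight (j + 1) * (a (j + 1))\<^sup>2)) + (\<Sum>j<1. ennreal (cweight j * (a j)\<^sup>2))"
    by (rule suminf_offset) simp
  also have "\<dots> = energy a"
    unfolding energy_def moment_eq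
    by (subst add.commute, intro arg_cong2[where f = "(+)"] suminf_cong)
      (auto simp: cweight_def \<mu>_nonneg ennreal_mult''[symmetric] power_mult_distrib mult_ac)
  finally show ?thesis ..
qed

lemma \<mu>_pos: "0 < \<mu> n"
proof -
  have "0 < moment w n"
    unfolding moment_eq_V using V_pos by (intro nn_integral_Ioo_pos) auto
  then show ?thesis by (simp add: moment_eq)
qed

lemma dirichlet_space_diff:
  assumes "f \<in> dirichlet_space v" "h \<in> dirichlet_space v"
  shows "(\<lambda>z. f z - h z) \<in> dirichlet_space v"
proof -
  have f: "f holomorphic_on ball 0 1" "h holomorphic_on ball 0 1"
    using assms by (auto simp: dirichlet_space_def)
  have "energy (\<lambda>n. cmod (coef (\<lambda>z. f z - h z) n))
     \<le> (\<Sum>k. 2 * ennreal (cweight k * (cmod (coef f k))\<^sup>2) + 2 * ennreal (cweight k * (cmod (coef h k))\<^sup>2))"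
    unfolding energy_eq coef_diff(2)[OF f]
    by (intro suminf_le ennreal_weighted_norm_le cweight_nonneg) auto
  also have "\<dots> = 2 * energy (\<lambda>n. cmod (coef f n)) + 2 * energy (\<lambda>n. cmod (coef h n))"
    unfolding energy_eq ennreal_suminf_cmult[symmetric] by (rule suminf_add[symmetric]) auto
  also have "\<dots> < top"
    using assms by (simp add: dirichlet_space_iff ennreal_mult_less_top)
  finally show ?thesis using coef_diff(1)[OF f] by (simp add: dirichlet_space_iff)
qed

text \<open>The symbol alone determines the cut-off through \<open>weighted_tail_small\<close>; the
  functions enter only through their energy, at most \<open>C^2\<close>. This is the source of
  uniformity.\<close>

lemma image_tails_uniformly_small:
  assumes g: "g \<in> b_2_infinity" and F: "\<And>n. F n \<in> dirichlet_space v" "\<And>n. dirichlet_norm v (F n) \<le> C"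
    and \<epsilon>: "0 < \<epsilon>"
  shows "\<exists>K. \<forall>n. (\<Sum>k. if K \<le> k then ennreal (cweight k * (cmod (coef (deriv g) k * pmoment (F n) k))\<^sup>2) else 0) \<le> ennreal \<epsilon>"
proof -
  have hg: "g holomorphic_on ball 0 1" using g by (simp add: b_2_infinity_def)
  then have dg: "deriv g holomorphic_on ball 0 1" by (rule holomorphic_deriv) auto
  define b where "b k = (cmod (coef (deriv g) k))\<^sup>2" for k
  have b: "0 \<le> b k" for k by (simp add: b_def)
  obtain C1 where C1: "0 < C1"
    "\<And>a b K \<delta>. (\<And>n. 0 \<le> a n) \<Longrightarrow> (\<And>k. 0 \<le> b k) \<Longrightarrow> 2 \<le> K \<Longrightarrow> 0 \<le> \<delta> \<Longrightarrow>
      (\<And>x. 0 < x \<Longrightarrow> x < 1 \<Longrightarrow>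
        (\<Sum>k. if K \<le> k then ennreal (real k ^ 3 * b k * x ^ (k - 1)) else 0) \<le> ennreal (\<delta> / (1 - x) ^ 4)) \<Longrightarrow>
      (\<Sum>k. if K \<le> k then ennreal ((real k)\<^sup>2 * b k * \<mu> (k - 1)) *
          (\<integral>\<^sup>+t. indicator {0<..<1} t * (ennreal (t ^ k) * majorant a t) \<partial>lborel)\<^sup>2 else 0) \<le> ennreal (C1 * \<delta>) * energy a"
    by (rule image_tail_energy_le) blast
  \<comment> \<open>Adding 1 avoids division by zero when \<open>C = 0\<close>.\<close>
  define \<delta> where "\<delta> = \<epsilon> / (C1 * (C\<^sup>2 + 1))"
  have den: "0 < C1 * (C\<^sup>2 + 1)" using C1(1) by (intro mult_pos_pos) (auto intro: add_nonneg_pos)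
  have \<delta>: "0 < \<delta>" using \<epsilon> den by (simp add: \<delta>_def)
  have "\<exists>K\<ge>2. \<forall>x. 0 < x \<and> x < 1 \<longrightarrow>
    (\<Sum>k. if K \<le> k then ennreal (real k ^ 3 * b k * x ^ (k - 1)) else 0) \<le> ennreal (\<delta> / (1 - x) ^ 4)"
    using g M2_power2(1)[OF dg] by (intro weighted_tail_small b \<delta>) (auto simp: b_2_infinity_iff b_def)
  then obtain K where K: "2 \<le> K" "\<And>x. 0 < x \<Longrightarrow> x < 1 \<Longrightarrow>
    (\<Sum>k. if K \<le> k then ennreal (real k ^ 3 * b k * x ^ (k - 1)) else 0) \<le> ennreal (\<delta> / (1 - x) ^ 4)"
    by blast
  show ?thesis
  proof (intro exI[of _ K] allI)
    fix n
    have Fn: "F n holomorphic_on ball 0 1" using F(1)[of n] by (simp add: dirichlet_space_def)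
    let ?a = "\<lambda>j. cmod (coef (F n) j)"
    have "energy ?a = ennreal ((dirichlet_norm v (F n))\<^sup>2)"
      using dirichlet_norm_power2[OF F(1)] by simp
    also have "\<dots> \<le> ennreal (C\<^sup>2)"
      using F(2)[of n] dirichlet_norm_nonneg by (intro ennreal_leI power_mono) auto
    finally have en: "energy ?a \<le> ennreal (C\<^sup>2)" .
    have "(\<Sum>k. if K \<le> k then ennreal (cweight k * (cmod (coef (deriv g) k * pmoment (F n) k))\<^sup>2) else 0)
      \<le> (\<Sum>k. if K \<le> k then ennreal ((real k)\<^sup>2 * b k * \<mu> (k - 1)) *
          (\<integral>\<^sup>+t. indicator {0<..<1} t * (ennreal (t ^ k) * majorant ?a t) \<partial>lborel)\<^sup>2 else 0)"
    proof (rule suminf_le)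
      fix k
      have "ennreal (cweight k * (cmod (coef (deriv g) k * pmoment (F n) k))\<^sup>2)
         = ennreal ((real k)\<^sup>2 * b k * \<mu> (k - 1)) * ennreal ((cmod (pmoment (F n) k))\<^sup>2)" if "K \<le> k"
        using that K(1) by (subst ennreal_mult''[symmetric]) (auto simp: cweight_def b_def norm_mult power_mult_distrib mult_ac)
      then show "(if K \<le> k then ennreal (cweight k * (cmod (coef (deriv g) k * pmoment (F n) k))\<^sup>2) else 0)
        \<le> (if K \<le> k then ennreal ((real k)\<^sup>2 * b k * \<mu> (k - 1)) *
          (\<integral>\<^sup>+t. indicator {0<..<1} t * (ennreal (t ^ k) * majorant ?a t) \<partial>lborel)\<^sup>2 else 0)"
        using pmoment_le[OF Fn, of k] by (auto intro: mult_left_mono)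
    qed auto
    also have "\<dots> \<le> ennreal (C1 * \<delta>) * energy ?a"
      by (rule C1(2)) (use b K \<delta> in auto)
    also have "\<dots> \<le> ennreal (C1 * \<delta>) * ennreal (C\<^sup>2)"
      by (rule mult_left_mono[OF en]) simp
    also have "\<dots> = ennreal (C1 * \<delta> * C\<^sup>2)" by (simp add: ennreal_mult''[symmetric])
    also have "\<dots> \<le> ennreal \<epsilon>"
    proof (rule ennreal_leI)
      have "C1 * \<delta> * C\<^sup>2 \<le> C1 * \<delta> * (C\<^sup>2 + 1)" using C1(1) \<delta> by (intro mult_left_mono) auto
      also have "\<dots> = (C1 * (C\<^sup>2 + 1)) * \<delta>" by (simp only: mult_ac)
      also have "\<dots> = \<epsilon>"
        unfolding \<delta>_def times_divide_eq_right
        by (rule nonzero_mult_div_cancel_left) (rule less_imp_neq[OF den, symmetric])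
      finally show "C1 * \<delta> * C\<^sup>2 \<le> \<epsilon>" .
    qed
    finally show "(\<Sum>k. if K \<le> k then ennreal (cweight k * (cmod (coef (deriv g) k * pmoment (F n) k))\<^sup>2) else 0) \<le> ennreal \<epsilon>" .
  qed
qed

text \<open>The moments are bounded functionals with a norm independent of \<open>k\<close>, as the
  factor \<open>t ^ k\<close> is at most 1. This makes the extraction of a diagonal subsequence
  possible.\<close>

lemma pmoment_bounded:
  obtains B where "0 \<le> B" "\<forall>f\<in>dirichlet_space v. \<forall>k. cmod (pmoment f k) \<le> B * dirichlet_norm v f"
proof -
  obtain C where C: "0 \<le> C"
    "\<forall>a. (\<forall>n. 0 \<le> a n) \<longrightarrow> (\<integral>\<^sup>+t. indicator {0<..<1} t * majorant a t \<partial>lborel)\<^sup>2 \<le> ennreal C * energy a"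
    by (rule majorant_energy_bounds)
  show ?thesis
  proof (rule that[of "sqrt C"]; (intro ballI allI)?)
    fix f k assume f: "f \<in> dirichlet_space v"
    then have hf: "f holomorphic_on ball 0 1" by (simp add: dirichlet_space_def)
    let ?a = "\<lambda>j. cmod (coef f j)"
    have "ennreal ((cmod (pmoment f k))\<^sup>2) \<le> (\<integral>\<^sup>+t. indicator {0<..<1} t * (ennreal (t ^ k) * majorant ?a t) \<partial>lborel)\<^sup>2"
      by (rule pmoment_le[OF hf])
    also have "\<dots> \<le> (\<integral>\<^sup>+t. indicator {0<..<1} t * majorant ?a t \<partial>lborel)\<^sup>2"
    proof (intro power_mono nn_integral_mono)
      fix t :: real
      show "indicator {0<..<1} t * (ennreal (t ^ k) * majorant ?a t) \<le> indicator {0<..<1} t * majorant ?a t"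
      proof (cases "0 < t \<and> t < 1")
        case True
        then have "ennreal (t ^ k) \<le> ennreal 1" by (intro ennreal_leI power_le_one) auto
        then show ?thesis using True mult_right_mono[of "ennreal (t ^ k)" 1 "majorant ?a t"] by simp
      qed auto
    qed simp
    also have "\<dots> \<le> ennreal C * energy ?a" using C(2) by simp
    also have "\<dots> = ennreal (C * (dirichlet_norm v f)\<^sup>2)"
      using C(1) dirichlet_norm_power2[OF f] by (simp add: ennreal_mult)
    finally have "(cmod (pmoment f k))\<^sup>2 \<le> C * (dirichlet_norm v f)\<^sup>2"
      using C(1) by simp
    then have "sqrt ((cmod (pmoment f k))\<^sup>2) \<le> sqrt (C * (dirichlet_norm v f)\<^sup>2)" by (rule real_sqrt_le_mono)
    then show "cmod (pmoment f k) \<le> sqrt C * dirichlet_norm v f"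
      using dirichlet_norm_nonneg by (simp add: real_sqrt_mult)
  qed (use C(1) in auto)
qed

theorem compact_if_b_2_infinity:
  assumes g: "g \<in> b_2_infinity"
  shows "compact_on_dirichlet v (hilbert_op g)"
proof -
  have hg: "g holomorphic_on ball 0 1" using g by (simp add: b_2_infinity_def)
  then have dg: "deriv g holomorphic_on ball 0 1" by (rule holomorphic_deriv) auto
  define \<beta> where "\<beta> = coef (deriv g)"
  have image: "hilbert_op g f \<in> dirichlet_space v" if f: "f \<in> dirichlet_space v" for f
  proof -
    \<comment> \<open>The compactness criterion is applied to the constant sequence; its tail
      condition yields finiteness of the norm of a single image.\<close>
    have tails: "\<exists>K. \<forall>n::nat. (\<Sum>k. if K \<le> k then ennreal (cweight k * (cmod (\<beta> k * pmoment f k))\<^sup>2) else 0) \<le> ennreal \<epsilon>"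
      if "0 < \<epsilon>" for \<epsilon>
      unfolding \<beta>_def using image_tails_uniformly_small[of g "\<lambda>_. f" "dirichlet_norm v f" \<epsilon>] g f that by simp
    have "(\<Sum>k. ennreal (cweight k * (cmod (\<beta> k * pmoment f k))\<^sup>2)) < top"
      by (rule coefficient_compactness(1)[where x = "\<lambda>_ k. \<beta> k * pmoment f k", OF cweight_nonneg tendsto_const tails])
    then show ?thesis
      using hilbert_op_coef[OF f hg] by (simp add: dirichlet_space_iff energy_eq \<beta>_def)
  qed
  moreover have "\<exists>\<sigma> :: nat \<Rightarrow> nat. \<exists>h\<in>dirichlet_space v. strict_mono \<sigma> \<and>
           (\<lambda>n. dirichlet_norm v (\<lambda>z. hilbert_op g (F (\<sigma> n)) z - h z)) \<longlonglongrightarrow> 0"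
    if F: "\<forall>n. F n \<in> dirichlet_space v" and FC: "\<forall>n. dirichlet_norm v (F n) \<le> C" for F :: "nat \<Rightarrow> complex \<Rightarrow> complex" and C
  proof -
    obtain B where B: "0 \<le> B" "\<forall>f\<in>dirichlet_space v. \<forall>k. cmod (pmoment f k) \<le> B * dirichlet_norm v f"
      using pmoment_bounded by blast
    have bd: "cmod (pmoment (F n) k) \<le> B * C" for n k
      using B F FC order_trans[OF _ mult_left_mono] by blast
    \<comment> \<open>Diagonal extraction is applied to the moments of the functions, so no weak
      limit of the functions themselves has to be identified.\<close>
    obtain \<sigma> :: "nat \<Rightarrow> nat" where \<sigma>: "strict_mono \<sigma>" "\<And>k. k \<in> UNIV \<Longrightarrow> \<exists>l. (\<lambda>n. pmoment (F (\<sigma> n)) k) \<longlonglongrightarrow> l"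
      using function_convergent_subsequence[of "UNIV :: nat set" "\<lambda>n k. pmoment (F n) k" "B * C"] bd by auto
    then obtain l where l: "\<And>k. (\<lambda>n. pmoment (F (\<sigma> n)) k) \<longlonglongrightarrow> l k" by (metis UNIV_I)
    have lb: "cmod (l k) \<le> B * C" for k
      by (rule LIMSEQ_le_const2[OF tendsto_norm[OF l]]) (use bd in auto)
    \<comment> \<open>The candidate limit is built from the limits of the coefficients; the series
      converges in the disc because \<open>l\<close> is bounded.\<close>
    define h where "h z = (\<Sum>k. (\<beta> k * l k) * z ^ k)" for z
    have hs: "(\<lambda>k. (\<beta> k * l k) * z ^ k) sums h z" if z: "cmod z < 1" for z
      unfolding h_def
    proof (rule summable_sums, rule summable_comparison_test)
      show "summable (\<lambda>k. cmod (\<beta> k) * cmod z ^ k * (B * C))"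
        unfolding \<beta>_def by (intro summable_mult2 coef_summable[OF dg]) (use z in auto)
      show "\<exists>N. \<forall>k\<ge>N. norm (\<beta> k * l k * z ^ k) \<le> cmod (\<beta> k) * cmod z ^ k * (B * C)"
      proof (intro exI allI impI)
        fix k
        show "norm (\<beta> k * l k * z ^ k) \<le> cmod (\<beta> k) * cmod z ^ k * (B * C)"
          using mult_left_mono[OF lb[of k], of "cmod (\<beta> k) * cmod z ^ k"] by (simp add: norm_mult norm_power mult_ac)
      qed
    qed
    have hh: "h holomorphic_on ball 0 1" and ch: "coef h k = \<beta> k * l k" for k
      using power_series_ball[OF hs] by auto
    have lim: "(\<lambda>n. \<beta> k * pmoment (F (\<sigma> n)) k) \<longlonglongrightarrow> \<beta> k * l k" for k
      by (intro tendsto_mult tendsto_const l)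
    have tails: "\<exists>K. \<forall>n. (\<Sum>k. if K \<le> k then ennreal (cweight k * (cmod (\<beta> k * pmoment (F (\<sigma> n)) k))\<^sup>2) else 0) \<le> ennreal \<epsilon>"
      if "0 < \<epsilon>" for \<epsilon>
      unfolding \<beta>_def by (rule image_tails_uniformly_small[OF g _ _ that]) (use F FC in auto)
    note cc = coefficient_compactness[where c = cweight and x = "\<lambda>n k. \<beta> k * pmoment (F (\<sigma> n)) k" and l = "\<lambda>k. \<beta> k * l k",
      OF cweight_nonneg lim tails]
    have hD: "h \<in> dirichlet_space v"
      using cc(1) hh by (simp add: dirichlet_space_iff energy_eq ch)
    have "ennreal ((dirichlet_norm v (\<lambda>z. hilbert_op g (F (\<sigma> n)) z - h z))\<^sup>2)
      = (\<Sum>k. ennreal (cweight k * (cmod (\<beta> k * pmoment (F (\<sigma> n)) k - \<beta> k * l k))\<^sup>2))" for n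
    proof -
      have T: "hilbert_op g (F (\<sigma> n)) \<in> dirichlet_space v" using image F by blast
      show ?thesis
        unfolding dirichlet_norm_power2[OF dirichlet_space_diff[OF T hD]] energy_eq
        using hilbert_op_coef[OF _ hg] F by (simp add: coef_diff(2) hh ch \<beta>_def)
    qed
    then have "(\<lambda>n. ennreal ((dirichlet_norm v (\<lambda>z. hilbert_op g (F (\<sigma> n)) z - h z))\<^sup>2)) \<longlonglongrightarrow> ennreal 0"
      using cc(2) by simp
    then have "(\<lambda>n. (dirichlet_norm v (\<lambda>z. hilbert_op g (F (\<sigma> n)) z - h z))\<^sup>2) \<longlonglongrightarrow> 0"
      by (subst (asm) tendsto_ennreal_iff) auto
    then have "(\<lambda>n. dirichlet_norm v (\<lambda>z. hilbert_op g (F (\<sigma> n)) z - h z)) \<longlonglongrightarrow> 0"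
      by (simp add: tendsto_null_power)
    then show ?thesis using \<sigma>(1) hD by blast
  qed
  ultimately show ?thesis unfolding compact_on_dirichlet_def by blast
qed

end

section \<open>Necessity\<close>

context hilbert_weight
begin

text \<open>The factor is the normalisation: each of the \<open>N\<close> monomials has squared norm
  at most \<open>4 * N^2 * \<mu> (N - 1)\<close>, so the block before scaling has squared norm at
  most \<open>4 * N^3 * \<mu> (N - 1)\<close>.\<close>

definition block_fun :: "nat \<Rightarrow> complex \<Rightarrow> complex" where
  "block_fun N z = of_real (1 / sqrt (real N ^ 3 * \<mu> (N - 1))) * (\<Sum>n\<in>{N..<2 * N}. z ^ n)"

lemma block_fun_coef:
  "block_fun N holomorphic_on ball 0 1"
  "coef (block_fun N) k = (if k \<in> {N..<2 * N} then of_real (1 / sqrt (real N ^ 3 * \<mu> (N - 1))) else 0)"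
proof -
  define s where "s = complex_of_real (1 / sqrt (real N ^ 3 * \<mu> (N - 1)))"
  have sums: "(\<lambda>n. (if n \<in> {N..<2 * N} then s else 0) * z ^ n) sums block_fun N z" for z
  proof -
    have "(\<lambda>n. if n \<in> {N..<2 * N} then s * z ^ n else 0) sums (\<Sum>n\<in>{N..<2 * N}. s * z ^ n)"
      by (rule sums_If_finite_set) simp
    also have "(\<lambda>n. if n \<in> {N..<2 * N} then s * z ^ n else 0) = (\<lambda>n. (if n \<in> {N..<2 * N} then s else 0) * z ^ n)"
      by auto
    finally show ?thesis by (simp only: block_fun_def s_def sum_distrib_left)
  qed
  show "block_fun N holomorphic_on ball 0 1" by (rule power_series_ball(1)[OF sums])
  show "coef (block_fun N) k = (if k \<in> {N..<2 * N} then of_real (1 / sqrt (real N ^ 3 * \<mu> (N - 1))) else 0)"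
    using power_series_ball(2)[OF sums] by (simp add: s_def)
qed

lemma block_fun_norm:
  assumes N: "N \<ge> 1"
  shows "block_fun N \<in> dirichlet_space v" "dirichlet_norm v (block_fun N) \<le> 2"
proof -
  define s where "s = 1 / sqrt (real N ^ 3 * \<mu> (N - 1))"
  have s2: "s\<^sup>2 = 1 / (real N ^ 3 * \<mu> (N - 1))"
    using \<mu>_pos[of "N - 1"] N by (simp add: s_def power_divide)
  have "energy (\<lambda>n. cmod (coef (block_fun N) n)) = (\<Sum>k. if k \<in> {N..<2 * N} then ennreal (cweight k * s\<^sup>2) else 0)"
    unfolding energy_eq block_fun_coef(2) by (intro suminf_cong) (simp add: s_def norm_divide power_divide)
  also have "\<dots> = (\<Sum>k\<in>{N..<2 * N}. ennreal (cweight k * s\<^sup>2))"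
    by (rule sums_unique[symmetric], rule sums_If_finite_set) simp
  also have "\<dots> = ennreal (\<Sum>k\<in>{N..<2 * N}. cweight k * s\<^sup>2)"
    using cweight_nonneg by (intro sum_ennreal) auto
  also have "(\<Sum>k\<in>{N..<2 * N}. cweight k * s\<^sup>2) \<le> (\<Sum>k\<in>{N..<2 * N}. 4 / real N)"
  proof (rule sum_mono)
    fix k assume k: "k \<in> {N..<2 * N}"
    have "cweight k = (real k)\<^sup>2 * \<mu> (k - 1)" using k N by (auto simp: cweight_def)
    also have "\<dots> \<le> (2 * real N)\<^sup>2 * \<mu> (N - 1)"
      using k \<mu>_nonneg by (intro mult_mono power_mono \<mu>_antimono) auto
    finally have "cweight k * s\<^sup>2 \<le> (2 * real N)\<^sup>2 * \<mu> (N - 1) * s\<^sup>2" by (rule mult_right_mono) simp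
    also have "\<dots> = 4 / real N"
      unfolding s2 using \<mu>_pos[of "N - 1"] N by (simp add: power2_eq_square power3_eq_cube)
    finally show "cweight k * s\<^sup>2 \<le> 4 / real N" .
  qed
  also have "(\<Sum>k\<in>{N..<2 * N}. 4 / real N) = 2\<^sup>2" using N by simp
  finally have en: "energy (\<lambda>n. cmod (coef (block_fun N) n)) \<le> ennreal (2\<^sup>2)" by (simp add: ennreal_leI)
  show D: "block_fun N \<in> dirichlet_space v"
    unfolding dirichlet_space_iff using block_fun_coef(1) le_less_trans[OF en ennreal_less_top] by blast
  have "(dirichlet_norm v (block_fun N))\<^sup>2 \<le> 2\<^sup>2"
    using en unfolding dirichlet_norm_power2[OF D, symmetric] by (simp del: ennreal_numeral)
  then show "dirichlet_norm v (block_fun N) \<le> 2" by (rule power2_le_imp_le) simp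
qed

text \<open>For \<open>k \<le> N\<close> every one of the \<open>N\<close> reciprocals
  \<open>1 / (k + n + 1)\<close> is at least \<open>1 / (3 * N)\<close>. All coefficients have the
  same sign, so no cancellation occurs.\<close>

lemma block_fun_pmoment:
  assumes N: "N \<ge> 1" and k: "k \<le> N"
  shows "1 / (3 * sqrt (real N ^ 3 * \<mu> (N - 1))) \<le> cmod (pmoment (block_fun N) k)"
proof -
  define s where "s = 1 / sqrt (real N ^ 3 * \<mu> (N - 1))"
  have s: "0 < s" using \<mu>_pos[of "N - 1"] N by (simp add: s_def)
  have "(\<Sum>n\<in>{N..<2 * N}. 1 / (3 * real N)) \<le> (\<Sum>n\<in>{N..<2 * N}. 1 / (real k + real n + 1))"
    using N k by (intro sum_mono divide_left_mono) auto
  then have "1 / 3 \<le> (\<Sum>n\<in>{N..<2 * N}. 1 / (real k + real n + 1))" using N by simp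
  then have "s * (1 / 3) \<le> s * (\<Sum>n\<in>{N..<2 * N}. 1 / (real k + real n + 1))"
    using s by (intro mult_left_mono) auto
  also have "\<dots> \<le> cmod (pmoment (block_fun N) k)"
  proof -
    have "block_fun N = (\<lambda>z. of_real s * (\<Sum>n\<in>{N..<2 * N}. z ^ n))"
      by (simp add: fun_eq_iff block_fun_def s_def)
    then have "pmoment (block_fun N) k = of_real (s * (\<Sum>n\<in>{N..<2 * N}. 1 / (real k + real n + 1)))"
      using pmoment_block[of "{N..<2 * N}" s k] by simp
    then show ?thesis by (metis abs_ge_self norm_of_real)
  qed
  finally show ?thesis by (simp add: s_def)
qed

text \<open>For \<open>N / 2 \<le> k \<le> N\<close> monotonicity of the moments gives
  \<open>cweight k \<ge> (N / 2)^2 * \<mu> (N - 1)\<close>. The moment cancels against the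
  normalisation of the block, and the remaining numbers are
  \<open>9 * 4 * N^3 / N^2 = 36 * N\<close>.\<close>

lemma block_sum_le:
  assumes g: "g holomorphic_on ball 0 1" and N: "N \<ge> 1"
  shows "ennreal (\<Sum>k\<in>{(N + 1) div 2..N}. (cmod (coef (deriv g) k))\<^sup>2) \<le> ennreal (36 * real N) *
    (\<Sum>k. if (N + 1) div 2 \<le> k then ennreal (cweight k * (cmod (coef (hilbert_op g (block_fun N)) k))\<^sup>2) else 0)"
proof -
  define b where "b k = (cmod (coef (deriv g) k))\<^sup>2" for k
  define c where "c k = cweight k * (cmod (coef (hilbert_op g (block_fun N)) k))\<^sup>2" for k
  have le: "b k \<le> 36 * real N * c k" if k: "k \<in> {(N + 1) div 2..N}" for k
  proof -
    have k': "N \<le> 2 * k" "1 \<le> k" "k \<le> N" using k N by auto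
    have m: "0 < \<mu> (N - 1)" by (rule \<mu>_pos)
    have "(real N / 2)\<^sup>2 * \<mu> (N - 1) \<le> (real k)\<^sup>2 * \<mu> (k - 1)"
      using k' \<mu>_nonneg by (intro mult_mono power_mono \<mu>_antimono) auto
    then have 1: "(real N / 2)\<^sup>2 * \<mu> (N - 1) \<le> cweight k" using k' by (simp add: cweight_def)
    have "(1 / (3 * sqrt (real N ^ 3 * \<mu> (N - 1))))\<^sup>2 \<le> (cmod (pmoment (block_fun N) k))\<^sup>2"
      using block_fun_pmoment[OF N k'(3)] m by (intro power_mono) auto
    then have 2: "1 / (9 * (real N ^ 3 * \<mu> (N - 1))) \<le> (cmod (pmoment (block_fun N) k))\<^sup>2"
      using m by (simp add: power_divide power_mult_distrib)
    have "b k = 36 * real N * (((real N / 2)\<^sup>2 * \<mu> (N - 1)) * (b k * (1 / (9 * (real N ^ 3 * \<mu> (N - 1))))))"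
      using m N by (simp add: power2_eq_square power3_eq_cube)
    also have "\<dots> \<le> 36 * real N * (cweight k * (b k * (cmod (pmoment (block_fun N) k))\<^sup>2))"
      using m by (intro mult_left_mono mult_mono[OF 1] 2 cweight_nonneg) (auto simp: b_def)
    also have "cweight k * (b k * (cmod (pmoment (block_fun N) k))\<^sup>2) = c k"
      using hilbert_op_coef(2)[OF block_fun_norm(1)[OF N] g, of k]
      by (simp add: c_def b_def norm_mult power_mult_distrib)
    finally show ?thesis .
  qed
  have c: "0 \<le> c k" for k by (simp add: c_def cweight_nonneg)
  have "ennreal (\<Sum>k\<in>{(N + 1) div 2..N}. b k) \<le> ennreal (\<Sum>k\<in>{(N + 1) div 2..N}. 36 * real N * c k)"
    by (intro ennreal_leI sum_mono le)
  also have "\<dots> = ennreal (36 * real N) * (\<Sum>k\<in>{(N + 1) div 2..N}. ennreal (c k))"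
    using c by (subst sum_ennreal) (auto simp: sum_distrib_left[symmetric] ennreal_mult'' sum_nonneg)
  also have "(\<Sum>k\<in>{(N + 1) div 2..N}. ennreal (c k)) = (\<Sum>k\<in>{(N + 1) div 2..N}. if (N + 1) div 2 \<le> k then ennreal (c k) else 0)"
    by (intro sum.cong) auto
  also have "\<dots> \<le> (\<Sum>k. if (N + 1) div 2 \<le> k then ennreal (c k) else 0)"
    by (intro sum_le_suminf) auto
  finally show ?thesis unfolding b_def c_def by (simp add: mult_left_mono)
qed

text \<open>Otherwise some sequence of blocks has images with large tails beyond
  \<open>N / 2\<close>. A subsequence of the images converges to some \<open>h\<close> in norm, and
  since the starting index of the tails tends to infinity, the tails of \<open>h\<close> vanish
  there, a contradiction.\<close>

lemma tail_image_blocks_small: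
  assumes g: "g holomorphic_on ball 0 1" and comp: "compact_on_dirichlet v (hilbert_op g)" and \<epsilon>: "0 < \<epsilon>"
  shows "\<forall>\<^sub>F N in sequentially.
    (\<Sum>k. if (N + 1) div 2 \<le> k then ennreal (cweight k * (cmod (coef (hilbert_op g (block_fun N)) k))\<^sup>2) else 0) \<le> ennreal \<epsilon>"
    (is "\<forall>\<^sub>F N in sequentially. ?D N \<le> ennreal \<epsilon>")
proof (rule ccontr)
  assume "\<not> ?thesis"
  then obtain r :: "nat \<Rightarrow> nat" where r: "strict_mono r" "\<And>n. \<not> ?D (r n) \<le> ennreal \<epsilon>"
    using not_eventually_sequentiallyD by blast
  have T: "\<forall>f\<in>dirichlet_space v. hilbert_op g f \<in> dirichlet_space v"
    and seq: "\<And>F :: nat \<Rightarrow> complex \<Rightarrow> complex. (\<forall>n. F n \<in> dirichlet_space v) \<and> (\<exists>C. \<forall>n. dirichlet_norm v (F n) \<le> C) \<Longrightarrow>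
        (\<exists>\<sigma> :: nat \<Rightarrow> nat. \<exists>h\<in>dirichlet_space v. strict_mono \<sigma> \<and>
           (\<lambda>n. dirichlet_norm v (\<lambda>z. hilbert_op g (F (\<sigma> n)) z - h z)) \<longlonglongrightarrow> 0)"
    using comp unfolding compact_on_dirichlet_def by blast+
  \<comment> \<open>The sequence is shifted by one because \<open>r 0\<close> may be 0, where the
    bounds on \<open>block_fun\<close> do not apply.\<close>
  have r1: "r (Suc n) \<ge> Suc n" for n using strict_mono_imp_increasing[OF r(1)] by blast
  have r1': "r (Suc n) \<ge> 1" for n using r1[of n] by linarith
  have blk: "block_fun (r (Suc n)) \<in> dirichlet_space v" "dirichlet_norm v (block_fun (r (Suc n))) \<le> 2" for n
    using block_fun_norm[OF r1'[of n]] .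
  obtain \<sigma> :: "nat \<Rightarrow> nat" and h where \<sigma>: "strict_mono \<sigma>" and h: "h \<in> dirichlet_space v"
    and lim: "(\<lambda>n. dirichlet_norm v (\<lambda>z. hilbert_op g (block_fun (r (Suc (\<sigma> n)))) z - h z)) \<longlonglongrightarrow> 0"
    using seq[of "\<lambda>n. block_fun (r (Suc n))"] blk by blast
  define N where "N n = r (Suc (\<sigma> n))" for n
  define d where "d n = dirichlet_norm v (\<lambda>z. hilbert_op g (block_fun (N n)) z - h z)" for n
  have Ninc: "n \<le> N n" for n
    using r1[of "\<sigma> n"] strict_mono_imp_increasing[OF \<sigma>, of n] unfolding N_def by linarith
  have hh: "h holomorphic_on ball 0 1" and "energy (\<lambda>n. cmod (coef h n)) < top"
    using h by (auto simp: dirichlet_space_iff)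
  then have "(\<Sum>k. ennreal (cweight k * (cmod (coef h k))\<^sup>2)) \<noteq> top" by (simp add: energy_eq)
  then have "summable (\<lambda>k. cweight k * (cmod (coef h k))\<^sup>2)"
    by (intro summable_suminf_not_top) (auto simp: cweight_nonneg)
  then obtain M where M: "\<And>n. n \<ge> M \<Longrightarrow> norm (\<Sum>i. cweight (i + n) * (cmod (coef h (i + n)))\<^sup>2) < \<epsilon> / 8"
    using suminf_exist_split[of "\<epsilon> / 8" "\<lambda>k. cweight k * (cmod (coef h k))\<^sup>2"] \<epsilon> by auto
  have htail: "(\<Sum>k. if n \<le> k then ennreal (cweight k * (cmod (coef h k))\<^sup>2) else 0) \<le> ennreal (\<epsilon> / 8)" if "n \<ge> M" for n
  proof -
    have "(\<Sum>i. ennreal (cweight (i + n) * (cmod (coef h (i + n)))\<^sup>2)) = ennreal (\<Sum>i. cweight (i + n) * (cmod (coef h (i + n)))\<^sup>2)"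
      using \<open>summable (\<lambda>k. cweight k * (cmod (coef h k))\<^sup>2)\<close> cweight_nonneg
      by (intro suminf_ennreal2) (auto simp: summable_iff_shift[of "\<lambda>k. cweight k * (cmod (coef h k))\<^sup>2"])
    also have "\<dots> \<le> ennreal (\<epsilon> / 8)" using M[OF that] by (intro ennreal_leI) auto
    finally show ?thesis by (simp add: suminf_from)
  qed
  have "(\<lambda>n. (d n)\<^sup>2) \<longlonglongrightarrow> 0\<^sup>2" unfolding d_def N_def by (intro tendsto_power lim)
  then have "\<forall>\<^sub>F n in sequentially. (d n)\<^sup>2 < \<epsilon> / 8"
    by (rule order_tendstoD(2)) (use \<epsilon> in simp)
  then obtain n0 where n0: "\<And>n. n \<ge> n0 \<Longrightarrow> (d n)\<^sup>2 < \<epsilon> / 8" by (auto simp: eventually_sequentially)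
  \<comment> \<open>From \<open>n \<le> N n\<close> the choice \<open>2 * M\<close> ensures that the
    tail of index \<open>(N n + 1) div 2\<close> starts beyond \<open>M\<close>.\<close>
  define n where "n = max n0 (2 * M)"
  have n: "(d n)\<^sup>2 < \<epsilon> / 8" "M \<le> (N n + 1) div 2"
    using n0[of n] Ninc[of n] by (auto simp: n_def)
  define t where "t = hilbert_op g (block_fun (N n))"
  have tD: "t \<in> dirichlet_space v" unfolding t_def N_def using T blk by blast
  then have ht: "t holomorphic_on ball 0 1" by (simp add: dirichlet_space_def)
  have "?D (N n) \<le> (\<Sum>k. 2 * ennreal (cweight k * (cmod (coef t k - coef h k))\<^sup>2)
      + 2 * (if (N n + 1) div 2 \<le> k then ennreal (cweight k * (cmod (coef h k))\<^sup>2) else 0))"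
    unfolding t_def[symmetric]
  proof (rule suminf_le)
    fix k
    have "ennreal (cweight k * (cmod (coef t k))\<^sup>2) \<le> 2 * ennreal (cweight k * (cmod (coef t k - coef h k))\<^sup>2) + 2 * ennreal (cweight k * (cmod (coef h k))\<^sup>2)"
      \<comment> \<open>The coefficient of \<open>t\<close> is written as the difference
        \<open>(coef t k - coef h k) - (- coef h k)\<close>.\<close>
      using ennreal_weighted_norm_le[OF cweight_nonneg, of k "coef t k - coef h k" "- coef h k"] by simp
    then show "(if (N n + 1) div 2 \<le> k then ennreal (cweight k * (cmod (coef t k))\<^sup>2) else 0) \<le>
      2 * ennreal (cweight k * (cmod (coef t k - coef h k))\<^sup>2)
      + 2 * (if (N n + 1) div 2 \<le> k then ennreal (cweight k * (cmod (coef h k))\<^sup>2) else 0)" by simp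
  qed auto
  also have "\<dots> = 2 * (\<Sum>k. ennreal (cweight k * (cmod (coef t k - coef h k))\<^sup>2))
      + 2 * (\<Sum>k. if (N n + 1) div 2 \<le> k then ennreal (cweight k * (cmod (coef h k))\<^sup>2) else 0)"
    unfolding ennreal_suminf_cmult[symmetric] by (rule suminf_add[symmetric]) auto
  also have "(\<Sum>k. ennreal (cweight k * (cmod (coef t k - coef h k))\<^sup>2)) = ennreal ((d n)\<^sup>2)"
    unfolding d_def t_def[symmetric] dirichlet_norm_power2[OF dirichlet_space_diff[OF tD h]] energy_eq
    by (simp add: coef_diff(2)[OF ht hh])
  also have "2 * ennreal ((d n)\<^sup>2) + 2 * (\<Sum>k. if (N n + 1) div 2 \<le> k then ennreal (cweight k * (cmod (coef h k))\<^sup>2) else 0)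
      \<le> 2 * ennreal (\<epsilon> / 8) + 2 * ennreal (\<epsilon> / 8)"
    using n htail by (intro add_mono mult_left_mono ennreal_leI) auto
  also have "\<dots> = ennreal (\<epsilon> / 2)"
    using \<epsilon> by (simp add: numeral_mult_ennreal ennreal_plus[symmetric] del: ennreal_plus)
  also have "\<dots> \<le> ennreal \<epsilon>" using \<epsilon> by (intro ennreal_leI) auto
  finally show False using r(2)[of "Suc (\<sigma> n)"] unfolding N_def by contradiction
qed

theorem b_2_infinity_if_compact:
  assumes g: "g holomorphic_on ball 0 1" and comp: "compact_on_dirichlet v (hilbert_op g)"
  shows "g \<in> b_2_infinity"
proof -
  have dg: "deriv g holomorphic_on ball 0 1" using g by (rule holomorphic_deriv) auto
  have "((\<lambda>r. (\<Sum>n. (cmod (coef (deriv g) n))\<^sup>2 * r ^ (2 * n)) * (1 - r)) \<longlongrightarrow> 0) (at_left 1)"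
  proof (rule block_sums_imp_radial_limit)
    fix \<epsilon> :: real assume \<epsilon>: "0 < \<epsilon>"
    \<comment> \<open>Compensates the factor \<open>36 * N\<close> of
      \<open>block_sum_le\<close>.\<close>
    then have "0 < \<epsilon> / 36" by simp
    from tail_image_blocks_small[OF g comp this] eventually_ge_at_top[of 1]
    show "\<forall>\<^sub>F N in sequentially. (\<Sum>k\<in>{(N + 1) div 2..N}. (cmod (coef (deriv g) k))\<^sup>2) \<le> \<epsilon> * real N"
    proof eventually_elim
      case (elim N)
      have "ennreal (\<Sum>k\<in>{(N + 1) div 2..N}. (cmod (coef (deriv g) k))\<^sup>2) \<le> ennreal (36 * real N) * ennreal (\<epsilon> / 36)"
        by (rule order_trans[OF block_sum_le[OF g elim(2)] mult_left_mono[OF elim(1)]]) simp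
      also have "\<dots> = ennreal (\<epsilon> * real N)" using \<epsilon> by (simp add: ennreal_mult''[symmetric] mult.commute)
      finally show ?case using \<epsilon> by (simp add: ennreal_le_iff)
    qed
  qed (use M2_power2(1)[OF dg] in auto)
  then show ?thesis using g by (simp add: b_2_infinity_iff)
qed

end

theorem proposition10:
  fixes g :: "complex \<Rightarrow> complex" and v :: "complex \<Rightarrow> real"
  assumes "g holomorphic_on ball 0 1"
    and "v \<in> D_hat"
    and "(SUP r\<in>{0<..<1::real}.
            ennsqrt (\<integral>\<^sup>+s\<in>{r<..<1}. ennreal (vhat v s / (1 - s)\<^sup>2) \<partial>lebesgue) *
            ennsqrt (\<integral>\<^sup>+s\<in>{0<..<r}. ennreal (1 / vhat v s) \<partial>lebesgue)) < \<infinity>"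
    and "(SUP r\<in>{0<..<1::real}.
            ennsqrt (\<integral>\<^sup>+s\<in>{0<..<r}. ennreal (vhat v s / (1 - s) ^ 4) \<partial>lebesgue) *
            ennsqrt (\<integral>\<^sup>+s\<in>{r<..<1}. ennreal ((1 - s)\<^sup>2 / vhat v s) \<partial>lebesgue)) < \<infinity>"
  shows "compact_on_dirichlet v (hilbert_op g) \<longleftrightarrow> g \<in> b_2_infinity"
proof -
  have "radial_weight v" using assms(2) by (simp add: D_hat_def)
  then obtain w where w: "w \<in> borel_measurable borel" "\<And>r. 0 \<le> w r"
    "(\<lambda>r. indicator {0<..<1} r * v (of_real r)) \<in> borel_measurable lebesgue"
    "AE r in lborel. 0 < r \<and> r < 1 \<longrightarrow> v (of_real r) = w r"
    "AE z in lborel. cmod z < 1 \<longrightarrow> v z = w (cmod z)"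
    by (rule radial_weight_borel) blast
  interpret hilbert_weight v w
    by unfold_locales (use assms w in auto)
  show ?thesis
    using b_2_infinity_if_compact[OF assms(1)] compact_if_b_2_infinity by blast
qed

end
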